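(* Let $\mathcal{A}$ be a small additive category and let $S$ be an arbitrary set of morphisms of $\mathcal{A}$. Let $\mathcal{D}\subset K^b(\mathcal{A})$ be the triangulated subcategory generated by the cones of the elements of $S$, and let $l:K^b(\mathcal{A})\to \mathcal{E}=K^b(\mathcal{A})/\mathcal{D}$ be the Verdier localization functor. Let $\mathcal{A}[S^{-1}]_{add}\subset\mathcal{E}$ be the full subcategory whose objects are those of $\mathcal{A}$ (regarded as complexes concentrated in degree $0$), and let $u:\mathcal{A}\to\mathcal{A}[S^{-1}]_{add}$ be the functor induced by $l$. Then $u$ has the following universal property: an additive functor $F:\mathcal{A}\to\mathcal{A}'$ to an additive category $\mathcal{A}'$ factorizes through $u$ (i.e. $F=G\circ u$ for some functor $G:\mathcal{A}[S^{-1}]_{add}\to\mathcal{A}'$) if and only if $F$ sends all elements of $S$ to isomorphisms; and if it does, then such a factorization is unique.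
   Context: $K^b(\mathcal{A})$ is the homotopy category of bounded (cohomological) complexes over $\mathcal{A}$. The cone of a morphism $s:X\to Y$ of $\mathcal{A}$ is the complex $X\xrightarrow{s}Y$ with $Y$ in degree $0$ and $X$ in degree $-1$. The triangulated subcategory of a triangulated category generated by a class of objects is the smallest full strict (closed under isomorphisms) triangulated subcategory containing this class. The Verdier quotient $\mathcal{E}=K^b(\mathcal{A})/\mathcal{D}$ has the same objects as $K^b(\mathcal{A})$. *)

theory Defs
  imports "HOL-Algebra.Group"
begin

section \<open>Categories and functors\<close>

record ('o, 'm) category =
  Obj :: "'o set"
  Arr :: "'m set"
  Dom :: "'m \<Rightarrow> 'o"
  Cod :: "'m \<Rightarrow> 'o"
  Ide :: "'o \<Rightarrow> 'm"
  Comp :: "'m \<Rightarrow> 'm \<Rightarrow> 'm"  (infixr "\<cdot>\<index>" 70)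

definition Hom :: "('o, 'm, 'z) category_scheme \<Rightarrow> 'o \<Rightarrow> 'o \<Rightarrow> 'm set" where
  "Hom C X Y = {f \<in> Arr C. Dom C f = X \<and> Cod C f = Y}"

locale category =
  fixes C :: "('o, 'm, 'z) category_scheme" (structure)
  assumes Dom_Obj: "f \<in> Arr C \<Longrightarrow> Dom C f \<in> Obj C"
    and Cod_Obj: "f \<in> Arr C \<Longrightarrow> Cod C f \<in> Obj C"
    and Ide_Hom: "X \<in> Obj C \<Longrightarrow> Ide C X \<in> Hom C X X"
    and Comp_Hom: "f \<in> Hom C X Y \<Longrightarrow> g \<in> Hom C Y Z \<Longrightarrow> g \<cdot> f \<in> Hom C X Z"
    and Comp_Ide_left: "f \<in> Hom C X Y \<Longrightarrow> Ide C Y \<cdot> f = f"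
    and Comp_Ide_right: "f \<in> Hom C X Y \<Longrightarrow> f \<cdot> Ide C X = f"
    and Comp_assoc:
      "f \<in> Hom C W X \<Longrightarrow> g \<in> Hom C X Y \<Longrightarrow> h \<in> Hom C Y Z \<Longrightarrow> (h \<cdot> g) \<cdot> f = h \<cdot> (g \<cdot> f)"

definition iso_arr :: "('o, 'm, 'z) category_scheme \<Rightarrow> 'm \<Rightarrow> bool" where
  "iso_arr C f \<longleftrightarrow> f \<in> Arr C \<and>
     (\<exists>g \<in> Hom C (Cod C f) (Dom C f).
        g \<cdot>\<^bsub>C\<^esub> f = Ide C (Dom C f) \<and> f \<cdot>\<^bsub>C\<^esub> g = Ide C (Cod C f))"

definition isomorphic :: "('o, 'm, 'z) category_scheme \<Rightarrow> 'o \<Rightarrow> 'o \<Rightarrow> bool" where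
  "isomorphic C X Y \<longleftrightarrow> (\<exists>f \<in> Hom C X Y. iso_arr C f)"

definition is_zero_obj :: "('o, 'm, 'z) category_scheme \<Rightarrow> 'o \<Rightarrow> bool" where
  "is_zero_obj C Z \<longleftrightarrow>
     Z \<in> Obj C \<and> (\<forall>X \<in> Obj C. (\<exists>!f. f \<in> Hom C X Z) \<and> (\<exists>!f. f \<in> Hom C Z X))"

definition full_subcat :: "('o, 'm, 'z) category_scheme \<Rightarrow> 'o set \<Rightarrow> ('o, 'm, 'z) category_scheme" where
  "full_subcat C P = C\<lparr>Obj := P, Arr := {f \<in> Arr C. Dom C f \<in> P \<and> Cod C f \<in> P}\<rparr>"

record ('o, 'm, 'p, 'n) functor_data =
  on_obj :: "'o \<Rightarrow> 'p"
  on_arr :: "'m \<Rightarrow> 'n"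

locale is_functor =
  dom: category C + cod: category D
  for C :: "('o, 'm, 'y) category_scheme" and D :: "('p, 'n, 'z) category_scheme" +
  fixes F :: "('o, 'm, 'p, 'n) functor_data"
  assumes on_obj_Obj: "X \<in> Obj C \<Longrightarrow> on_obj F X \<in> Obj D"
    and on_arr_Hom: "f \<in> Hom C X Y \<Longrightarrow> on_arr F f \<in> Hom D (on_obj F X) (on_obj F Y)"
    and on_arr_Ide: "X \<in> Obj C \<Longrightarrow> on_arr F (Ide C X) = Ide D (on_obj F X)"
    and on_arr_Comp: "f \<in> Hom C X Y \<Longrightarrow> g \<in> Hom C Y Z \<Longrightarrow>
      on_arr F (g \<cdot>\<^bsub>C\<^esub> f) = on_arr F g \<cdot>\<^bsub>D\<^esub> on_arr F f"

definition functor_comp ::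
  "('p, 'n, 'q, 'k) functor_data \<Rightarrow> ('o, 'm, 'p, 'n) functor_data \<Rightarrow> ('o, 'm, 'q, 'k) functor_data" where
  "functor_comp G F = \<lparr>on_obj = on_obj G \<circ> on_obj F, on_arr = on_arr G \<circ> on_arr F\<rparr>"

text \<open>Equality of functors out of C: the values of the underlying HOL functions
  outside C carry no information.\<close>

definition functor_eq ::
  "('o, 'm, 'z) category_scheme \<Rightarrow> ('o, 'm, 'p, 'n) functor_data \<Rightarrow> ('o, 'm, 'p, 'n) functor_data \<Rightarrow> bool" where
  "functor_eq C F G \<longleftrightarrow>
     (\<forall>X \<in> Obj C. on_obj F X = on_obj G X) \<and> (\<forall>f \<in> Arr C. on_arr F f = on_arr G f)"


section \<open>Additive categories\<close>

record ('o, 'm) additive_cat = "('o, 'm) category" +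
  Add :: "'m \<Rightarrow> 'm \<Rightarrow> 'm"  (infixl "\<boxplus>\<index>" 65)
  Zero :: "'o \<Rightarrow> 'o \<Rightarrow> 'm"

definition hom_group :: "('o, 'm, 'z) additive_cat_scheme \<Rightarrow> 'o \<Rightarrow> 'o \<Rightarrow> 'm monoid" where
  "hom_group A X Y = \<lparr>carrier = Hom A X Y, mult = Add A, one = Zero A X Y\<rparr>"

definition neg :: "('o, 'm, 'z) additive_cat_scheme \<Rightarrow> 'm \<Rightarrow> 'm" where
  "neg A f = inv\<^bsub>hom_group A (Dom A f) (Cod A f)\<^esub> f"

record ('o, 'm) biproduct =
  bsum :: 'o
  in1 :: 'm
  in2 :: 'm
  pr1 :: 'm
  pr2 :: 'm

definition is_biproduct ::
  "('o, 'm, 'z) additive_cat_scheme \<Rightarrow> 'o \<Rightarrow> 'o \<Rightarrow> ('o, 'm) biproduct \<Rightarrow> bool" where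
  "is_biproduct A X Y B \<longleftrightarrow>
     bsum B \<in> Obj A \<and>
     in1 B \<in> Hom A X (bsum B) \<and> in2 B \<in> Hom A Y (bsum B) \<and>
     pr1 B \<in> Hom A (bsum B) X \<and> pr2 B \<in> Hom A (bsum B) Y \<and>
     pr1 B \<cdot>\<^bsub>A\<^esub> in1 B = Ide A X \<and> pr2 B \<cdot>\<^bsub>A\<^esub> in2 B = Ide A Y \<and>
     pr1 B \<cdot>\<^bsub>A\<^esub> in2 B = Zero A Y X \<and> pr2 B \<cdot>\<^bsub>A\<^esub> in1 B = Zero A X Y \<and>
     (in1 B \<cdot>\<^bsub>A\<^esub> pr1 B) \<boxplus>\<^bsub>A\<^esub> (in2 B \<cdot>\<^bsub>A\<^esub> pr2 B) = Ide A (bsum B)"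

locale additive_category = category A
  for A :: "('o, 'm, 'z) additive_cat_scheme" (structure) +
  assumes comm_group_Hom: "X \<in> Obj A \<Longrightarrow> Y \<in> Obj A \<Longrightarrow> comm_group (hom_group A X Y)"
    and Comp_Add_left: "f \<in> Hom A X Y \<Longrightarrow> g \<in> Hom A Y Z \<Longrightarrow> g' \<in> Hom A Y Z \<Longrightarrow>
      (g \<boxplus> g') \<cdot> f = (g \<cdot> f) \<boxplus> (g' \<cdot> f)"
    and Comp_Add_right: "f \<in> Hom A X Y \<Longrightarrow> f' \<in> Hom A X Y \<Longrightarrow> g \<in> Hom A Y Z \<Longrightarrow>
      g \<cdot> (f \<boxplus> f') = (g \<cdot> f) \<boxplus> (g \<cdot> f')"
    and ex_zero_obj: "\<exists>Z. is_zero_obj A Z"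
    and ex_biproduct: "X \<in> Obj A \<Longrightarrow> Y \<in> Obj A \<Longrightarrow> \<exists>B. is_biproduct A X Y B"

locale additive_functor = is_functor A B F + dom: additive_category A + cod: additive_category B
  for A :: "('o, 'm, 'y) additive_cat_scheme" and B :: "('p, 'n, 'z) additive_cat_scheme"
    and F :: "('o, 'm, 'p, 'n) functor_data" +
  assumes on_arr_Add: "f \<in> Hom A X Y \<Longrightarrow> g \<in> Hom A X Y \<Longrightarrow>
    on_arr F (f \<boxplus>\<^bsub>A\<^esub> g) = on_arr F f \<boxplus>\<^bsub>B\<^esub> on_arr F g"

definition zero_obj :: "('o, 'm, 'z) category_scheme \<Rightarrow> 'o" where
  "zero_obj C = (SOME Z. is_zero_obj C Z)"

definition biprod :: "('o, 'm, 'z) additive_cat_scheme \<Rightarrow> 'o \<Rightarrow> 'o \<Rightarrow> ('o, 'm) biproduct" where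
  "biprod A X Y = (SOME B. is_biproduct A X Y B)"


section \<open>Triangulated subcategories and Verdier quotients\<close>

text \<open>The data of a triangulated category: a shift and a set of distinguished triangles
  \<open>X \<rightarrow> Y \<rightarrow> Z \<rightarrow> X[1]\<close>, each given by its three arrows.\<close>

record ('o, 'm) tri_cat = "('o, 'm) category" +
  Shift_obj :: "'o \<Rightarrow> 'o"
  Shift_arr :: "'m \<Rightarrow> 'm"
  Dist :: "('m \<times> 'm \<times> 'm) set"

text \<open>A full subcategory is represented by its set of objects. Containing a zero object is
  what makes it nonempty.\<close>

definition strict_triangulated_subcat :: "('o, 'm, 'z) tri_cat_scheme \<Rightarrow> 'o set \<Rightarrow> bool" where
  "strict_triangulated_subcat T D \<longleftrightarrow>
     D \<subseteq> Obj T \<and>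
     (\<exists>Z \<in> D. is_zero_obj T Z) \<and>
     (\<forall>X \<in> D. \<forall>Y \<in> Obj T. isomorphic T X Y \<longrightarrow> Y \<in> D) \<and>
     (\<forall>X \<in> Obj T. X \<in> D \<longleftrightarrow> Shift_obj T X \<in> D) \<and>
     (\<forall>(f, g, h) \<in> Dist T. Dom T f \<in> D \<longrightarrow> Cod T f \<in> D \<longrightarrow> Cod T g \<in> D)"

definition generated_triangulated_subcat :: "('o, 'm, 'z) tri_cat_scheme \<Rightarrow> 'o set \<Rightarrow> 'o set" where
  "generated_triangulated_subcat T P = \<Inter>{D. strict_triangulated_subcat T D \<and> P \<subseteq> D}"

definition cone_in :: "('o, 'm, 'z) tri_cat_scheme \<Rightarrow> 'o set \<Rightarrow> 'm set" where
  "cone_in T D = {s \<in> Arr T. \<exists>g h. (s, g, h) \<in> Dist T \<and> Cod T g \<in> D}"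

text \<open>A roof \<open>X \<leftarrow> W \<rightarrow> Y\<close> is the pair of its two arrows out of \<open>W\<close>, the first of which
  has its cone in \<open>D\<close>.\<close>

definition roofs :: "('o, 'm, 'z) tri_cat_scheme \<Rightarrow> 'o set \<Rightarrow> 'o \<Rightarrow> 'o \<Rightarrow> ('m \<times> 'm) set" where
  "roofs T D X Y =
     {(s, f). s \<in> cone_in T D \<and> f \<in> Arr T \<and> Dom T s = Dom T f \<and> Cod T s = X \<and> Cod T f = Y}"

definition roof_equiv :: "('o, 'm, 'z) tri_cat_scheme \<Rightarrow> 'o set \<Rightarrow> 'm \<times> 'm \<Rightarrow> 'm \<times> 'm \<Rightarrow> bool" where
  "roof_equiv T D = (\<lambda>(s, f) (s', f').
     \<exists>W. \<exists>p \<in> Hom T W (Dom T s). \<exists>p' \<in> Hom T W (Dom T s').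
       s \<cdot>\<^bsub>T\<^esub> p = s' \<cdot>\<^bsub>T\<^esub> p' \<and> f \<cdot>\<^bsub>T\<^esub> p = f' \<cdot>\<^bsub>T\<^esub> p' \<and> s \<cdot>\<^bsub>T\<^esub> p \<in> cone_in T D)"

text \<open>Arrows of the Verdier quotient carry their source and target.\<close>

type_synonym ('o, 'm) fraction = "'o \<times> 'o \<times> ('m \<times> 'm) set"

definition roof_class ::
  "('o, 'm, 'z) tri_cat_scheme \<Rightarrow> 'o set \<Rightarrow> 'o \<Rightarrow> 'o \<Rightarrow> 'm \<times> 'm \<Rightarrow> ('o, 'm) fraction" where
  "roof_class T D X Y r = (X, Y, {r' \<in> roofs T D X Y. roof_equiv T D r r'})"

text \<open>The composite of the classes of \<open>X \<leftarrow> W \<rightarrow> Y\<close> (arrows \<open>s, f\<close>) and \<open>Y \<leftarrow> V \<rightarrow> Z\<close>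
  (arrows \<open>t, g\<close>) consists of the roofs equivalent to \<open>X \<leftarrow> U \<rightarrow> Z\<close>, where \<open>U\<close> completes
  \<open>f\<close> and \<open>t\<close> to a commutative square with \<open>t' : U \<rightarrow> W\<close> having its cone in \<open>D\<close>.\<close>

definition fraction_comp ::
  "('o, 'm, 'z) tri_cat_scheme \<Rightarrow> 'o set \<Rightarrow> ('o, 'm) fraction \<Rightarrow> ('o, 'm) fraction \<Rightarrow> ('o, 'm) fraction" where
  "fraction_comp T D = (\<lambda>(Y', Z, \<psi>) (X, Y, \<phi>).
     (X, Z, {r \<in> roofs T D X Z. \<exists>(s, f) \<in> \<phi>. \<exists>(t, g) \<in> \<psi>. \<exists>U.
        \<exists>t' \<in> Hom T U (Dom T s) \<inter> cone_in T D. \<exists>f' \<in> Hom T U (Dom T t).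
          f \<cdot>\<^bsub>T\<^esub> t' = t \<cdot>\<^bsub>T\<^esub> f' \<and> roof_equiv T D (s \<cdot>\<^bsub>T\<^esub> t', g \<cdot>\<^bsub>T\<^esub> f') r}))"

definition verdier_quotient ::
  "('o, 'm, 'z) tri_cat_scheme \<Rightarrow> 'o set \<Rightarrow> ('o, ('o, 'm) fraction) category" where
  "verdier_quotient T D =
     \<lparr>Obj = Obj T,
      Arr = {roof_class T D X Y r | X Y r. X \<in> Obj T \<and> Y \<in> Obj T \<and> r \<in> roofs T D X Y},
      Dom = (\<lambda>(X, Y, \<phi>). X),
      Cod = (\<lambda>(X, Y, \<phi>). Y),
      Ide = (\<lambda>X. roof_class T D X X (Ide T X, Ide T X)),
      Comp = fraction_comp T D\<rparr>"

definition verdier_localization ::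
  "('o, 'm, 'z) tri_cat_scheme \<Rightarrow> 'o set \<Rightarrow> ('o, 'm, 'o, ('o, 'm) fraction) functor_data" where
  "verdier_localization T D =
     \<lparr>on_obj = (\<lambda>X. X),
      on_arr = (\<lambda>f. roof_class T D (Dom T f) (Cod T f) (Ide T (Dom T f), f))\<rparr>"


section \<open>The homotopy category of bounded complexes\<close>

record ('o, 'm) cochain =
  deg :: "int \<Rightarrow> 'o"
  diff :: "int \<Rightarrow> 'm"

definition bounded_complex :: "('o, 'm, 'z) additive_cat_scheme \<Rightarrow> ('o, 'm) cochain \<Rightarrow> bool" where
  "bounded_complex A X \<longleftrightarrow>
     (\<forall>n. deg X n \<in> Obj A \<and> diff X n \<in> Hom A (deg X n) (deg X (n + 1)) \<and>
          diff X (n + 1) \<cdot>\<^bsub>A\<^esub> diff X n = Zero A (deg X n) (deg X (n + 2))) \<and>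
     finite {n. \<not> is_zero_obj A (deg X n)}"

definition chain_map ::
  "('o, 'm, 'z) additive_cat_scheme \<Rightarrow> ('o, 'm) cochain \<Rightarrow> ('o, 'm) cochain \<Rightarrow> (int \<Rightarrow> 'm) \<Rightarrow> bool" where
  "chain_map A X Y f \<longleftrightarrow>
     (\<forall>n. f n \<in> Hom A (deg X n) (deg Y n) \<and> diff Y n \<cdot>\<^bsub>A\<^esub> f n = f (n + 1) \<cdot>\<^bsub>A\<^esub> diff X n)"

definition homotopic ::
  "('o, 'm, 'z) additive_cat_scheme \<Rightarrow> ('o, 'm) cochain \<Rightarrow> ('o, 'm) cochain \<Rightarrow>
     (int \<Rightarrow> 'm) \<Rightarrow> (int \<Rightarrow> 'm) \<Rightarrow> bool" where
  "homotopic A X Y f g \<longleftrightarrow>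
     (\<exists>h. \<forall>n. h n \<in> Hom A (deg X n) (deg Y (n - 1)) \<and>
        f n = g n \<boxplus>\<^bsub>A\<^esub> ((diff Y (n - 1) \<cdot>\<^bsub>A\<^esub> h n) \<boxplus>\<^bsub>A\<^esub> (h (n + 1) \<cdot>\<^bsub>A\<^esub> diff X n)))"

text \<open>An arrow of the homotopy category: source, target and homotopy class of chain maps.\<close>

type_synonym ('o, 'm) htpy_arr = "('o, 'm) cochain \<times> ('o, 'm) cochain \<times> (int \<Rightarrow> 'm) set"

definition htpy_class ::
  "('o, 'm, 'z) additive_cat_scheme \<Rightarrow> ('o, 'm) cochain \<Rightarrow> ('o, 'm) cochain \<Rightarrow>
     (int \<Rightarrow> 'm) \<Rightarrow> ('o, 'm) htpy_arr" where
  "htpy_class A X Y f = (X, Y, {g. chain_map A X Y g \<and> homotopic A X Y f g})"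

definition htpy_comp ::
  "('o, 'm, 'z) additive_cat_scheme \<Rightarrow> ('o, 'm) htpy_arr \<Rightarrow> ('o, 'm) htpy_arr \<Rightarrow> ('o, 'm) htpy_arr" where
  "htpy_comp A = (\<lambda>(Y', Z, \<psi>) (X, Y, \<phi>).
     (X, Z, {k. chain_map A X Z k \<and> (\<exists>f \<in> \<phi>. \<exists>g \<in> \<psi>. homotopic A X Z (\<lambda>n. g n \<cdot>\<^bsub>A\<^esub> f n) k)}))"

definition Kb_cat :: "('o, 'm, 'z) additive_cat_scheme \<Rightarrow> (('o, 'm) cochain, ('o, 'm) htpy_arr) category" where
  "Kb_cat A =
     \<lparr>Obj = Collect (bounded_complex A),
      Arr = {htpy_class A X Y f | X Y f.
               bounded_complex A X \<and> bounded_complex A Y \<and> chain_map A X Y f},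
      Dom = (\<lambda>(X, Y, \<phi>). X),
      Cod = (\<lambda>(X, Y, \<phi>). Y),
      Ide = (\<lambda>X. htpy_class A X X (\<lambda>n. Ide A (deg X n))),
      Comp = htpy_comp A\<rparr>"

definition shift_complex :: "('o, 'm, 'z) additive_cat_scheme \<Rightarrow> ('o, 'm) cochain \<Rightarrow> ('o, 'm) cochain" where
  "shift_complex A X = \<lparr>deg = (\<lambda>n. deg X (n + 1)), diff = (\<lambda>n. neg A (diff X (n + 1)))\<rparr>"

definition shift_htpy_arr ::
  "('o, 'm, 'z) additive_cat_scheme \<Rightarrow> ('o, 'm) htpy_arr \<Rightarrow> ('o, 'm) htpy_arr" where
  "shift_htpy_arr A = (\<lambda>(X, Y, \<phi>).
     (shift_complex A X, shift_complex A Y, (\<lambda>f n. f (n + 1)) ` \<phi>))"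

definition cone_biprod ::
  "('o, 'm, 'z) additive_cat_scheme \<Rightarrow> ('o, 'm) cochain \<Rightarrow> ('o, 'm) cochain \<Rightarrow> int \<Rightarrow> ('o, 'm) biproduct" where
  "cone_biprod A X Y n = biprod A (deg X (n + 1)) (deg Y n)"

text \<open>The differential of the cone is \<open>(x, y) \<mapsto> (- d x, f x + d y)\<close>.\<close>

definition cone ::
  "('o, 'm, 'z) additive_cat_scheme \<Rightarrow> ('o, 'm) cochain \<Rightarrow> ('o, 'm) cochain \<Rightarrow>
     (int \<Rightarrow> 'm) \<Rightarrow> ('o, 'm) cochain" where
  "cone A X Y f =
     \<lparr>deg = (\<lambda>n. bsum (cone_biprod A X Y n)),
      diff = (\<lambda>n. let B = cone_biprod A X Y n; B' = cone_biprod A X Y (n + 1) in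
        (in1 B' \<cdot>\<^bsub>A\<^esub> neg A (diff X (n + 1)) \<cdot>\<^bsub>A\<^esub> pr1 B) \<boxplus>\<^bsub>A\<^esub>
        ((in2 B' \<cdot>\<^bsub>A\<^esub> f (n + 1) \<cdot>\<^bsub>A\<^esub> pr1 B) \<boxplus>\<^bsub>A\<^esub> (in2 B' \<cdot>\<^bsub>A\<^esub> diff Y n \<cdot>\<^bsub>A\<^esub> pr2 B)))\<rparr>"

definition standard_triangles ::
  "('o, 'm, 'z) additive_cat_scheme \<Rightarrow>
     (('o, 'm) htpy_arr \<times> ('o, 'm) htpy_arr \<times> ('o, 'm) htpy_arr) set" where
  "standard_triangles A =
     {(htpy_class A X Y f,
       htpy_class A Y (cone A X Y f) (\<lambda>n. in2 (cone_biprod A X Y n)),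
       htpy_class A (cone A X Y f) (shift_complex A X) (\<lambda>n. pr1 (cone_biprod A X Y n))) | X Y f.
      bounded_complex A X \<and> bounded_complex A Y \<and> chain_map A X Y f}"

definition distinguished_triangles ::
  "('o, 'm, 'z) additive_cat_scheme \<Rightarrow>
     (('o, 'm) htpy_arr \<times> ('o, 'm) htpy_arr \<times> ('o, 'm) htpy_arr) set" where
  "distinguished_triangles A = {(f, g, h).
     \<exists>X Y Z. f \<in> Hom (Kb_cat A) X Y \<and> g \<in> Hom (Kb_cat A) Y Z \<and>
       h \<in> Hom (Kb_cat A) Z (shift_complex A X) \<and>
     (\<exists>(f', g', h') \<in> standard_triangles A.
      \<exists>a \<in> Hom (Kb_cat A) X (Dom (Kb_cat A) f').
      \<exists>b \<in> Hom (Kb_cat A) Y (Dom (Kb_cat A) g').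
      \<exists>c \<in> Hom (Kb_cat A) Z (Dom (Kb_cat A) h').
        iso_arr (Kb_cat A) a \<and> iso_arr (Kb_cat A) b \<and> iso_arr (Kb_cat A) c \<and>
        htpy_comp A b f = htpy_comp A f' a \<and>
        htpy_comp A c g = htpy_comp A g' b \<and>
        htpy_comp A (shift_htpy_arr A a) h = htpy_comp A h' c)}"

definition Kb :: "('o, 'm, 'z) additive_cat_scheme \<Rightarrow> (('o, 'm) cochain, ('o, 'm) htpy_arr) tri_cat" where
  "Kb A = category.extend (Kb_cat A)
     \<lparr>Shift_obj = shift_complex A,
      Shift_arr = shift_htpy_arr A,
      Dist = distinguished_triangles A\<rparr>"

definition stalk :: "('o, 'm, 'z) additive_cat_scheme \<Rightarrow> 'o \<Rightarrow> ('o, 'm) cochain" where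
  "stalk A X = (let P = (\<lambda>n::int. if n = 0 then X else zero_obj A)
     in \<lparr>deg = P, diff = (\<lambda>n. Zero A (P n) (P (n + 1)))\<rparr>)"

definition stalk_functor ::
  "('o, 'm, 'z) additive_cat_scheme \<Rightarrow> ('o, 'm, ('o, 'm) cochain, ('o, 'm) htpy_arr) functor_data" where
  "stalk_functor A =
     \<lparr>on_obj = stalk A,
      on_arr = (\<lambda>f. htpy_class A (stalk A (Dom A f)) (stalk A (Cod A f))
        (\<lambda>n. if n = 0 then f else Ide A (zero_obj A)))\<rparr>"

text \<open>For an arrow \<open>s\<close> of \<open>A\<close>, the complex with \<open>s\<close> in degrees \<open>-1 \<rightarrow> 0\<close> and zero elsewhere.\<close>

definition arrow_cone :: "('o, 'm, 'z) additive_cat_scheme \<Rightarrow> 'm \<Rightarrow> ('o, 'm) cochain" where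
  "arrow_cone A s =
     (let P = (\<lambda>n::int. if n = - 1 then Dom A s else if n = 0 then Cod A s else zero_obj A)
      in \<lparr>deg = P, diff = (\<lambda>n. if n = - 1 then s else Zero A (P n) (P (n + 1)))\<rparr>)"


section \<open>The additive localization\<close>

definition cones_subcat :: "('o, 'm, 'z) additive_cat_scheme \<Rightarrow> 'm set \<Rightarrow> ('o, 'm) cochain set" where
  "cones_subcat A S = generated_triangulated_subcat (Kb A) (arrow_cone A ` S)"

type_synonym ('o, 'm) loc_arr = "(('o, 'm) cochain, ('o, 'm) htpy_arr) fraction"

definition add_localization ::
  "('o, 'm, 'z) additive_cat_scheme \<Rightarrow> 'm set \<Rightarrow> (('o, 'm) cochain, ('o, 'm) loc_arr) category" where
  "add_localization A S =
     full_subcat (verdier_quotient (Kb A) (cones_subcat A S)) (stalk A ` Obj A)"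

definition add_localization_functor ::
  "('o, 'm, 'z) additive_cat_scheme \<Rightarrow> 'm set \<Rightarrow>
     ('o, 'm, ('o, 'm) cochain, ('o, 'm) loc_arr) functor_data" where
  "add_localization_functor A S =
     functor_comp (verdier_localization (Kb A) (cones_subcat A S)) (stalk_functor A)"

end

theory Submission
  imports Defs "HOL-Algebra.FiniteProduct" "HOL-Library.Poly_Mapping"
begin

text \<open>
  Call an arrow of \<open>K\<^sup>b(A)\<close> a quasi-isomorphism if its cone lies in the triangulated subcategory \<open>D\<close>
  generated by the cones of \<open>S\<close>. Quasi-isomorphisms admit a calculus of fractions, so an arrow
  \<open>X \<rightarrow> Y\<close> of the localization is a roof \<open>X \<leftarrow> W \<rightarrow> Y\<close> with legs \<open>s\<close>, \<open>f\<close>.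

  If \<open>F\<close> inverts \<open>S\<close>, the complexes \<open>C\<close> for which all \<open>Hom(T, F C)\<close> are exact form a triangulated
  subcategory containing \<open>D\<close>. Hence the identity of \<open>F X\<close> lifts along \<open>F s\<close> to a cycle
  \<open>q : F X \<rightarrow> F W\<^sup>0\<close>, unique up to boundaries, and \<open>F f\<^sup>0 q\<close> is the value of the extension at the roof.

  For uniqueness, every complex in \<open>D\<close> is, up to homotopy retracts, approximated in high degrees by
  complexes in \<open>D\<close> which vanish in low degrees; this property passes to cones, because a map from high
  to low degrees is zero. Therefore \<open>W\<close> may be taken in nonnegative degrees. Then \<open>W\<close> projects to
  \<open>W\<^sup>0\<close>, the roof factors in the quotient as \<open>X \<rightarrow> W\<^sup>0 \<rightarrow> Y\<close> with second arrow \<open>f\<^sup>0\<close>, and any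
  factorization of \<open>F\<close> sends the first arrow to a cycle that lifts the identity of \<open>F X\<close>.
\<close>

section \<open>Calculation in additive categories\<close>

text \<open>\<open>S\<close> is arbitrary, so the fractions formed inside \<open>A\<close> have no
  calculus; one exists only among complexes. The price is that the middle term \<open>W\<close> of a
  roof between stalks lies outside the domain of a factorization \<open>G\<close>, which sees stalks
  alone. Neither existence nor uniqueness of a value at a roof is therefore formal.

  For existence, \<open>F W\<close> is probed only by arrows from test objects \<open>T\<close>,
  since the target category need not have kernels. For bounded \<open>C\<close>, exactness of all
  \<open>Hom(T, F C)\<close> amounts to contractibility of \<open>F C\<close>, but it passes to
  cones by a diagram chase and requires no homotopies in the target.

  For uniqueness, projecting \<open>W\<close> to its term of degree 0 is a chain map only when the
  differential arriving from degree -1 vanishes; this is the reason for truncating. \<open>G\<close>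
  is not assumed additive: that it produces a cycle comes from comparing, in the quotient,
  composites with a differential and with a zero arrow, both of them images of arrows of
  \<open>A\<close>.\<close>

context category
begin

lemma HomI: "f \<in> Arr C \<Longrightarrow> Dom C f = X \<Longrightarrow> Cod C f = Y \<Longrightarrow> f \<in> Hom C X Y"
  by (simp add: Hom_def)

lemma HomD: "f \<in> Hom C X Y \<Longrightarrow> f \<in> Arr C" "f \<in> Hom C X Y \<Longrightarrow> Dom C f = X" "f \<in> Hom C X Y \<Longrightarrow> Cod C f = Y"
  by (simp_all add: Hom_def)

lemma Hom_Obj: "f \<in> Hom C X Y \<Longrightarrow> X \<in> Obj C \<and> Y \<in> Obj C"
  using Dom_Obj Cod_Obj by (auto simp: Hom_def)

text \<open>Phrased with \<open>Dom\<close> and \<open>Cod\<close> instead of \<open>Hom\<close>, so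
  that the simplifier computes the ends of nested composites without guessing intermediate
  objects.\<close>

lemma Comp_arr [simp]:
  assumes "g \<in> Arr C" "f \<in> Arr C" "Dom C g = Cod C f"
  shows "g \<cdot> f \<in> Arr C" "Dom C (g \<cdot> f) = Dom C f" "Cod C (g \<cdot> f) = Cod C g"
  using Comp_Hom[of f "Dom C f" "Cod C f" g "Cod C g"] assms by (auto simp: Hom_def)

lemma Ide_arr [simp]:
  assumes "X \<in> Obj C"
  shows "Ide C X \<in> Arr C" "Dom C (Ide C X) = X" "Cod C (Ide C X) = X"
  using Ide_Hom[OF assms] by (auto simp: Hom_def)

lemma Ide_Comp [simp]: "f \<in> Arr C \<Longrightarrow> Cod C f = X \<Longrightarrow> Ide C X \<cdot> f = f"
  by (metis Comp_Ide_left HomI)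

lemma Comp_Ide [simp]: "f \<in> Arr C \<Longrightarrow> Dom C f = X \<Longrightarrow> f \<cdot> Ide C X = f"
  by (metis Comp_Ide_right HomI)

lemma Comp_assoc' [simp]:
  "f \<in> Arr C \<Longrightarrow> g \<in> Arr C \<Longrightarrow> h \<in> Arr C \<Longrightarrow> Dom C g = Cod C f \<Longrightarrow> Dom C h = Cod C g
    \<Longrightarrow> (h \<cdot> g) \<cdot> f = h \<cdot> (g \<cdot> f)"
  using Comp_assoc[of f _ _ g _ h] by (auto simp: Hom_def)

text \<open>Composites are normalized to the right, so \<open>g \<cdot> f\<close> is no subterm of a
  longer composite; in this form an equation for it still applies.\<close>

lemma Comp_rewrite:
  "g \<cdot> f = k \<Longrightarrow> f \<in> Arr C \<Longrightarrow> g \<in> Arr C \<Longrightarrow> Dom C g = Cod C f \<Longrightarrow> h \<in> Arr C \<Longrightarrow> Cod C h = Dom C f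
    \<Longrightarrow> g \<cdot> (f \<cdot> h) = k \<cdot> h"
  by (metis Comp_assoc')

end

context additive_category
begin

lemma hom_group_simps [simp]: "carrier (hom_group A X Y) = Hom A X Y"
    "mult (hom_group A X Y) = Add A" "one (hom_group A X Y) = Zero A X Y"
  by (simp_all add: hom_group_def)

lemma Add_Hom: "f \<in> Hom A X Y \<Longrightarrow> g \<in> Hom A X Y \<Longrightarrow> f \<boxplus> g \<in> Hom A X Y"
proof -
  assume a: "f \<in> Hom A X Y" "g \<in> Hom A X Y"
  then interpret G: comm_group "hom_group A X Y" using comm_group_Hom Hom_Obj by blast
  show ?thesis using G.m_closed a by simp
qed

lemma Zero_Hom: "X \<in> Obj A \<Longrightarrow> Y \<in> Obj A \<Longrightarrow> Zero A X Y \<in> Hom A X Y"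
proof -
  assume a: "X \<in> Obj A" "Y \<in> Obj A"
  then interpret G: comm_group "hom_group A X Y" using comm_group_Hom by blast
  show ?thesis using G.one_closed by simp
qed

lemma neg_Hom: "f \<in> Hom A X Y \<Longrightarrow> neg A f \<in> Hom A X Y"
proof -
  assume a: "f \<in> Hom A X Y"
  then interpret G: comm_group "hom_group A X Y" using comm_group_Hom Hom_Obj by blast
  show ?thesis using G.inv_closed[of f] a by (simp add: neg_def HomD[OF a])
qed

lemma Add_arr [simp]:
  assumes "f \<in> Arr A" "g \<in> Arr A" "Dom A f = Dom A g" "Cod A f = Cod A g"
  shows "f \<boxplus> g \<in> Arr A" "Dom A (f \<boxplus> g) = Dom A g" "Cod A (f \<boxplus> g) = Cod A g"
  using Add_Hom[of f "Dom A f" "Cod A f" g] assms by (auto simp: Hom_def)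

lemma Zero_arr [simp]:
  assumes "X \<in> Obj A" "Y \<in> Obj A"
  shows "Zero A X Y \<in> Arr A" "Dom A (Zero A X Y) = X" "Cod A (Zero A X Y) = Y"
  using Zero_Hom[of X Y] assms by (auto simp: Hom_def)

lemma neg_arr [simp]:
  assumes "f \<in> Arr A"
  shows "neg A f \<in> Arr A" "Dom A (neg A f) = Dom A f" "Cod A (neg A f) = Cod A f"
  using neg_Hom[of f "Dom A f" "Cod A f"] assms by (auto simp: Hom_def)

lemma Dom_Cod_Obj [simp]: "f \<in> Arr A \<Longrightarrow> Dom A f \<in> Obj A" "f \<in> Arr A \<Longrightarrow> Cod A f \<in> Obj A"
  using Dom_Obj Cod_Obj by auto

lemma
  assumes "f \<in> Arr A" "Dom A f = X" "Cod A f = Y"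
  shows Add_Zero [simp]: "f \<boxplus> Zero A X Y = f" and Zero_Add [simp]: "Zero A X Y \<boxplus> f = f"
    and Add_neg [simp]: "f \<boxplus> neg A f = Zero A X Y" and neg_Add [simp]: "neg A f \<boxplus> f = Zero A X Y"
    and neg_neg [simp]: "neg A (neg A f) = f"
proof -
  have f: "f \<in> Hom A X Y" using assms by (simp add: Hom_def)
  then interpret G: comm_group "hom_group A X Y" using comm_group_Hom Hom_Obj by blast
  show "f \<boxplus> Zero A X Y = f" using G.r_one[of f] f by simp
  show "Zero A X Y \<boxplus> f = f" using G.l_one[of f] f by simp
  have n: "neg A f = inv\<^bsub>hom_group A X Y\<^esub> f" "neg A (neg A f) = inv\<^bsub>hom_group A X Y\<^esub> (neg A f)"
    using assms neg_arr[OF assms(1)] neg_def[of A f] neg_def[of A "neg A f"] by metis+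
  show "f \<boxplus> neg A f = Zero A X Y" "neg A f \<boxplus> f = Zero A X Y" "neg A (neg A f) = f"
    using G.r_inv[of f] G.l_inv[of f] G.inv_inv[of f] f n by simp_all
qed

lemma Add_eq_Zero_neg:
  assumes "f \<in> Hom A X Y" "g \<in> Hom A X Y" "f \<boxplus> g = Zero A X Y"
  shows "f = neg A g"
proof -
  interpret G: comm_group "hom_group A X Y" using comm_group_Hom Hom_Obj assms(1) by blast
  show ?thesis using G.inv_equality[of f g] assms by (simp add: neg_def HomD[OF assms(2)])
qed

lemma Add_idem_Zero:
  assumes "f \<in> Hom A X Y" "f \<boxplus> f = f"
  shows "f = Zero A X Y"
proof -
  interpret G: comm_group "hom_group A X Y" using comm_group_Hom Hom_Obj assms(1) by blast
  show ?thesis using G.l_cancel_one[of f f] assms by simp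
qed

lemma Comp_Add [simp]:
  "f \<in> Arr A \<Longrightarrow> f' \<in> Arr A \<Longrightarrow> g \<in> Arr A \<Longrightarrow> Dom A f = Dom A f' \<Longrightarrow> Cod A f = Cod A f'
   \<Longrightarrow> Dom A g = Cod A f \<Longrightarrow> g \<cdot> (f \<boxplus> f') = (g \<cdot> f) \<boxplus> (g \<cdot> f')"
  using Comp_Add_right[of f "Dom A f" "Cod A f" f' g "Cod A g"] by (auto simp: Hom_def)

lemma Add_Comp [simp]:
  "f \<in> Arr A \<Longrightarrow> g' \<in> Arr A \<Longrightarrow> g \<in> Arr A \<Longrightarrow> Dom A g = Dom A g' \<Longrightarrow> Cod A g = Cod A g'
   \<Longrightarrow> Dom A g = Cod A f \<Longrightarrow> (g \<boxplus> g') \<cdot> f = (g \<cdot> f) \<boxplus> (g' \<cdot> f)"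
  using Comp_Add_left[of f "Dom A f" "Cod A f" g "Cod A g" g'] by (auto simp: Hom_def)

lemma Comp_Zero [simp]:
  assumes "g \<in> Arr A" "X \<in> Obj A" "Dom A g = Y"
  shows "g \<cdot> Zero A X Y = Zero A X (Cod A g)"
proof -
  have Y: "Y \<in> Obj A" using assms by auto
  have z: "Zero A X Y \<in> Hom A X Y" using Zero_Hom assms Y by blast
  have "g \<cdot> Zero A X Y = g \<cdot> (Zero A X Y \<boxplus> Zero A X Y)" using assms Y by simp
  also have "\<dots> = (g \<cdot> Zero A X Y) \<boxplus> (g \<cdot> Zero A X Y)" using assms Y by (subst Comp_Add) auto
  finally show ?thesis using assms Y by (intro Add_idem_Zero) (auto simp: Hom_def)
qed

lemma Zero_Comp [simp]:
  assumes "f \<in> Arr A" "Z \<in> Obj A" "Cod A f = Y"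
  shows "Zero A Y Z \<cdot> f = Zero A (Dom A f) Z"
proof -
  have Y: "Y \<in> Obj A" using assms by auto
  have "Zero A Y Z \<cdot> f = (Zero A Y Z \<boxplus> Zero A Y Z) \<cdot> f" using assms Y by simp
  also have "\<dots> = (Zero A Y Z \<cdot> f) \<boxplus> (Zero A Y Z \<cdot> f)" using assms Y by (subst Add_Comp) auto
  finally show ?thesis using assms Y by (intro Add_idem_Zero) (auto simp: Hom_def)
qed

lemma neg_Comp [simp]:
  assumes "f \<in> Arr A" "g \<in> Arr A" "Dom A g = Cod A f"
  shows "neg A g \<cdot> f = neg A (g \<cdot> f)"
proof -
  have "(neg A g \<cdot> f) \<boxplus> (g \<cdot> f) = (neg A g \<boxplus> g) \<cdot> f" using assms by (subst Add_Comp) auto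
  also have "\<dots> = Zero A (Dom A f) (Cod A g)"
    using assms by (simp add: neg_Add[OF assms(2) refl refl])
  finally show ?thesis using assms by (intro Add_eq_Zero_neg) (auto simp: Hom_def)
qed

lemma Comp_neg [simp]:
  assumes "f \<in> Arr A" "g \<in> Arr A" "Dom A g = Cod A f"
  shows "g \<cdot> neg A f = neg A (g \<cdot> f)"
proof -
  have "(g \<cdot> neg A f) \<boxplus> (g \<cdot> f) = g \<cdot> (neg A f \<boxplus> f)" using assms by (subst Comp_Add) auto
  also have "\<dots> = Zero A (Dom A f) (Cod A g)"
    using assms by (simp add: neg_Add[OF assms(1) refl refl])
  finally show ?thesis using assms by (intro Add_eq_Zero_neg) (auto simp: Hom_def)
qed

text \<open>Linear identities between arrows are decided in the free abelian group on the arrows,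
  where the arithmetic of type classes is available.\<close>

lemma int_pow_Hom: "m \<in> Hom A X Y \<Longrightarrow> m [^]\<^bsub>hom_group A X Y\<^esub> (k::int) \<in> Hom A X Y"
proof -
  assume a: "m \<in> Hom A X Y"
  then interpret G: comm_group "hom_group A X Y" using comm_group_Hom Hom_Obj by blast
  show ?thesis using G.int_pow_closed[of m k] a by simp
qed

text \<open>To be read: \<open>a\<close> is the value of the formal combination \<open>u\<close>. A
  relation, not an evaluation function, so that introduction rules can read \<open>u\<close> off the
  term \<open>a\<close>, with composites entering as generators through
  \<open>lin_gen\<close>.\<close>

definition lin :: "'o \<Rightarrow> 'o \<Rightarrow> 'm \<Rightarrow> ('m \<Rightarrow>\<^sub>0 int) \<Rightarrow> bool" where
  "lin X Y a u \<longleftrightarrow> X \<in> Obj A \<and> Y \<in> Obj A \<and> Poly_Mapping.keys u \<subseteq> Hom A X Y \<and>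
     a = finprod (hom_group A X Y) (\<lambda>m. m [^]\<^bsub>hom_group A X Y\<^esub> Poly_Mapping.lookup u m) (Poly_Mapping.keys u)"

lemma lin_gen: "a \<in> Hom A X Y \<Longrightarrow> lin X Y a (Poly_Mapping.single a 1)"
proof -
  assume a: "a \<in> Hom A X Y"
  then interpret G: comm_group "hom_group A X Y" using comm_group_Hom Hom_Obj by blast
  show ?thesis using a Hom_Obj[OF a] G.r_one[of a] by (simp add: lin_def G.int_pow_1)
qed

lemma lin_zero: "X \<in> Obj A \<Longrightarrow> Y \<in> Obj A \<Longrightarrow> lin X Y (Zero A X Y) 0"
proof -
  assume a: "X \<in> Obj A" "Y \<in> Obj A"
  then interpret G: comm_group "hom_group A X Y" using comm_group_Hom by blast
  show ?thesis using a by (simp add: lin_def)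
qed

lemma lin_add:
  assumes "lin X Y a u" "lin X Y b v"
  shows "lin X Y (a \<boxplus> b) (u + v)"
proof -
  interpret G: comm_group "hom_group A X Y" using comm_group_Hom assms(1) by (auto simp: lin_def)
  define ev where "ev w K = finprod (hom_group A X Y) (\<lambda>m. m [^]\<^bsub>hom_group A X Y\<^esub> Poly_Mapping.lookup w m) K"
    for w :: "'m \<Rightarrow>\<^sub>0 int" and K
  let ?K = "Poly_Mapping.keys u \<union> Poly_Mapping.keys v"
  have sub: "?K \<subseteq> Hom A X Y" using assms by (auto simp: lin_def)
  \<comment> \<open>The keys of \<open>u\<close>, \<open>v\<close> and \<open>u + v\<close> differ,
    the last possibly shrinking by cancellation. Outside its own keys a combination contributes
    zeroth powers, so all products may be taken over the one set \<open>?K\<close>.\<close>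
  have ext: "ev w (Poly_Mapping.keys w) = ev w ?K" if "Poly_Mapping.keys w \<subseteq> ?K" for w
    unfolding ev_def
    by (rule G.finprod_mono_neutral_cong_left)
      (use that sub in \<open>auto simp: in_keys_iff intro!: int_pow_Hom\<close>)
  have k: "Poly_Mapping.keys (u + v) \<subseteq> ?K" by (rule Poly_Mapping.keys_add)
  have "a \<boxplus> b = ev u ?K \<otimes>\<^bsub>hom_group A X Y\<^esub> ev v ?K"
    using assms ext[of u] ext[of v] by (simp add: lin_def ev_def)
  also have "\<dots> = ev (u + v) ?K"
    unfolding ev_def
    by (subst G.finprod_multf[symmetric], use sub in \<open>force intro!: int_pow_Hom\<close>,
        use sub in \<open>force intro!: int_pow_Hom\<close>)
      (intro G.finprod_cong', use sub G.int_pow_mult in \<open>auto simp: lookup_add intro!: int_pow_Hom\<close>)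
  also have "\<dots> = ev (u + v) (Poly_Mapping.keys (u + v))" using ext[OF k] by simp
  finally show ?thesis using assms k sub by (auto simp: lin_def ev_def)
qed

lemma lin_unique: "lin X Y a u \<Longrightarrow> lin X Y b u \<Longrightarrow> a = b"
  by (simp add: lin_def)

lemma lin_Hom: "lin X Y a u \<Longrightarrow> a \<in> Hom A X Y"
proof -
  assume a: "lin X Y a u"
  then interpret G: comm_group "hom_group A X Y" using comm_group_Hom by (auto simp: lin_def)
  have "(\<lambda>m. m [^]\<^bsub>hom_group A X Y\<^esub> Poly_Mapping.lookup u m) \<in> Poly_Mapping.keys u \<rightarrow> carrier (hom_group A X Y)"
    using a int_pow_Hom by (auto simp: lin_def)
  from G.finprod_closed[OF this] show ?thesis using a by (simp only: lin_def hom_group_simps)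
qed

text \<open>The combinations \<open>- u\<close> and \<open>u\<close> add up to \<open>0\<close>, so
  their values are inverse to each other; no computation with powers is needed.\<close>

lemma lin_neg:
  assumes "lin X Y a u"
  shows "lin X Y (neg A a) (- u)"
proof -
  interpret G: comm_group "hom_group A X Y" using comm_group_Hom assms by (auto simp: lin_def)
  define b where "b = finprod (hom_group A X Y) (\<lambda>m. m [^]\<^bsub>hom_group A X Y\<^esub> Poly_Mapping.lookup (- u) m) (Poly_Mapping.keys (- u))"
  have b: "lin X Y b (- u)" using assms by (auto simp: lin_def b_def in_keys_iff)
  have aH: "a \<in> Hom A X Y" "b \<in> Hom A X Y"
    using lin_Hom[OF assms] lin_Hom[OF b] by simp_all
  have "b \<boxplus> a = Zero A X Y"
    using lin_unique lin_add[OF b assms] lin_zero assms by (auto simp: lin_def)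
  then show ?thesis using Add_eq_Zero_neg[OF aH(2) aH(1)] b by simp
qed

text \<open>Both sides need only give the same formal combination, and that equation is settled by
  cancellation in \<open>'m \<Rightarrow>\<^sub>0 int\<close>.\<close>

lemma lin_eqI: "lin X Y a u \<Longrightarrow> lin X Y b v \<Longrightarrow> u = v \<Longrightarrow> a = b"
  using lin_unique by blast

lemmas lin_intros = lin_add lin_neg lin_zero lin_gen

lemma neg_Zero [simp]: "X \<in> Obj A \<Longrightarrow> Y \<in> Obj A \<Longrightarrow> neg A (Zero A X Y) = Zero A X Y"
  by (rule lin_eqI, (rule lin_intros | assumption)+) simp

lemma neg_distrib [simp]: "f \<in> Arr A \<Longrightarrow> g \<in> Arr A \<Longrightarrow> Dom A f = Dom A g \<Longrightarrow> Cod A f = Cod A g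
   \<Longrightarrow> neg A (f \<boxplus> g) = neg A f \<boxplus> neg A g"
  by (rule lin_eqI[of "Dom A f" "Cod A f"], ((rule lin_intros HomI) | simp)+)

section \<open>Zero objects and biproducts\<close>

lemma zero_obj_Obj: "is_zero_obj A Z \<Longrightarrow> Z \<in> Obj A"
  by (simp add: is_zero_obj_def)

text \<open>Every arrow into or out of \<open>Z\<close> is a composite with its identity. The right
  side is equational, hence preserved by additive functors, which is what \<open>Fo_zero\<close>
  uses.\<close>

lemma is_zero_obj_iff: "is_zero_obj A Z \<longleftrightarrow> Z \<in> Obj A \<and> Ide A Z = Zero A Z Z"
proof
  assume "is_zero_obj A Z"
  then show "Z \<in> Obj A \<and> Ide A Z = Zero A Z Z"
    using Ide_Hom Zero_Hom unfolding is_zero_obj_def by blast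
next
  assume Z: "Z \<in> Obj A \<and> Ide A Z = Zero A Z Z"
  have "f = Zero A X Z" if "f \<in> Hom A X Z" for f X
  proof -
    have "f = Ide A Z \<cdot> f" using that by (auto simp: Hom_def)
    then show ?thesis using that Z Zero_Comp[of f Z Z] by (auto simp: Hom_def)
  qed
  moreover have "f = Zero A Z X" if "f \<in> Hom A Z X" for f X
  proof -
    have "f = f \<cdot> Ide A Z" using that by (auto simp: Hom_def)
    then show ?thesis using that Z Comp_Zero[of f Z Z] by (auto simp: Hom_def)
  qed
  ultimately show "is_zero_obj A Z"
    unfolding is_zero_obj_def using Zero_Hom Z by blast
qed

lemma to_zero_obj: "is_zero_obj A (Cod A f) \<Longrightarrow> f \<in> Arr A \<Longrightarrow> f = Zero A (Dom A f) (Cod A f)"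
  using Zero_Comp[of f "Cod A f" "Cod A f"] by (metis Ide_Comp is_zero_obj_iff)

lemma from_zero_obj: "is_zero_obj A (Dom A f) \<Longrightarrow> f \<in> Arr A \<Longrightarrow> f = Zero A (Dom A f) (Cod A f)"
  using Comp_Zero[of f "Dom A f" "Dom A f"] by (metis Comp_Ide is_zero_obj_iff)

lemma zero_obj: "is_zero_obj A (zero_obj A)"
  unfolding zero_obj_def using ex_zero_obj by (rule someI_ex)

lemma zero_obj_in_Obj [simp]: "zero_obj A \<in> Obj A"
  using zero_obj zero_obj_Obj by blast

lemma biprod_is_biproduct:
  "X \<in> Obj A \<Longrightarrow> Y \<in> Obj A \<Longrightarrow> is_biproduct A X Y (biprod A X Y)"
  unfolding biprod_def using ex_biproduct by (rule someI_ex)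

lemma biproduct_simps:
  assumes "is_biproduct A X Y B"
  shows "bsum B \<in> Obj A" "in1 B \<in> Arr A" "in2 B \<in> Arr A" "pr1 B \<in> Arr A" "pr2 B \<in> Arr A"
    "Dom A (in1 B) = X" "Dom A (in2 B) = Y" "Cod A (in1 B) = bsum B" "Cod A (in2 B) = bsum B"
    "Cod A (pr1 B) = X" "Cod A (pr2 B) = Y" "Dom A (pr1 B) = bsum B" "Dom A (pr2 B) = bsum B"
    "pr1 B \<cdot> in1 B = Ide A X" "pr2 B \<cdot> in2 B = Ide A Y"
    "pr1 B \<cdot> in2 B = Zero A Y X" "pr2 B \<cdot> in1 B = Zero A X Y"
    "(in1 B \<cdot> pr1 B) \<boxplus> (in2 B \<cdot> pr2 B) = Ide A (bsum B)"
  using assms by (simp_all add: is_biproduct_def Hom_def)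

text \<open>The injections are jointly epic: composing an arrow with the decomposition of the
  identity recovers it from its two components.\<close>

lemma biproduct_from_eqI:
  assumes B: "is_biproduct A X Y B" and f: "f \<in> Hom A (bsum B) Z" and g: "g \<in> Hom A (bsum B) Z"
    and "f \<cdot> in1 B = g \<cdot> in1 B" "f \<cdot> in2 B = g \<cdot> in2 B"
  shows "f = g"
proof -
  have *: "h = ((h \<cdot> in1 B) \<cdot> pr1 B) \<boxplus> ((h \<cdot> in2 B) \<cdot> pr2 B)" if "h \<in> Hom A (bsum B) Z" for h
  proof -
    have "h = h \<cdot> ((in1 B \<cdot> pr1 B) \<boxplus> (in2 B \<cdot> pr2 B))"
      using Comp_Ide[of h "bsum B"] biproduct_simps[OF B] HomD[OF that] by metis
    also have "\<dots> = ((h \<cdot> in1 B) \<cdot> pr1 B) \<boxplus> ((h \<cdot> in2 B) \<cdot> pr2 B)"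
      using biproduct_simps(1-13)[OF B] HomD[OF that] by simp
    finally show ?thesis .
  qed
  show ?thesis using *[OF f] *[OF g] assms(4,5) by simp
qed

lemma biproduct_to_eqI:
  assumes B: "is_biproduct A X Y B" and f: "f \<in> Hom A Z (bsum B)" and g: "g \<in> Hom A Z (bsum B)"
    and "pr1 B \<cdot> f = pr1 B \<cdot> g" "pr2 B \<cdot> f = pr2 B \<cdot> g"
  shows "f = g"
proof -
  have *: "h = (in1 B \<cdot> (pr1 B \<cdot> h)) \<boxplus> (in2 B \<cdot> (pr2 B \<cdot> h))" if "h \<in> Hom A Z (bsum B)" for h
  proof -
    have "h = ((in1 B \<cdot> pr1 B) \<boxplus> (in2 B \<cdot> pr2 B)) \<cdot> h"
      using Ide_Comp[of h "bsum B"] biproduct_simps[OF B] HomD[OF that] by metis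
    also have "\<dots> = (in1 B \<cdot> (pr1 B \<cdot> h)) \<boxplus> (in2 B \<cdot> (pr2 B \<cdot> h))"
      using biproduct_simps(1-13)[OF B] HomD[OF that] by simp
    finally show ?thesis .
  qed
  show ?thesis using *[OF f] *[OF g] assms(4,5) by simp
qed

lemma biproduct_zero:
  assumes B: "is_biproduct A X Y B" and "is_zero_obj A X" "is_zero_obj A Y"
  shows "is_zero_obj A (bsum B)"
proof -
  have X: "X \<in> Obj A" "Y \<in> Obj A" using assms zero_obj_Obj by auto
  have z: "pr1 B = Zero A (bsum B) X" "pr2 B = Zero A (bsum B) Y"
    using to_zero_obj[of "pr1 B"] to_zero_obj[of "pr2 B"] biproduct_simps[OF B] assms by simp_all
  have "Ide A (bsum B) = Zero A (bsum B) (bsum B)"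
    using biproduct_simps(18)[OF B] biproduct_simps(1-9)[OF B] X by (simp add: z)
  then show ?thesis using biproduct_simps(1)[OF B] by (simp add: is_zero_obj_iff)
qed


section \<open>Complexes, chain maps and homotopies\<close>

lemma bounded_complex_simps [simp]:
  assumes "bounded_complex A X"
  shows "deg X n \<in> Obj A" "diff X n \<in> Arr A" "Dom A (diff X n) = deg X n" "Cod A (diff X n) = deg X (n + 1)"
    "m = n + 1 \<Longrightarrow> diff X m \<cdot> diff X n = Zero A (deg X n) (deg X (n + 2))"
  using assms by (auto simp: bounded_complex_def Hom_def add.commute add.left_commute)

lemma diff_diff [simp]:
  assumes "bounded_complex A X" "h \<in> Arr A" "Cod A h = deg X n" "m = n + 1"
  shows "diff X m \<cdot> (diff X n \<cdot> h) = Zero A (Dom A h) (deg X (n + 2))"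
  using assms by (subst Comp_rewrite[OF bounded_complex_simps(5)]) simp_all

lemma bounded_complex_finite: "bounded_complex A X \<Longrightarrow> finite {n. \<not> is_zero_obj A (deg X n)}"
  unfolding bounded_complex_def by blast

text \<open>Bundles the chain map condition with boundedness of both ends, since
  \<open>chain_map\<close> does not say that they are complexes.\<close>

definition cmap :: "('o, 'm) cochain \<Rightarrow> ('o, 'm) cochain \<Rightarrow> (int \<Rightarrow> 'm) \<Rightarrow> bool" where
  "cmap X Y f \<longleftrightarrow> bounded_complex A X \<and> bounded_complex A Y \<and> chain_map A X Y f"

lemma cmap_simps:
  assumes "cmap X Y f"
  shows "bounded_complex A X" "bounded_complex A Y" "f n \<in> Arr A" "Dom A (f n) = deg X n" "Cod A (f n) = deg Y n"
    "diff Y n \<cdot> f n = f (n + 1) \<cdot> diff X n"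
    "h \<in> Arr A \<Longrightarrow> Cod A h = deg X n \<Longrightarrow> diff Y n \<cdot> (f n \<cdot> h) = f (n + 1) \<cdot> (diff X n \<cdot> h)"
proof -
  show 1: "bounded_complex A X" "bounded_complex A Y" 
    using assms unfolding cmap_def by blast+
  show 2: "f n \<in> Arr A" "Dom A (f n) = deg X n" "Cod A (f n) = deg Y n"
    and 3: "diff Y n \<cdot> f n = f (n + 1) \<cdot> diff X n" for n
    using assms unfolding cmap_def chain_map_def Hom_def by blast+
  show "diff Y n \<cdot> (f n \<cdot> h) = f (n + 1) \<cdot> (diff X n \<cdot> h)" if h: "h \<in> Arr A" "Cod A h = deg X n"
    by (subst Comp_rewrite[OF 3]) (simp_all add: 1 2 h)
qed

lemma cmapI:
  assumes "bounded_complex A X" "bounded_complex A Y" "\<And>n. f n \<in> Arr A" "\<And>n. Dom A (f n) = deg X n"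
    "\<And>n. Cod A (f n) = deg Y n" "\<And>n. diff Y n \<cdot> f n = f (n + 1) \<cdot> diff X n"
  shows "cmap X Y f"
  unfolding cmap_def chain_map_def Hom_def using assms by blast

lemma cmap_Ide: "bounded_complex A X \<Longrightarrow> cmap X X (\<lambda>n. Ide A (deg X n))"
  by (rule cmapI) auto

lemma cmap_Zero: "bounded_complex A X \<Longrightarrow> bounded_complex A Y \<Longrightarrow> cmap X Y (\<lambda>n. Zero A (deg X n) (deg Y n))"
  by (rule cmapI) auto

lemma cmap_Comp: "cmap X Y f \<Longrightarrow> cmap Y Z g \<Longrightarrow> cmap X Z (\<lambda>n. g n \<cdot> f n)"
  by (rule cmapI) (simp_all add: cmap_simps[of X Y f] cmap_simps[of Y Z g])

lemma cmap_Add: "cmap X Y f \<Longrightarrow> cmap X Y g \<Longrightarrow> cmap X Y (\<lambda>n. f n \<boxplus> g n)"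
  by (rule cmapI) (simp_all add: cmap_simps[of X Y f] cmap_simps[of X Y g])

lemma cmap_neg: "cmap X Y f \<Longrightarrow> cmap X Y (\<lambda>n. neg A (f n))"
  by (rule cmapI) (simp_all add: cmap_simps[of X Y f])

definition hmap :: "('o, 'm) cochain \<Rightarrow> ('o, 'm) cochain \<Rightarrow> (int \<Rightarrow> 'm) \<Rightarrow> bool" where
  "hmap X Y h \<longleftrightarrow> (\<forall>n. h n \<in> Arr A \<and> Dom A (h n) = deg X n \<and> Cod A (h n) = deg Y (n - 1))"

lemma hmap_simps:
  assumes "hmap X Y h"
  shows "h n \<in> Arr A" "Dom A (h n) = deg X n" "Cod A (h n) = deg Y (n - 1)"
  using assms by (auto simp: hmap_def)

lemma homotopic_iff:
  "homotopic A X Y f g \<longleftrightarrow> (\<exists>h. hmap X Y h \<and>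
     (\<forall>n. f n = g n \<boxplus> ((diff Y (n - 1) \<cdot> h n) \<boxplus> (h (n + 1) \<cdot> diff X n))))"
  by (auto simp: homotopic_def hmap_def Hom_def)

lemma homotopicI:
  assumes "\<And>n. h n \<in> Arr A" "\<And>n. Dom A (h n) = deg X n" "\<And>n. Cod A (h n) = deg Y (n - 1)"
    "\<And>n. f n = g n \<boxplus> ((diff Y (n - 1) \<cdot> h n) \<boxplus> (h (n + 1) \<cdot> diff X n))"
  shows "homotopic A X Y f g"
  using assms by (auto simp: homotopic_iff hmap_def intro!: exI[of _ h])

lemma homotopic_eqI:
  assumes "cmap X Y f" "\<And>n. f n = g n"
  shows "homotopic A X Y f g"
proof -
  note [simp] = cmap_simps[OF assms(1)]
  show ?thesis
    by (rule homotopicI[where h="\<lambda>n. Zero A (deg X n) (deg Y (n - 1))"]) (simp_all flip: assms(2))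
qed

lemma homotopic_refl: "cmap X Y f \<Longrightarrow> homotopic A X Y f f"
  by (simp add: homotopic_eqI)

lemma homotopic_sym:
  assumes "cmap X Y f" "cmap X Y g" "homotopic A X Y f g"
  shows "homotopic A X Y g f"
proof -
  note [simp] = cmap_simps[OF assms(1)] cmap_simps[OF assms(2)]
  obtain h where "hmap X Y h"
    and h: "\<And>n. f n = g n \<boxplus> ((diff Y (n - 1) \<cdot> h n) \<boxplus> (h (n + 1) \<cdot> diff X n))"
    using assms(3) by (auto simp: homotopic_iff)
  note [simp] = hmap_simps[OF \<open>hmap X Y h\<close>]
  show ?thesis
  proof (rule homotopicI[where h="\<lambda>n. neg A (h n)"], simp_all add: h)
    show "g n = (g n \<boxplus> (diff Y (n - 1) \<cdot> h n \<boxplus> h (n + 1) \<cdot> diff X n)) \<boxplus>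
        (neg A (diff Y (n - 1) \<cdot> h n) \<boxplus> neg A (h (n + 1) \<cdot> diff X n))" for n
      by (rule lin_eqI[of "deg X n" "deg Y n"], ((rule lin_intros HomI) | simp)+)
  qed
qed

lemma homotopic_trans:
  assumes "cmap X Y f" "cmap X Y g" "cmap X Y k" "homotopic A X Y f g" "homotopic A X Y g k"
  shows "homotopic A X Y f k"
proof -
  note [simp] = cmap_simps[OF assms(1)] cmap_simps[OF assms(2)] cmap_simps[OF assms(3)]
  obtain h where "hmap X Y h"
    and h: "\<And>n. f n = g n \<boxplus> ((diff Y (n - 1) \<cdot> h n) \<boxplus> (h (n + 1) \<cdot> diff X n))"
    using assms(4) by (auto simp: homotopic_iff)
  note [simp] = hmap_simps[OF \<open>hmap X Y h\<close>]
  obtain h' where "hmap X Y h'"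
    and h': "\<And>n. g n = k n \<boxplus> ((diff Y (n - 1) \<cdot> h' n) \<boxplus> (h' (n + 1) \<cdot> diff X n))"
    using assms(5) by (auto simp: homotopic_iff)
  note [simp] = hmap_simps[OF \<open>hmap X Y h'\<close>]
  show ?thesis
    by (rule homotopicI[where h="\<lambda>n. h n \<boxplus> h' n"], simp_all add: h h')
      (rule lin_eqI, ((rule lin_intros HomI) | simp)+)
qed

lemma homotopic_Comp_left:
  assumes "cmap X Y f" "cmap X Y g" "cmap Y Z k" "homotopic A X Y f g"
  shows "homotopic A X Z (\<lambda>n. k n \<cdot> f n) (\<lambda>n. k n \<cdot> g n)"
proof -
  note [simp] = cmap_simps[OF assms(1)] cmap_simps[OF assms(2)] cmap_simps[OF assms(3)]
  obtain h where "hmap X Y h"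
    and h: "\<And>n. f n = g n \<boxplus> ((diff Y (n - 1) \<cdot> h n) \<boxplus> (h (n + 1) \<cdot> diff X n))"
    using assms(4) by (auto simp: homotopic_iff)
  note [simp] = hmap_simps[OF \<open>hmap X Y h\<close>]
  show ?thesis
    by (rule homotopicI[where h="\<lambda>n. k (n - 1) \<cdot> h n"], simp_all add: h)
qed

lemma homotopic_Comp_right:
  assumes "cmap X Y f" "cmap X Y g" "cmap W X k" "homotopic A X Y f g"
  shows "homotopic A W Y (\<lambda>n. f n \<cdot> k n) (\<lambda>n. g n \<cdot> k n)"
proof -
  note [simp] = cmap_simps[OF assms(1)] cmap_simps[OF assms(2)] cmap_simps[OF assms(3)]
  obtain h where "hmap X Y h"
    and h: "\<And>n. f n = g n \<boxplus> ((diff Y (n - 1) \<cdot> h n) \<boxplus> (h (n + 1) \<cdot> diff X n))"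
    using assms(4) by (auto simp: homotopic_iff)
  note [simp] = hmap_simps[OF \<open>hmap X Y h\<close>]
  show ?thesis
    by (rule homotopicI[where h="\<lambda>n. h n \<cdot> k n"], simp_all add: h)
qed

lemma homotopic_Comp:
  assumes "cmap X Y f" "cmap X Y f'" "cmap Y Z g" "cmap Y Z g'" "homotopic A X Y f f'" "homotopic A Y Z g g'"
  shows "homotopic A X Z (\<lambda>n. g n \<cdot> f n) (\<lambda>n. g' n \<cdot> f' n)"
  using homotopic_trans[OF _ _ _ homotopic_Comp_right[OF assms(3,4,1,6)] homotopic_Comp_left[OF assms(1,2,4,5)]]
    cmap_Comp assms by blast

lemma homotopic_Add:
  assumes "cmap X Y f" "cmap X Y f'" "cmap X Y g" "cmap X Y g'" "homotopic A X Y f f'" "homotopic A X Y g g'"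
  shows "homotopic A X Y (\<lambda>n. f n \<boxplus> g n) (\<lambda>n. f' n \<boxplus> g' n)"
proof -
  note [simp] = cmap_simps[OF assms(1)] cmap_simps[OF assms(2)] cmap_simps[OF assms(3)] cmap_simps[OF assms(4)]
  obtain h where "hmap X Y h"
    and h: "\<And>n. f n = f' n \<boxplus> ((diff Y (n - 1) \<cdot> h n) \<boxplus> (h (n + 1) \<cdot> diff X n))"
    using assms(5) by (auto simp: homotopic_iff)
  note [simp] = hmap_simps[OF \<open>hmap X Y h\<close>]
  obtain h' where "hmap X Y h'"
    and h': "\<And>n. g n = g' n \<boxplus> ((diff Y (n - 1) \<cdot> h' n) \<boxplus> (h' (n + 1) \<cdot> diff X n))"
    using assms(6) by (auto simp: homotopic_iff)
  note [simp] = hmap_simps[OF \<open>hmap X Y h'\<close>]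
  show ?thesis
    by (rule homotopicI[where h="\<lambda>n. h n \<boxplus> h' n"], simp_all add: h h')
      (rule lin_eqI, ((rule lin_intros HomI) | simp)+)
qed

end

section \<open>The homotopy category\<close>

lemma Kb_simps [simp]:
  "Obj (Kb A) = Collect (bounded_complex A)"
  "Ide (Kb A) = (\<lambda>X. htpy_class A X X (\<lambda>n. Ide A (deg X n)))"
  "Comp (Kb A) = htpy_comp A"
  "Shift_obj (Kb A) = shift_complex A" "Dist (Kb A) = distinguished_triangles A"
  by (simp_all add: Kb_def Kb_cat_def category.defs)

lemma Kb_cat_simps [simp]:
  "Obj (Kb_cat A) = Collect (bounded_complex A)" "Arr (Kb_cat A) = Arr (Kb A)" "Dom (Kb_cat A) = Dom (Kb A)"
  "Cod (Kb_cat A) = Cod (Kb A)" "Ide (Kb_cat A) = Ide (Kb A)" "Comp (Kb_cat A) = htpy_comp A"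
  by (simp_all add: Kb_def Kb_cat_def category.defs)

lemma Hom_Kb_cat [simp]: "Hom (Kb_cat A) = Hom (Kb A)"
  by (intro ext) (simp add: Hom_def)

lemma iso_arr_Kb_cat [simp]: "iso_arr (Kb_cat A) = iso_arr (Kb A)"
  by (intro ext) (simp add: iso_arr_def)

context additive_category
begin

lemma Arr_Kb: "Arr (Kb A) = {htpy_class A X Y f | X Y f. cmap X Y f}"
  by (simp add: Kb_def Kb_cat_def category.defs cmap_def)

lemma Dom_Cod_Kb [simp]: "Dom (Kb A) (htpy_class A X Y f) = X" "Cod (Kb A) (htpy_class A X Y f) = Y"
  by (simp_all add: htpy_class_def Kb_def Kb_cat_def category.defs)

lemma Hom_Kb: "\<phi> \<in> Hom (Kb A) X Y \<longleftrightarrow> (\<exists>f. cmap X Y f \<and> \<phi> = htpy_class A X Y f)"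
  by (auto simp: Hom_def Arr_Kb)

lemma htpy_class_in_Hom: "cmap X Y f \<Longrightarrow> htpy_class A X Y f \<in> Hom (Kb A) X Y"
  using Hom_Kb by blast

lemma htpy_class_in_Arr: "cmap X Y f \<Longrightarrow> htpy_class A X Y f \<in> Arr (Kb A)"
  using Arr_Kb by blast

lemma cmap_chain_map: "cmap X Y f \<Longrightarrow> chain_map A X Y g \<longleftrightarrow> cmap X Y g"
  unfolding cmap_def by blast

lemma htpy_class_eq_iff:
  assumes "cmap X Y f" "cmap X Y g"
  shows "htpy_class A X Y f = htpy_class A X Y g \<longleftrightarrow> homotopic A X Y f g"
proof
  assume "htpy_class A X Y f = htpy_class A X Y g"
  then have "{k. chain_map A X Y k \<and> homotopic A X Y f k} = {k. chain_map A X Y k \<and> homotopic A X Y g k}"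
    unfolding htpy_class_def by blast
  moreover have "chain_map A X Y g" using assms(2) cmap_def by blast
  ultimately show "homotopic A X Y f g" using homotopic_refl[OF assms(2)] by blast
next
  assume h: "homotopic A X Y f g"
  have "homotopic A X Y f k \<longleftrightarrow> homotopic A X Y g k" if "cmap X Y k" for k
    using homotopic_trans homotopic_sym h assms that by meson
  then show "htpy_class A X Y f = htpy_class A X Y g"
    unfolding htpy_class_def using cmap_chain_map[OF assms(1)] by blast
qed

text \<open>Composition of classes ranges over all representatives; homotopy is a congruence for
  composition, so one pair of representatives determines the result.\<close>

lemma htpy_comp_class:
  assumes f: "cmap X Y f" and g: "cmap Y Z g"
  shows "htpy_comp A (htpy_class A Y Z g) (htpy_class A X Y f) = htpy_class A X Z (\<lambda>n. g n \<cdot> f n)"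
proof -
  have gf: "cmap X Z (\<lambda>n. g n \<cdot> f n)" using cmap_Comp[OF f g] .
  have "(\<exists>f'. chain_map A X Y f' \<and> homotopic A X Y f f' \<and> (\<exists>g'. chain_map A Y Z g' \<and> homotopic A Y Z g g' \<and>
          homotopic A X Z (\<lambda>n. g' n \<cdot> f' n) k)) \<longleftrightarrow> homotopic A X Z (\<lambda>n. g n \<cdot> f n) k"
    if k: "cmap X Z k" for k
  proof
    assume "\<exists>f'. chain_map A X Y f' \<and> homotopic A X Y f f' \<and> (\<exists>g'. chain_map A Y Z g' \<and> homotopic A Y Z g g' \<and>
          homotopic A X Z (\<lambda>n. g' n \<cdot> f' n) k)"
    then obtain f' g' where f': "cmap X Y f'" "homotopic A X Y f f'" and g': "cmap Y Z g'" "homotopic A Y Z g g'"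
      and *: "homotopic A X Z (\<lambda>n. g' n \<cdot> f' n) k"
      using cmap_chain_map f g by blast
    show "homotopic A X Z (\<lambda>n. g n \<cdot> f n) k"
      using homotopic_trans[OF gf cmap_Comp[OF f'(1) g'(1)] k homotopic_Comp[OF f f'(1) g g'(1) f'(2) g'(2)] *] .
  next
    assume "homotopic A X Z (\<lambda>n. g n \<cdot> f n) k"
    then show "\<exists>f'. chain_map A X Y f' \<and> homotopic A X Y f f' \<and> (\<exists>g'. chain_map A Y Z g' \<and> homotopic A Y Z g g' \<and>
          homotopic A X Z (\<lambda>n. g' n \<cdot> f' n) k)"
      using homotopic_refl f g cmap_def by blast
  qed
  then have "{k. chain_map A X Z k \<and> (\<exists>f'\<in>{k. chain_map A X Y k \<and> homotopic A X Y f k}.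
      \<exists>g'\<in>{k. chain_map A Y Z k \<and> homotopic A Y Z g k}. homotopic A X Z (\<lambda>n. g' n \<cdot> f' n) k)}
      = {k. chain_map A X Z k \<and> homotopic A X Z (\<lambda>n. g n \<cdot> f n) k}"
    using cmap_chain_map[OF gf] by blast
  then show ?thesis by (simp only: htpy_comp_def htpy_class_def split_conv)
qed

lemma category_Kb: "category (Kb A)"
proof
  fix f assume "f \<in> Arr (Kb A)"
  then show "Dom (Kb A) f \<in> Obj (Kb A)" "Cod (Kb A) f \<in> Obj (Kb A)"
    by (auto simp: Arr_Kb cmap_simps(1,2))
next
  fix X assume "X \<in> Obj (Kb A)"
  then show "Ide (Kb A) X \<in> Hom (Kb A) X X" by (auto intro!: htpy_class_in_Hom cmap_Ide)
next
  fix f X Y g Z assume "f \<in> Hom (Kb A) X Y" "g \<in> Hom (Kb A) Y Z"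
  then show "Comp (Kb A) g f \<in> Hom (Kb A) X Z"
    by (auto simp: Hom_Kb htpy_comp_class intro: cmap_Comp)
next
  fix f X Y assume "f \<in> Hom (Kb A) X Y"
  then obtain f' where f: "cmap X Y f'" "f = htpy_class A X Y f'" by (auto simp: Hom_Kb)
  note [simp] = cmap_simps[OF f(1)]
  show "Comp (Kb A) (Ide (Kb A) Y) f = f" "Comp (Kb A) f (Ide (Kb A) X) = f"
    by (simp_all add: f htpy_comp_class[OF f(1)] htpy_comp_class[OF _ f(1)] cmap_Ide)
next
  fix f W X g Y h Z assume "f \<in> Hom (Kb A) W X" "g \<in> Hom (Kb A) X Y" "h \<in> Hom (Kb A) Y Z"
  then obtain f' g' h' where f: "cmap W X f'" "f = htpy_class A W X f'" and g: "cmap X Y g'" "g = htpy_class A X Y g'"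
    and h: "cmap Y Z h'" "h = htpy_class A Y Z h'" by (auto simp: Hom_Kb)
  show "Comp (Kb A) (Comp (Kb A) h g) f = Comp (Kb A) h (Comp (Kb A) g f)"
    using f g h by (simp add: htpy_comp_class cmap_Comp cmap_simps[of W X f'] cmap_simps[of X Y g'] cmap_simps[of Y Z h'])
qed

sublocale Kb: category "Kb A"
  by (rule category_Kb)

section \<open>Homotopy equivalences and contractible complexes\<close>

definition heq :: "('o, 'm) cochain \<Rightarrow> ('o, 'm) cochain \<Rightarrow> (int \<Rightarrow> 'm) \<Rightarrow> (int \<Rightarrow> 'm) \<Rightarrow> bool" where
  "heq X Y f g \<longleftrightarrow> cmap X Y f \<and> cmap Y X g \<and>
     homotopic A X X (\<lambda>n. g n \<cdot> f n) (\<lambda>n. Ide A (deg X n)) \<and>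
     homotopic A Y Y (\<lambda>n. f n \<cdot> g n) (\<lambda>n. Ide A (deg Y n))"

lemma iso_arr_Kb: "cmap X Y f \<Longrightarrow> iso_arr (Kb A) (htpy_class A X Y f) \<longleftrightarrow> (\<exists>g. heq X Y f g)"
proof -
  assume f: "cmap X Y f"
  have "iso_arr (Kb A) (htpy_class A X Y f) \<longleftrightarrow> (\<exists>g. cmap Y X g \<and>
      htpy_comp A (htpy_class A Y X g) (htpy_class A X Y f) = Ide (Kb A) X \<and>
      htpy_comp A (htpy_class A X Y f) (htpy_class A Y X g) = Ide (Kb A) Y)"
    unfolding iso_arr_def Dom_Cod_Kb Bex_def Hom_Kb Kb_simps(3) using htpy_class_in_Arr[OF f] by blast
  then show ?thesis
    using f cmap_Comp[OF f] cmap_Comp[OF _ f] cmap_Ide cmap_simps(1,2)[OF f]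
    by (auto simp: heq_def htpy_comp_class htpy_class_eq_iff)
qed

lemma isomorphic_Kb: "isomorphic (Kb A) X Y \<longleftrightarrow> (\<exists>f g. heq X Y f g)"
proof -
  have "isomorphic (Kb A) X Y \<longleftrightarrow> (\<exists>f. cmap X Y f \<and> iso_arr (Kb A) (htpy_class A X Y f))"
    unfolding isomorphic_def Bex_def Hom_Kb by blast
  then show ?thesis using iso_arr_Kb unfolding heq_def by blast
qed

lemma isomorphicI:
  assumes "cmap X Y f" "cmap Y X g" "homotopic A X X (\<lambda>n. g n \<cdot> f n) (\<lambda>n. Ide A (deg X n))"
    "homotopic A Y Y (\<lambda>n. f n \<cdot> g n) (\<lambda>n. Ide A (deg Y n))"
  shows "isomorphic (Kb A) X Y"
  using assms isomorphic_Kb heq_def by blast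

text \<open>A map into or out of \<open>X\<close> is its own composite with the identity of
  \<open>X\<close>, and is therefore null-homotopic together with it.\<close>

lemma contractible_is_zero:
  assumes X: "bounded_complex A X" and h: "homotopic A X X (\<lambda>n. Ide A (deg X n)) (\<lambda>n. Zero A (deg X n) (deg X n))"
  shows "is_zero_obj (Kb A) X"
proof -
  have 1: "htpy_class A Y X f = htpy_class A Y X (\<lambda>n. Zero A (deg Y n) (deg X n))" if f: "cmap Y X f" for Y f
    using htpy_class_eq_iff[OF f cmap_Zero] homotopic_Comp_right[OF cmap_Ide[OF X] cmap_Zero[OF X X] f h]
      cmap_simps[OF f] by simp
  have 2: "htpy_class A X Y f = htpy_class A X Y (\<lambda>n. Zero A (deg X n) (deg Y n))" if f: "cmap X Y f" for Y f
    using htpy_class_eq_iff[OF f cmap_Zero] homotopic_Comp_left[OF cmap_Ide[OF X] cmap_Zero[OF X X] f h]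
      cmap_simps[OF f] by simp
  show ?thesis
    unfolding is_zero_obj_def Kb_simps(1) mem_Collect_eq Hom_Kb
  proof (intro conjI ballI X)
    fix Y assume "Y \<in> Collect (bounded_complex A)"
    then have Y: "bounded_complex A Y" by simp
    show "\<exists>!\<phi>. \<exists>f. cmap Y X f \<and> \<phi> = htpy_class A Y X f"
      by (rule ex1I[of _ "htpy_class A Y X (\<lambda>n. Zero A (deg Y n) (deg X n))"])
        (use 1 cmap_Zero[OF Y X] in \<open>blast+\<close>)
    show "\<exists>!\<phi>. \<exists>f. cmap X Y f \<and> \<phi> = htpy_class A X Y f"
      by (rule ex1I[of _ "htpy_class A X Y (\<lambda>n. Zero A (deg X n) (deg Y n))"])
        (use 2 cmap_Zero[OF X Y] in \<open>blast+\<close>)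
  qed
qed

lemma zero_is_contractible:
  assumes "is_zero_obj (Kb A) X"
  shows "homotopic A X X (\<lambda>n. Ide A (deg X n)) (\<lambda>n. Zero A (deg X n) (deg X n))"
proof -
  have X: "bounded_complex A X" using assms by (simp add: is_zero_obj_def)
  then have "htpy_class A X X (\<lambda>n. Ide A (deg X n)) = htpy_class A X X (\<lambda>n. Zero A (deg X n) (deg X n))"
    using assms unfolding is_zero_obj_def
    unfolding Kb_simps(1) mem_Collect_eq using htpy_class_in_Hom[OF cmap_Ide[OF X]] htpy_class_in_Hom[OF cmap_Zero[OF X X]]
    by blast
  then show ?thesis using htpy_class_eq_iff X cmap_Ide cmap_Zero by blast
qed

lemma zero_complex_is_zero:
  assumes "bounded_complex A X" "\<And>n. is_zero_obj A (deg X n)"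
  shows "is_zero_obj (Kb A) X"
  using assms by (intro contractible_is_zero homotopic_eqI cmap_Ide) (auto simp: is_zero_obj_iff)

end

section \<open>Shifts and cones\<close>

text \<open>A composite is well typed for the simplifier only when the degrees of its ends agree
  syntactically; these rules normalize the degrees that differentials and homotopies
  produce.\<close>

lemma int_add_simps [simp]: "(n::int) + 1 + 1 = n + 2" "n + 2 + 1 = n + 3" "n + 1 + 2 = n + 3"
  "n + 2 - 1 = n + 1" "n + 3 - 1 = n + 2" "n - 1 + 2 = n + 1"
  by simp_all

context additive_category
begin

lemma shift_complex_simps [simp]:
  "deg (shift_complex A X) n = deg X (n + 1)" "diff (shift_complex A X) n = neg A (diff X (n + 1))"
  by (simp_all add: shift_complex_def)

text \<open>The sign makes this inverse to \<open>shift_complex\<close> on the nose for bounded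
  complexes, not only up to isomorphism.\<close>

definition unshift_complex :: "('o, 'm) cochain \<Rightarrow> ('o, 'm) cochain" where
  "unshift_complex X = \<lparr>deg = (\<lambda>n. deg X (n - 1)), diff = (\<lambda>n. neg A (diff X (n - 1)))\<rparr>"

lemma unshift_complex_simps [simp]:
  "deg (unshift_complex X) n = deg X (n - 1)" "diff (unshift_complex X) n = neg A (diff X (n - 1))"
  by (simp_all add: unshift_complex_def)

lemma bounded_complexI:
  assumes "\<And>n. deg X n \<in> Obj A" "\<And>n. diff X n \<in> Arr A" "\<And>n. Dom A (diff X n) = deg X n"
    "\<And>n. Cod A (diff X n) = deg X (n + 1)"
    "\<And>n. diff X (n + 1) \<cdot> diff X n = Zero A (deg X n) (deg X (n + 2))"
    "finite {n. \<not> is_zero_obj A (deg X n)}"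
  shows "bounded_complex A X"
  unfolding bounded_complex_def Hom_def using assms by blast

lemma bounded_shift [simp]:
  assumes "bounded_complex A X"
  shows "bounded_complex A (shift_complex A X)"
proof (rule bounded_complexI)
  have "{n. \<not> is_zero_obj A (deg (shift_complex A X) n)} = (\<lambda>n. n - 1) ` {n. \<not> is_zero_obj A (deg X n)}"
    by (force simp: image_iff algebra_simps)
  then show "finite {n. \<not> is_zero_obj A (deg (shift_complex A X) n)}"
    using bounded_complex_finite[OF assms] by simp
qed (simp_all add: assms)

lemma bounded_unshift [simp]:
  assumes "bounded_complex A X"
  shows "bounded_complex A (unshift_complex X)"
proof (rule bounded_complexI)
  have "{n. \<not> is_zero_obj A (deg (unshift_complex X) n)} = (\<lambda>n. n + 1) ` {n. \<not> is_zero_obj A (deg X n)}"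
    by (force simp: image_iff algebra_simps)
  then show "finite {n. \<not> is_zero_obj A (deg (unshift_complex X) n)}"
    using bounded_complex_finite[OF assms] by simp
qed (simp_all add: assms)

lemma cochain_eqI: "(\<And>n. deg X n = deg Y n) \<Longrightarrow> (\<And>n. diff X n = diff Y n) \<Longrightarrow> X = (Y :: ('o, 'm) cochain)"
  by (rule cochain.equality) (auto simp: fun_eq_iff)

lemma shift_unshift [simp]: "bounded_complex A X \<Longrightarrow> shift_complex A (unshift_complex X) = X"
  by (rule cochain_eqI) simp_all

lemma unshift_shift [simp]: "bounded_complex A X \<Longrightarrow> unshift_complex (shift_complex A X) = X"
  by (rule cochain_eqI) simp_all

lemma cmap_shift: "cmap X Y f \<Longrightarrow> cmap (shift_complex A X) (shift_complex A Y) (\<lambda>n. f (n + 1))"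
  by (rule cmapI) (simp_all add: cmap_simps[of X Y f])

lemma cmap_unshift: "cmap X Y f \<Longrightarrow> cmap (unshift_complex X) (unshift_complex Y) (\<lambda>n. f (n - 1))"
  by (rule cmapI) (simp_all add: cmap_simps[of X Y f])

lemma homotopic_shift:
  assumes "cmap X Y f" "cmap X Y g" "homotopic A X Y f g"
  shows "homotopic A (shift_complex A X) (shift_complex A Y) (\<lambda>n. f (n + 1)) (\<lambda>n. g (n + 1))"
proof -
  note [simp] = cmap_simps[OF assms(1)] cmap_simps[OF assms(2)]
  obtain h where "hmap X Y h"
    and h: "\<And>n. f n = g n \<boxplus> ((diff Y (n - 1) \<cdot> h n) \<boxplus> (h (n + 1) \<cdot> diff X n))"
    using assms(3) by (auto simp: homotopic_iff)
  note [simp] = hmap_simps[OF \<open>hmap X Y h\<close>]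
  \<comment> \<open>Shifting changes the sign of the differentials, so the homotopy has to change
    sign with them.\<close>
  show ?thesis
    by (rule homotopicI[where h="\<lambda>n. neg A (h (n + 1))"], simp_all add: h)
qed

lemma homotopic_unshift:
  assumes "cmap X Y f" "cmap X Y g" "homotopic A X Y f g"
  shows "homotopic A (unshift_complex X) (unshift_complex Y) (\<lambda>n. f (n - 1)) (\<lambda>n. g (n - 1))"
proof -
  note [simp] = cmap_simps[OF assms(1)] cmap_simps[OF assms(2)]
  obtain h where "hmap X Y h"
    and h: "\<And>n. f n = g n \<boxplus> ((diff Y (n - 1) \<cdot> h n) \<boxplus> (h (n + 1) \<cdot> diff X n))"
    using assms(3) by (auto simp: homotopic_iff)
  note [simp] = hmap_simps[OF \<open>hmap X Y h\<close>]
  show ?thesis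
    by (rule homotopicI[where h="\<lambda>n. neg A (h (n - 1))"], simp_all add: h)
qed

lemma heq_shift: "heq X Y f g \<Longrightarrow> heq (shift_complex A X) (shift_complex A Y) (\<lambda>n. f (n + 1)) (\<lambda>n. g (n + 1))"
proof -
  assume "heq X Y f g"
  then have f: "cmap X Y f" and g: "cmap Y X g" and h: "homotopic A X X (\<lambda>n. g n \<cdot> f n) (\<lambda>n. Ide A (deg X n))"
      "homotopic A Y Y (\<lambda>n. f n \<cdot> g n) (\<lambda>n. Ide A (deg Y n))"
    by (simp_all add: heq_def)
  show ?thesis
    using homotopic_shift[OF cmap_Comp[OF f g] cmap_Ide h(1)] homotopic_shift[OF cmap_Comp[OF g f] cmap_Ide h(2)]
      cmap_shift[OF f] cmap_shift[OF g] cmap_simps(1,2)[OF f]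
    by (simp add: heq_def)
qed

section \<open>Mapping cones\<close>

abbreviation "ci1 X Y n \<equiv> in1 (cone_biprod A X Y n)"
abbreviation "ci2 X Y n \<equiv> in2 (cone_biprod A X Y n)"
abbreviation "cp1 X Y n \<equiv> pr1 (cone_biprod A X Y n)"
abbreviation "cp2 X Y n \<equiv> pr2 (cone_biprod A X Y n)"

lemma cone_biprod:
  "bounded_complex A X \<Longrightarrow> bounded_complex A Y \<Longrightarrow> is_biproduct A (deg X (n + 1)) (deg Y n) (cone_biprod A X Y n)"
  unfolding cone_biprod_def by (rule biprod_is_biproduct) simp_all

lemma cone_biprod_simps [simp]:
  assumes "bounded_complex A X" "bounded_complex A Y"
  shows "bsum (cone_biprod A X Y n) \<in> Obj A"
    "ci1 X Y n \<in> Arr A" "ci2 X Y n \<in> Arr A" "cp1 X Y n \<in> Arr A" "cp2 X Y n \<in> Arr A"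
    "Dom A (ci1 X Y n) = deg X (n + 1)" "Dom A (ci2 X Y n) = deg Y n"
    "Cod A (ci1 X Y n) = bsum (cone_biprod A X Y n)" "Cod A (ci2 X Y n) = bsum (cone_biprod A X Y n)"
    "Cod A (cp1 X Y n) = deg X (n + 1)" "Cod A (cp2 X Y n) = deg Y n"
    "Dom A (cp1 X Y n) = bsum (cone_biprod A X Y n)" "Dom A (cp2 X Y n) = bsum (cone_biprod A X Y n)"
    "cp1 X Y n \<cdot> ci1 X Y n = Ide A (deg X (n + 1))" "cp2 X Y n \<cdot> ci2 X Y n = Ide A (deg Y n)"
    "cp1 X Y n \<cdot> ci2 X Y n = Zero A (deg Y n) (deg X (n + 1))" "cp2 X Y n \<cdot> ci1 X Y n = Zero A (deg X (n + 1)) (deg Y n)"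
  using biproduct_simps[OF cone_biprod[OF assms]] by simp_all

lemma cone_biprod_simps' [simp]:
  assumes "bounded_complex A X" "bounded_complex A Y" "h \<in> Arr A"
  shows
    "Cod A h = deg X (n + 1) \<Longrightarrow> cp1 X Y n \<cdot> (ci1 X Y n \<cdot> h) = h"
    "Cod A h = deg Y n \<Longrightarrow> cp2 X Y n \<cdot> (ci2 X Y n \<cdot> h) = h"
    "Cod A h = deg Y n \<Longrightarrow> cp1 X Y n \<cdot> (ci2 X Y n \<cdot> h) = Zero A (Dom A h) (deg X (n + 1))"
    "Cod A h = deg X (n + 1) \<Longrightarrow> cp2 X Y n \<cdot> (ci1 X Y n \<cdot> h) = Zero A (Dom A h) (deg Y n)"
  using assms by (simp_all flip: Comp_assoc')

lemma deg_cone [simp]: "deg (cone A X Y f) n = bsum (cone_biprod A X Y n)"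
  by (simp add: cone_def)

lemma from_cone_eqI:
  assumes "bounded_complex A X" "bounded_complex A Y" "f \<in> Arr A" "g \<in> Arr A"
    "Dom A f = bsum (cone_biprod A X Y n)" "Dom A g = bsum (cone_biprod A X Y n)" "Cod A f = Cod A g"
    "f \<cdot> ci1 X Y n = g \<cdot> ci1 X Y n" "f \<cdot> ci2 X Y n = g \<cdot> ci2 X Y n"
  shows "f = g"
  using biproduct_from_eqI[OF cone_biprod[OF assms(1,2)], of f n "Cod A f" g] assms by (simp add: Hom_def)

lemma to_cone_eqI:
  assumes "bounded_complex A X" "bounded_complex A Y" "f \<in> Arr A" "g \<in> Arr A"
    "Cod A f = bsum (cone_biprod A X Y n)" "Cod A g = bsum (cone_biprod A X Y n)" "Dom A f = Dom A g"
    "cp1 X Y n \<cdot> f = cp1 X Y n \<cdot> g" "cp2 X Y n \<cdot> f = cp2 X Y n \<cdot> g"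
  shows "f = g"
  using biproduct_to_eqI[OF cone_biprod[OF assms(1,2)], of f "Dom A f" n g] assms by (simp add: Hom_def)

text \<open>The differential of a cone is used henceforth only through these components. Writing the
  next degree as \<open>m\<close> with a premise lets the rules match it in any syntactic form, such
  as \<open>n\<close> after \<open>n - 1\<close>.\<close>

lemma diff_cone:
  assumes "cmap X Y f"
  shows "diff (cone A X Y f) n \<in> Arr A" "Dom A (diff (cone A X Y f) n) = bsum (cone_biprod A X Y n)"
    "Cod A (diff (cone A X Y f) n) = bsum (cone_biprod A X Y (n + 1))"
    "diff (cone A X Y f) n \<cdot> ci1 X Y n = neg A (ci1 X Y (n + 1) \<cdot> diff X (n + 1)) \<boxplus> (ci2 X Y (n + 1) \<cdot> f (n + 1))"
    "diff (cone A X Y f) n \<cdot> ci2 X Y n = ci2 X Y (n + 1) \<cdot> diff Y n"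
    "m = n + 1 \<Longrightarrow> cp1 X Y m \<cdot> diff (cone A X Y f) n = neg A (diff X m \<cdot> cp1 X Y n)"
    "m = n + 1 \<Longrightarrow> cp2 X Y m \<cdot> diff (cone A X Y f) n = (f m \<cdot> cp1 X Y n) \<boxplus> (diff Y n \<cdot> cp2 X Y n)"
  by (simp_all add: cone_def Let_def cmap_simps[OF assms])

lemma diff_cone':
  assumes "cmap X Y f" "h \<in> Arr A"
  shows "Cod A h = deg X (n + 1) \<Longrightarrow> diff (cone A X Y f) n \<cdot> (ci1 X Y n \<cdot> h)
      = neg A (ci1 X Y (n + 1) \<cdot> (diff X (n + 1) \<cdot> h)) \<boxplus> (ci2 X Y (n + 1) \<cdot> (f (n + 1) \<cdot> h))"
    "Cod A h = deg Y n \<Longrightarrow> diff (cone A X Y f) n \<cdot> (ci2 X Y n \<cdot> h) = ci2 X Y (n + 1) \<cdot> (diff Y n \<cdot> h)"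
    "m = n + 1 \<Longrightarrow> Cod A h = bsum (cone_biprod A X Y n) \<Longrightarrow>
      cp1 X Y m \<cdot> (diff (cone A X Y f) n \<cdot> h) = neg A (diff X m \<cdot> (cp1 X Y n \<cdot> h))"
    "m = n + 1 \<Longrightarrow> Cod A h = bsum (cone_biprod A X Y n) \<Longrightarrow>
      cp2 X Y m \<cdot> (diff (cone A X Y f) n \<cdot> h) = (f m \<cdot> (cp1 X Y n \<cdot> h)) \<boxplus> (diff Y n \<cdot> (cp2 X Y n \<cdot> h))"
  using assms(2)
  by (simp_all add: diff_cone[OF assms(1)] cmap_simps[OF assms(1)] flip: Comp_assoc')

lemma bounded_cone [simp]:
  assumes f: "cmap X Y f"
  shows "bounded_complex A (cone A X Y f)"
proof (rule bounded_complexI)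
  note [simp] = cmap_simps[OF f] diff_cone[OF f] diff_cone'[OF f]
  show "diff (cone A X Y f) (n + 1) \<cdot> diff (cone A X Y f) n
      = Zero A (deg (cone A X Y f) n) (deg (cone A X Y f) (n + 2))" for n
    by (rule from_cone_eqI[of X Y _ _ n]) simp_all
  have "is_zero_obj A (deg (cone A X Y f) n)" if "is_zero_obj A (deg X (n + 1))" "is_zero_obj A (deg Y n)" for n
    using biproduct_zero[OF cone_biprod] that by simp
  then have "{n. \<not> is_zero_obj A (deg (cone A X Y f) n)} \<subseteq>
      (\<lambda>n. n - 1) ` {n. \<not> is_zero_obj A (deg X n)} \<union> {n. \<not> is_zero_obj A (deg Y n)}"
    by (force simp: image_iff algebra_simps)
  then show "finite {n. \<not> is_zero_obj A (deg (cone A X Y f) n)}"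
    using bounded_complex_finite[of X] bounded_complex_finite[of Y] finite_subset by fastforce
qed (simp_all add: cmap_simps[OF f] diff_cone[OF f])

text \<open>The copairing of \<open>a\<close> and \<open>b\<close> on degree \<open>n\<close> of a
  cone. It does not mention the chain map, which affects only the differential.\<close>

definition ccp :: "('o, 'm) cochain \<Rightarrow> ('o, 'm) cochain \<Rightarrow> int \<Rightarrow> 'm \<Rightarrow> 'm \<Rightarrow> 'm" where
  "ccp X Y n a b = (a \<cdot> cp1 X Y n) \<boxplus> (b \<cdot> cp2 X Y n)"

lemma ccp_simps [simp]:
  assumes "bounded_complex A X" "bounded_complex A Y" "a \<in> Arr A" "b \<in> Arr A"
    "Dom A a = deg X (n + 1)" "Dom A b = deg Y n" "Cod A a = Cod A b"
  shows "ccp X Y n a b \<in> Arr A" "Dom A (ccp X Y n a b) = bsum (cone_biprod A X Y n)" "Cod A (ccp X Y n a b) = Cod A b"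
    "ccp X Y n a b \<cdot> ci1 X Y n = a" "ccp X Y n a b \<cdot> ci2 X Y n = b"
    "h \<in> Arr A \<Longrightarrow> Cod A h = deg X (n + 1) \<Longrightarrow> ccp X Y n a b \<cdot> (ci1 X Y n \<cdot> h) = a \<cdot> h"
    "h \<in> Arr A \<Longrightarrow> Cod A h = deg Y n \<Longrightarrow> ccp X Y n a b \<cdot> (ci2 X Y n \<cdot> h) = b \<cdot> h"
  using assms by (simp_all add: ccp_def)

lemma cmap_cone_in: assumes f: "cmap X Y f" shows "cmap Y (cone A X Y f) (\<lambda>n. ci2 X Y n)"
  by (rule cmapI) (simp_all add: cmap_simps[OF f] diff_cone[OF f] f)

lemma cmap_cone_out: assumes f: "cmap X Y f" shows "cmap (cone A X Y f) (shift_complex A X) (\<lambda>n. cp1 X Y n)"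
  by (rule cmapI) (simp_all add: cmap_simps[OF f] diff_cone[OF f] f)

text \<open>The projections \<open>cp2\<close> fail to commute with the differentials exactly by
  \<open>f\<close> after \<open>cp1\<close>, so they form the required homotopy.\<close>

lemma cone_out_null:
  assumes f: "cmap X Y f"
  shows "homotopic A (cone A X Y f) (shift_complex A Y) (\<lambda>n. f (n + 1) \<cdot> cp1 X Y n)
    (\<lambda>n. Zero A (deg (cone A X Y f) n) (deg (shift_complex A Y) n))"
proof -
  note [simp] = cmap_simps[OF f] diff_cone[OF f] diff_cone'[OF f]
  show ?thesis
    by (rule homotopicI[where h="\<lambda>n. cp2 X Y n"]; simp?)
      (rule lin_eqI, ((rule lin_intros HomI) | simp)+)
qed

text \<open>Dually, the injections \<open>ci1\<close> fail to commute with the differentials exactly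
  by \<open>ci2\<close> after \<open>f\<close>.\<close>

lemma cone_in_null:
  assumes f: "cmap X Y f"
  shows "homotopic A X (cone A X Y f) (\<lambda>n. ci2 X Y n \<cdot> f n) (\<lambda>n. Zero A (deg X n) (deg (cone A X Y f) n))"
proof -
  note [simp] = cmap_simps[OF f] diff_cone[OF f] diff_cone'[OF f]
  have [simp]: "diff (cone A X Y f) (n - 1) \<cdot> ci1 X Y (n - 1) = neg A (ci1 X Y n \<cdot> diff X n) \<boxplus> (ci2 X Y n \<cdot> f n)" for n
    using diff_cone(4)[OF f, of "n - 1"] by simp
  show ?thesis
    by (rule homotopicI[where h="\<lambda>n. ci1 X Y (n - 1)"]; simp?)
      (rule lin_eqI, ((rule lin_intros HomI) | simp)+)
qed

text \<open>In degree \<open>n\<close> a null-homotopy has components in \<open>deg X n\<close> and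
  \<open>deg Y (n - 1)\<close>. The first is the lift; the second, with its sign changed, is the
  homotopy from the lifted map to \<open>y\<close>.\<close>

lemma lift_of_cone_null:
  assumes f: "cmap X Y f" and y: "cmap T Y y"
    and 0: "homotopic A T (cone A X Y f) (\<lambda>n. ci2 X Y n \<cdot> y n) (\<lambda>n. Zero A (deg T n) (deg (cone A X Y f) n))"
  shows "\<exists>a. cmap T X a \<and> homotopic A T Y (\<lambda>n. f n \<cdot> a n) y"
proof -
  note [simp] = cmap_simps[OF f] diff_cone[OF f] diff_cone'[OF f] cmap_simps[OF y] f
  obtain h where "hmap T (cone A X Y f) h" and h: "\<And>n. ci2 X Y n \<cdot> y n = Zero A (deg T n) (deg (cone A X Y f) n) \<boxplus>
      ((diff (cone A X Y f) (n - 1) \<cdot> h n) \<boxplus> (h (n + 1) \<cdot> diff T n))"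
    using 0 by (auto simp: homotopic_iff)
  note [simp] = hmap_simps[OF \<open>hmap T (cone A X Y f) h\<close>]
  define a b where "a n = cp1 X Y (n - 1) \<cdot> h n" and "b n = cp2 X Y (n - 1) \<cdot> h n" for n
  have [simp]: "a n \<in> Arr A" "Dom A (a n) = deg T n" "Cod A (a n) = deg X n"
    "b n \<in> Arr A" "Dom A (b n) = deg T n" "Cod A (b n) = deg Y (n - 1)" for n
    by (simp_all add: a_def b_def)
  have 1: "cp1 X Y n \<cdot> (ci2 X Y n \<cdot> y n) = neg A (diff X n \<cdot> a n) \<boxplus> (a (n + 1) \<cdot> diff T n)"
    and 2: "cp2 X Y n \<cdot> (ci2 X Y n \<cdot> y n) = (f n \<cdot> a n) \<boxplus> (diff Y (n - 1) \<cdot> b n) \<boxplus> (b (n + 1) \<cdot> diff T n)" for n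
    by (simp_all only: h) (simp_all add: a_def b_def)
  have "cmap T X a"
  proof (rule cmapI)
    fix n
    have "neg A (diff X n \<cdot> a n) \<boxplus> (a (n + 1) \<cdot> diff T n) = Zero A (deg T n) (deg X (n + 1))"
      using 1[of n] by simp
    then have "(diff X n \<cdot> a n) \<boxplus> (neg A (diff X n \<cdot> a n) \<boxplus> (a (n + 1) \<cdot> diff T n)) = diff X n \<cdot> a n"
      by simp
    moreover have "(diff X n \<cdot> a n) \<boxplus> (neg A (diff X n \<cdot> a n) \<boxplus> (a (n + 1) \<cdot> diff T n)) = a (n + 1) \<cdot> diff T n"
      by (rule lin_eqI, ((rule lin_intros HomI) | simp)+)
    ultimately show "diff X n \<cdot> a n = a (n + 1) \<cdot> diff T n" by simp
  qed simp_all
  moreover have "homotopic A T Y (\<lambda>n. f n \<cdot> a n) y"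
  proof (rule homotopicI[where h="\<lambda>n. neg A (b n)"])
    fix n
    have "y n = (f n \<cdot> a n) \<boxplus> (diff Y (n - 1) \<cdot> b n) \<boxplus> (b (n + 1) \<cdot> diff T n)" using 2[of n] by simp
    then show "f n \<cdot> a n = y n \<boxplus> (diff Y (n - 1) \<cdot> neg A (b n) \<boxplus> neg A (b (n + 1)) \<cdot> diff T n)"
      by simp (rule lin_eqI, ((rule lin_intros HomI) | simp)+)
  qed simp_all
  ultimately show ?thesis by blast
qed

lemma cone_rotate:
  assumes f: "cmap X Y f"
  shows "isomorphic (Kb A) (cone A (cone A X Y f) (shift_complex A X) (\<lambda>n. cp1 X Y n)) (shift_complex A Y)"
proof -
  let ?C = "cone A X Y f" and ?X = "shift_complex A X"
  let ?P = "cone A ?C ?X (\<lambda>n. cp1 X Y n)"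
  note p = cmap_cone_out[OF f]
  note [simp] = cmap_simps[OF f] diff_cone[OF f] diff_cone'[OF f] f p cmap_simps[OF p] diff_cone[OF p] diff_cone'[OF p]
  \<comment> \<open>In degree \<open>n\<close> the iterated cone consists of
    \<open>deg X (n + 2)\<close>, \<open>deg Y (n + 1)\<close> and \<open>deg X (n + 1)\<close>. The
    two copies of \<open>X\<close> are contracted against each other by \<open>H\<close>; the term
    with \<open>f\<close> makes the projection to \<open>Y\<close> a chain map.\<close>
  define r where "r n = ccp ?C ?X n (cp2 X Y (n + 1)) (f (n + 1))" for n
  define s where "s n = ci1 ?C ?X n \<cdot> ci2 X Y (n + 1)" for n
  define H where "H n = ccp ?C ?X n (Zero A (bsum (cone_biprod A X Y (n + 1))) (deg ?P (n - 1)))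
      (neg A (ci1 ?C ?X (n - 1) \<cdot> ci1 X Y n))" for n
  have r: "cmap ?P (shift_complex A Y) r"
  proof (rule cmapI)
    show "diff (shift_complex A Y) n \<cdot> r n = r (n + 1) \<cdot> diff ?P n" for n
      by (rule from_cone_eqI[of ?C ?X _ _ n]; simp add: r_def)
        (rule lin_eqI, ((rule lin_intros HomI) | simp)+)
  qed (simp_all add: r_def)
  have s: "cmap (shift_complex A Y) ?P s"
    by (rule cmapI) (simp_all add: s_def)
  have rs: "r n \<cdot> s n = Ide A (deg (shift_complex A Y) n)" for n
    by (simp add: r_def s_def)
  have "homotopic A ?P ?P (\<lambda>n. s n \<cdot> r n) (\<lambda>n. Ide A (deg ?P n))"
  proof (rule homotopicI[where h=H])
    fix n
    let ?L = "s n \<cdot> r n" and ?R = "Ide A (deg ?P n) \<boxplus> (diff ?P (n - 1) \<cdot> H n \<boxplus> H (n + 1) \<cdot> diff ?P n)"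
    have [simp]: "s n \<in> Arr A" "Dom A (s n) = deg Y (n + 1)" "Cod A (s n) = deg ?P n"
      by (simp_all add: s_def)
    have 1: "?L \<cdot> ci1 ?C ?X n = ?R \<cdot> ci1 ?C ?X n"
      by (simp add: r_def H_def, rule from_cone_eqI[of X Y _ _ "n + 1"]; simp add: s_def)
    have 2: "?L \<cdot> ci2 ?C ?X n = ?R \<cdot> ci2 ?C ?X n"
      by (simp add: s_def r_def H_def) (rule lin_eqI, ((rule lin_intros HomI) | simp)+)
    show "?L = ?R"
      by (rule from_cone_eqI[OF _ _ _ _ _ _ _ 1 2]) (simp_all add: s_def r_def H_def)
  qed (simp_all add: H_def)
  then show ?thesis
    by (rule isomorphicI[OF r s _ homotopic_eqI[OF cmap_Comp[OF s r] rs]])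
qed

text \<open>The octahedron on \<open>s\<close> and \<open>t\<close> with explicit arrows:
  \<open>w\<close> is the identity on the components from \<open>X\<close> and \<open>t\<close> on
  the others.\<close>

lemma cone_Comp_octahedron:
  assumes s: "cmap X Y s" and t: "cmap Y Z t"
  defines "ts \<equiv> \<lambda>n. t n \<cdot> s n"
  defines "w \<equiv> \<lambda>n. ccp X Y n (ci1 X Z n) (ci2 X Z n \<cdot> t n)"
  shows "cmap (cone A X Y s) (cone A X Z ts) w"
    and "isomorphic (Kb A) (cone A (cone A X Y s) (cone A X Z ts) w) (cone A Y Z t)"
proof -
  have ts: "cmap X Z ts" unfolding ts_def by (rule cmap_Comp[OF s t])
  let ?S = "cone A X Y s" and ?T = "cone A Y Z t" and ?U = "cone A X Z ts"
  note [simp] = cmap_simps[OF s] diff_cone[OF s] diff_cone'[OF s] s t ts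
    cmap_simps[OF t] diff_cone[OF t] diff_cone'[OF t] cmap_simps(1,2)[OF ts] diff_cone[OF ts] diff_cone'[OF ts]
  have [simp]: "ts n \<in> Arr A" "Dom A (ts n) = deg X n" "Cod A (ts n) = deg Z n" for n by (simp_all add: ts_def)
  have ts_ap: "ts n = t n \<cdot> s n" for n by (simp add: ts_def)
  have w_arr [simp]: "w n \<in> Arr A" "Dom A (w n) = deg ?S n" "Cod A (w n) = deg ?U n"
    and w_ci [simp]: "w n \<cdot> ci1 X Y n = ci1 X Z n" "w n \<cdot> ci2 X Y n = ci2 X Z n \<cdot> t n"
    and w_ci' [simp]: "h \<in> Arr A \<Longrightarrow> Cod A h = deg X (n + 1) \<Longrightarrow> w n \<cdot> (ci1 X Y n \<cdot> h) = ci1 X Z n \<cdot> h"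
      "h \<in> Arr A \<Longrightarrow> Cod A h = deg Y n \<Longrightarrow> w n \<cdot> (ci2 X Y n \<cdot> h) = ci2 X Z n \<cdot> (t n \<cdot> h)" for n h
    by (simp_all add: w_def)
  show w: "cmap ?S ?U w"
  proof (rule cmapI)
    show "diff ?U n \<cdot> w n = w (n + 1) \<cdot> diff ?S n" for n
      by (rule from_cone_eqI[of X Y _ _ n]; simp add: ts_ap)
  qed simp_all
  let ?P = "cone A ?S ?U w"
  note [simp] = w diff_cone[OF w] diff_cone'[OF w] cmap_simps(1,2)[OF w]
  \<comment> \<open>As in the rotation, two copies of \<open>X\<close> cancel and the terms of the
    cone of \<open>t\<close> remain. The copy in \<open>?U\<close> is sent to \<open>Y\<close> by
    \<open>s\<close>, which is what compatibility with the differentials demands.\<close>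
  define r where "r n = ccp ?S ?U n (ci1 Y Z n \<cdot> cp2 X Y (n + 1)) (ccp X Z n (ci1 Y Z n \<cdot> s (n + 1)) (ci2 Y Z n))" for n
  define v where "v n = ccp Y Z n (ci1 ?S ?U n \<cdot> ci2 X Y (n + 1)) (ci2 ?S ?U n \<cdot> ci2 X Z n)" for n
  define H where "H n = ccp ?S ?U n (Zero A (bsum (cone_biprod A X Y (n + 1))) (deg ?P (n - 1)))
      (neg A (ci1 ?S ?U (n - 1) \<cdot> (ci1 X Y n \<cdot> cp1 X Z n)))" for n
  have r: "cmap ?P ?T r"
  proof (rule cmapI)
    fix n
    let ?L = "diff ?T n \<cdot> r n" and ?R = "r (n + 1) \<cdot> diff ?P n"
    have 1: "?L \<cdot> ci1 ?S ?U n = ?R \<cdot> ci1 ?S ?U n"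
      by (simp add: r_def, rule from_cone_eqI[of X Y _ _ "n + 1"]; simp)
    have 2: "?L \<cdot> ci2 ?S ?U n = ?R \<cdot> ci2 ?S ?U n"
      by (simp add: r_def, rule from_cone_eqI[of X Z _ _ n]; simp add: ts_ap)
    show "?L = ?R"
      by (rule from_cone_eqI[OF _ _ _ _ _ _ _ 1 2]) (simp_all add: r_def)
  qed (simp_all add: r_def)
  have v: "cmap ?T ?P v"
  proof (rule cmapI)
    show "diff ?P n \<cdot> v n = v (n + 1) \<cdot> diff ?T n" for n
      by (rule from_cone_eqI[of Y Z _ _ n]; simp add: v_def)
  qed (simp_all add: v_def)
  have rv: "r n \<cdot> v n = Ide A (deg ?T n)" for n
    by (rule from_cone_eqI[of Y Z _ _ n]; simp add: v_def r_def)
  have "homotopic A ?P ?P (\<lambda>n. v n \<cdot> r n) (\<lambda>n. Ide A (deg ?P n))"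
  proof (rule homotopicI[where h=H])
    fix n
    let ?L = "v n \<cdot> r n" and ?R = "Ide A (deg ?P n) \<boxplus> (diff ?P (n - 1) \<cdot> H n \<boxplus> H (n + 1) \<cdot> diff ?P n)"
    have [simp]: "v n \<in> Arr A" "Dom A (v n) = deg ?T n" "Cod A (v n) = deg ?P n"
      "v n \<cdot> ci1 Y Z n = ci1 ?S ?U n \<cdot> ci2 X Y (n + 1)"
      "v n \<cdot> ci2 Y Z n = ci2 ?S ?U n \<cdot> ci2 X Z n"
      "h \<in> Arr A \<Longrightarrow> Cod A h = deg Y (n + 1) \<Longrightarrow> v n \<cdot> (ci1 Y Z n \<cdot> h) = ci1 ?S ?U n \<cdot> (ci2 X Y (n + 1) \<cdot> h)" for n h
      by (simp_all add: v_def)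
    have 1: "?L \<cdot> ci1 ?S ?U n = ?R \<cdot> ci1 ?S ?U n"
      by (simp add: r_def H_def, rule from_cone_eqI[of X Y _ _ "n + 1"]; simp)
    have 2: "?L \<cdot> ci2 ?S ?U n = ?R \<cdot> ci2 ?S ?U n"
      by (simp add: r_def H_def, rule from_cone_eqI[of X Z _ _ n]; simp) 
        (rule lin_eqI, ((rule lin_intros HomI) | simp)+)
    show "?L = ?R"
      by (rule from_cone_eqI[OF _ _ _ _ _ _ _ 1 2]) (simp_all add: r_def H_def)
  qed (simp_all add: H_def)
  then show "isomorphic (Kb A) ?P ?T"
    by (rule isomorphicI[OF r v _ homotopic_eqI[OF cmap_Comp[OF v r] rv]])
qed

text \<open>Subtracting the boundary of \<open>ci1\<close> after the given homotopy \<open>h\<close>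
  removes the \<open>X\<close> component of \<open>c\<close>. The same boundary has a
  \<open>Y\<close> component, \<open>f\<close> after \<open>h\<close>, which is why \<open>y\<close>
  differs from \<open>u\<close> by it.\<close>

lemma to_cone_factor:
  assumes f: "cmap X Y f" and c: "cmap T (cone A X Y f) c"
    and 0: "homotopic A T (shift_complex A X) (\<lambda>n. cp1 X Y n \<cdot> c n) (\<lambda>n. Zero A (deg T n) (deg (shift_complex A X) n))"
  shows "\<exists>y. cmap T Y y \<and> homotopic A T (cone A X Y f) c (\<lambda>n. ci2 X Y n \<cdot> y n)"
proof -
  note [simp] = cmap_simps[OF f] diff_cone[OF f] diff_cone'[OF f] cmap_simps(1,3,4,5)[OF c] f
  have c5 [simp]: "Cod A (c n) = bsum (cone_biprod A X Y n)" for n by simp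
  obtain h where "hmap T (shift_complex A X) h" and h: "\<And>n. cp1 X Y n \<cdot> c n = Zero A (deg T n) (deg (shift_complex A X) n) \<boxplus>
      ((diff (shift_complex A X) (n - 1) \<cdot> h n) \<boxplus> (h (n + 1) \<cdot> diff T n))"
    using 0 by (auto simp: homotopic_iff)
  have [simp]: "h n \<in> Arr A" "Dom A (h n) = deg T n" "Cod A (h n) = deg X n" for n
    using hmap_simps[OF \<open>hmap T (shift_complex A X) h\<close>] by simp_all
  define u where "u n = cp2 X Y n \<cdot> c n" for n
  have [simp]: "u n \<in> Arr A" "Dom A (u n) = deg T n" "Cod A (u n) = deg Y n" for n
    by (simp_all add: u_def)
  have e: "cp1 X Y n \<cdot> c n = neg A (diff X n \<cdot> h n) \<boxplus> (h (n + 1) \<cdot> diff T n)" for n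
    by (simp add: h)
  have ud: "u (n + 1) \<cdot> diff T n = (f (n + 1) \<cdot> (cp1 X Y n \<cdot> c n)) \<boxplus> (diff Y n \<cdot> u n)" for n
  proof -
    have "u (n + 1) \<cdot> diff T n = cp2 X Y (n + 1) \<cdot> (diff (cone A X Y f) n \<cdot> c n)"
      by (simp add: u_def cmap_simps(6)[OF c] del: diff_cone')
    then show ?thesis by (simp add: u_def)
  qed
  define y where "y n = u n \<boxplus> neg A (f n \<cdot> h n)" for n
  have y: "cmap T Y y"
    by (rule cmapI; simp add: y_def ud e) (rule lin_eqI, ((rule lin_intros HomI) | simp)+)
  moreover have "homotopic A T (cone A X Y f) c (\<lambda>n. ci2 X Y n \<cdot> y n)"
  proof (rule homotopicI[where h="\<lambda>n. ci1 X Y (n - 1) \<cdot> h n"])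
    fix n
    let ?R = "(ci2 X Y n \<cdot> y n) \<boxplus> ((diff (cone A X Y f) (n - 1) \<cdot> (ci1 X Y (n - 1) \<cdot> h n)) \<boxplus>
        ((ci1 X Y (n + 1 - 1) \<cdot> h (n + 1)) \<cdot> diff T n))"
    have *: "diff (cone A X Y f) (n - 1) \<cdot> (ci1 X Y (n - 1) \<cdot> h n) = neg A (ci1 X Y n \<cdot> (diff X n \<cdot> h n)) \<boxplus> (ci2 X Y n \<cdot> (f n \<cdot> h n))"
      using diff_cone'(1)[OF f, of "h n" "n - 1"] by simp
    have 1: "cp1 X Y n \<cdot> c n = cp1 X Y n \<cdot> ?R"
      by (simp add: * e cmap_simps(3-5)[OF y])
    have 2: "cp2 X Y n \<cdot> c n = cp2 X Y n \<cdot> ?R"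
      by (simp add: * cmap_simps(3-5)[OF y] flip: u_def)
        (simp add: y_def, rule lin_eqI, ((rule lin_intros HomI) | simp)+)
    show "c n = ?R"
      by (rule to_cone_eqI[OF _ _ _ _ _ _ _ 1 2]) (simp_all add: * cmap_simps(3-5)[OF y])
  qed simp_all
  ultimately show ?thesis by blast
qed

text \<open>The projection \<open>cp1\<close> is homotopic to its composite with \<open>f\<close>
  and then \<open>g\<close>, hence null, so the identity of the cone factors as \<open>ci2\<close>
  after some \<open>y\<close>. Replacing \<open>y\<close> by \<open>f g y\<close> makes this null
  too, because \<open>ci2\<close> after \<open>f\<close> is.\<close>

lemma cone_of_heq:
  assumes fg: "heq X Y f g"
  shows "is_zero_obj (Kb A) (cone A X Y f)"
proof -
  let ?C = "cone A X Y f" and ?X = "shift_complex A X" and ?Y = "shift_complex A Y"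
  have f: "cmap X Y f" and g: "cmap Y X g" and fg': "homotopic A Y Y (\<lambda>n. f n \<cdot> g n) (\<lambda>n. Ide A (deg Y n))"
    using fg by (simp_all add: heq_def)
  note [simp] = f cmap_simps[OF f] cmap_simps[OF g]
  note p = cmap_cone_out[OF f] and i = cmap_cone_in[OF f]
  have g': "cmap ?Y ?X (\<lambda>n. g (n + 1))" and f': "cmap ?X ?Y (\<lambda>n. f (n + 1))" using cmap_shift f g by auto
  have gf': "homotopic A ?X ?X (\<lambda>n. g (n + 1) \<cdot> f (n + 1)) (\<lambda>n. Ide A (deg ?X n))"
    using heq_shift[OF fg] by (simp add: heq_def)
  have 1: "homotopic A ?C ?X (\<lambda>n. g (n + 1) \<cdot> (f (n + 1) \<cdot> cp1 X Y n)) (\<lambda>n. Zero A (deg ?C n) (deg ?X n))"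
    using homotopic_Comp_left[OF cmap_Comp[OF p f'] cmap_Zero g' cone_out_null[OF f]] by simp
  have 2: "homotopic A ?C ?X (\<lambda>n. g (n + 1) \<cdot> (f (n + 1) \<cdot> cp1 X Y n)) (\<lambda>n. cp1 X Y n)"
    using homotopic_Comp_right[OF cmap_Comp[OF f' g'] cmap_Ide p gf'] by simp
  have 3: "homotopic A ?C ?X (\<lambda>n. cp1 X Y n) (\<lambda>n. Zero A (deg ?C n) (deg ?X n))"
    using homotopic_trans[OF p _ cmap_Zero homotopic_sym[OF _ p 2] 1] cmap_Comp[OF cmap_Comp[OF p f'] g'] by simp
  obtain y where y: "cmap ?C Y y" and idy: "homotopic A ?C ?C (\<lambda>n. Ide A (deg ?C n)) (\<lambda>n. ci2 X Y n \<cdot> y n)"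
    using to_cone_factor[OF f cmap_Ide[OF bounded_cone[OF f]]] 3 by auto
  note [simp] = cmap_simps(3-5)[OF y]
  have fgy: "homotopic A ?C Y y (\<lambda>n. f n \<cdot> (g n \<cdot> y n))"
    using homotopic_Comp_right[OF cmap_Comp[OF g f] cmap_Ide y fg'] homotopic_sym cmap_Comp[OF y cmap_Comp[OF g f]] y
    by simp
  have fgy': "cmap ?C Y (\<lambda>n. f n \<cdot> (g n \<cdot> y n))" using cmap_Comp[OF cmap_Comp[OF y g] f] .
  have 4: "homotopic A ?C ?C (\<lambda>n. ci2 X Y n \<cdot> y n) (\<lambda>n. ci2 X Y n \<cdot> (f n \<cdot> (g n \<cdot> y n)))"
    using homotopic_Comp_left[OF y fgy' i fgy] .
  have 5: "homotopic A ?C ?C (\<lambda>n. ci2 X Y n \<cdot> (f n \<cdot> (g n \<cdot> y n))) (\<lambda>n. Zero A (deg ?C n) (deg ?C n))"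
    using homotopic_Comp_right[OF cmap_Comp[OF f i] cmap_Zero cmap_Comp[OF y g] cone_in_null[OF f]] by simp
  show ?thesis
    by (rule contractible_is_zero, simp,
        rule homotopic_trans[OF cmap_Ide _ cmap_Zero idy homotopic_trans[OF _ _ cmap_Zero 4 5]])
      (simp_all add: cmap_Comp[OF y i] cmap_Comp[OF fgy' i])
qed

text \<open>A homotopy between \<open>s f\<close> and \<open>s g\<close> is the same datum as a map
  to the fibre of \<open>s\<close> lying over \<open>f - g\<close>; up to sign it is the
  \<open>Y\<close> component of that map.\<close>

lemma cmap_to_unshift_cone:
  assumes s: "cmap X Y s" and f: "cmap W X f" and g: "cmap W X g"
    and sfg: "homotopic A W Y (\<lambda>n. s n \<cdot> f n) (\<lambda>n. s n \<cdot> g n)"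
  shows "\<exists>k. cmap W (unshift_complex (cone A X Y s)) k \<and> (\<forall>n. cp1 X Y (n - 1) \<cdot> k n = f n \<boxplus> neg A (g n))"
proof -
  note [simp] = s cmap_simps[OF s] diff_cone[OF s] diff_cone'[OF s] cmap_simps[OF f] cmap_simps[OF g]
  obtain h where "hmap W Y h" and h: "\<And>n. s n \<cdot> f n = (s n \<cdot> g n) \<boxplus> ((diff Y (n - 1) \<cdot> h n) \<boxplus> (h (n + 1) \<cdot> diff W n))"
    using sfg by (auto simp: homotopic_iff)
  note [simp] = hmap_simps[OF \<open>hmap W Y h\<close>]
  define k where "k n = (ci1 X Y (n - 1) \<cdot> (f n \<boxplus> neg A (g n))) \<boxplus> neg A (ci2 X Y (n - 1) \<cdot> h n)" for n
  have *: "diff (cone A X Y s) (n - 1) \<cdot> (ci1 X Y (n - 1) \<cdot> b) = neg A (ci1 X Y n \<cdot> (diff X n \<cdot> b)) \<boxplus> (ci2 X Y n \<cdot> (s n \<cdot> b))"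
      if "b \<in> Arr A" "Cod A b = deg X n" for b n
      using diff_cone'(1)[OF s, of b "n - 1"] that by simp
  have ** [simp]: "ci1 X Y (n - 1) \<in> Arr A" "Dom A (ci1 X Y (n - 1)) = deg X n" "Cod A (ci1 X Y (n - 1)) = bsum (cone_biprod A X Y (n - 1))" for n
    using cone_biprod_simps[of X Y "n - 1"] by simp_all
  have "cmap W (unshift_complex (cone A X Y s)) k"
    by (rule cmapI; simp add: k_def * h)
      (rule lin_eqI, ((rule lin_intros HomI) | simp)+)
  moreover have "cp1 X Y (n - 1) \<cdot> k n = f n \<boxplus> neg A (g n)" for n
    by (simp add: k_def cone_biprod_simps'(1)[of X Y _ "n - 1", simplified] cone_biprod_simps'(3)[of X Y _ "n - 1", simplified] cone_biprod_simps(10)[of X Y "n - 1", simplified])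
  ultimately show ?thesis by blast
qed

section \<open>Homotopy retracts and cones\<close>

definition hretract :: "('o, 'm) cochain \<Rightarrow> ('o, 'm) cochain \<Rightarrow> bool" where
  "hretract X Y \<longleftrightarrow> (\<exists>j r. cmap X Y j \<and> cmap Y X r \<and> homotopic A X X (\<lambda>n. r n \<cdot> j n) (\<lambda>n. Ide A (deg X n)))"

lemma hretract_trans:
  assumes "hretract X Y" "hretract Y Z"
  shows "hretract X Z"
proof -
  obtain j r where j: "cmap X Y j" "cmap Y X r" "homotopic A X X (\<lambda>n. r n \<cdot> j n) (\<lambda>n. Ide A (deg X n))"
    using assms(1) hretract_def by blast
  obtain j' r' where j': "cmap Y Z j'" "cmap Z Y r'" "homotopic A Y Y (\<lambda>n. r' n \<cdot> j' n) (\<lambda>n. Ide A (deg Y n))"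
    using assms(2) hretract_def by blast
  note [simp] = cmap_simps[OF j(1)] cmap_simps[OF j(2)] cmap_simps[OF j'(1)] cmap_simps[OF j'(2)]
  have 1: "homotopic A X X (\<lambda>n. r n \<cdot> (r' n \<cdot> (j' n \<cdot> j n))) (\<lambda>n. r n \<cdot> j n)"
    using homotopic_Comp_left[OF cmap_Comp[OF j(1) cmap_Comp[OF j'(1,2)]] j(1) j(2)]
      homotopic_Comp_right[OF cmap_Comp[OF j'(1,2)] cmap_Ide j(1) j'(3)] by simp
  have "homotopic A X X (\<lambda>n. r n \<cdot> (r' n \<cdot> (j' n \<cdot> j n))) (\<lambda>n. Ide A (deg X n))"
    using homotopic_trans[OF _ cmap_Comp[OF j(1,2)] cmap_Ide 1 j(3)]
      cmap_Comp[OF cmap_Comp[OF j(1) cmap_Comp[OF j'(1,2)]] j(2)] by simp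
  then show ?thesis
    unfolding hretract_def using cmap_Comp[OF j(1) j'(1)] cmap_Comp[OF j'(2) j(2)] by fastforce
qed

lemma hretract_cone_target:
  assumes f: "cmap X Y f" and j: "cmap Y Y' j" and r: "cmap Y' Y r"
    and rj: "homotopic A Y Y (\<lambda>n. r n \<cdot> j n) (\<lambda>n. Ide A (deg Y n))"
  shows "hretract (cone A X Y f) (cone A X Y' (\<lambda>n. j n \<cdot> f n))"
proof -
  have jf: "cmap X Y' (\<lambda>n. j n \<cdot> f n)" using cmap_Comp f j by blast
  let ?C = "cone A X Y f" and ?C' = "cone A X Y' (\<lambda>n. j n \<cdot> f n)"
  note [simp] = f jf cmap_simps[OF f] cmap_simps[OF j] cmap_simps[OF r] diff_cone[OF f] diff_cone'[OF f] diff_cone[OF jf] diff_cone'[OF jf]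
  obtain h where "hmap Y Y h" and h: "\<And>n. r n \<cdot> j n = Ide A (deg Y n) \<boxplus> ((diff Y (n - 1) \<cdot> h n) \<boxplus> (h (n + 1) \<cdot> diff Y n))"
    using rj by (auto simp: homotopic_iff)
  note [simp] = hmap_simps[OF \<open>hmap Y Y h\<close>]
  have h': "r n \<cdot> (j n \<cdot> b) = b \<boxplus> ((diff Y (n - 1) \<cdot> (h n \<cdot> b)) \<boxplus> (h (n + 1) \<cdot> (diff Y n \<cdot> b)))"
    if "b \<in> Arr A" "Cod A b = deg Y n" for b n
    using that by (simp flip: Comp_assoc') (simp add: h)
  define M where "M n = ccp X Y n (ci1 X Y' n) (ci2 X Y' n \<cdot> j n)" for n
  \<comment> \<open>Since \<open>r\<close> after \<open>j\<close> is the identity only up to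
    \<open>h\<close>, the retraction needs the extra entry \<open>h\<close> after \<open>f\<close>
    from \<open>X\<close> to \<open>Y\<close> to commute with the differentials.\<close>
  define N where "N n = ccp X Y' n (ci1 X Y n \<boxplus> (ci2 X Y n \<cdot> (h (n + 1) \<cdot> f (n + 1)))) (ci2 X Y n \<cdot> r n)" for n
  define H where "H n = ccp X Y n (Zero A (deg X (n + 1)) (deg ?C (n - 1))) (ci2 X Y (n - 1) \<cdot> h n)" for n
  have M: "cmap ?C ?C' M" unfolding M_def by (rule cone_Comp_octahedron[OF f j])
  have N: "cmap ?C' ?C N"
  proof (rule cmapI)
    show "diff ?C n \<cdot> N n = N (n + 1) \<cdot> diff ?C' n" for n
      by (rule from_cone_eqI[of X Y' _ _ n]; simp add: N_def h')
        (rule lin_eqI, ((rule lin_intros HomI) | simp)+)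
  qed (simp_all add: N_def)
  have "homotopic A ?C ?C (\<lambda>n. N n \<cdot> M n) (\<lambda>n. Ide A (deg ?C n))"
  proof (rule homotopicI[where h=H])
    show "N n \<cdot> M n = Ide A (deg ?C n) \<boxplus> ((diff ?C (n - 1) \<cdot> H n) \<boxplus> (H (n + 1) \<cdot> diff ?C n))" for n
      by (rule from_cone_eqI[of X Y _ _ n]; simp add: N_def M_def H_def h)
  qed (simp_all add: H_def)
  then show ?thesis using M N hretract_def by blast
qed

lemma hretract_cone_source:
  assumes f: "cmap X Y f" and j: "cmap X X' j" and r: "cmap X' X r"
    and rj: "homotopic A X X (\<lambda>n. r n \<cdot> j n) (\<lambda>n. Ide A (deg X n))"
  shows "hretract (cone A X Y f) (cone A X' Y (\<lambda>n. f n \<cdot> r n))"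
proof -
  have fr: "cmap X' Y (\<lambda>n. f n \<cdot> r n)" using cmap_Comp f r by blast
  let ?C = "cone A X Y f" and ?C' = "cone A X' Y (\<lambda>n. f n \<cdot> r n)"
  note [simp] = f fr cmap_simps[OF f] cmap_simps[OF j] cmap_simps[OF r] diff_cone[OF f] diff_cone'[OF f] diff_cone[OF fr] diff_cone'[OF fr]
  obtain h where "hmap X X h" and h: "\<And>n. r n \<cdot> j n = Ide A (deg X n) \<boxplus> ((diff X (n - 1) \<cdot> h n) \<boxplus> (h (n + 1) \<cdot> diff X n))"
    using rj by (auto simp: homotopic_iff)
  note [simp] = hmap_simps[OF \<open>hmap X X h\<close>]
  \<comment> \<open>Here the correction belongs to the inclusion: \<open>f r j\<close> differs from
    \<open>f\<close> by the boundary of \<open>f\<close> after \<open>h\<close>. It is negative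
    because \<open>X\<close> sits in the cone with its differential negated.\<close>
  define M where "M n = ccp X Y n ((ci1 X' Y n \<cdot> j (n + 1)) \<boxplus> neg A (ci2 X' Y n \<cdot> (f n \<cdot> h (n + 1)))) (ci2 X' Y n)" for n
  define N where "N n = ccp X' Y n (ci1 X Y n \<cdot> r (n + 1)) (ci2 X Y n)" for n
  define H where "H n = ccp X Y n (neg A (ci1 X Y (n - 1) \<cdot> h (n + 1))) (Zero A (deg Y n) (deg ?C (n - 1)))" for n
  have M: "cmap ?C ?C' M"
  proof (rule cmapI)
    show "diff ?C' n \<cdot> M n = M (n + 1) \<cdot> diff ?C n" for n
      by (rule from_cone_eqI[of X Y _ _ n]; simp add: M_def h)
        (rule lin_eqI, ((rule lin_intros HomI) | simp)+)
  qed (simp_all add: M_def)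
  have N: "cmap ?C' ?C N"
  proof (rule cmapI)
    show "diff ?C n \<cdot> N n = N (n + 1) \<cdot> diff ?C' n" for n
      by (rule from_cone_eqI[of X' Y _ _ n]; simp add: N_def)
  qed (simp_all add: N_def)
  have "homotopic A ?C ?C (\<lambda>n. N n \<cdot> M n) (\<lambda>n. Ide A (deg ?C n))"
  proof (rule homotopicI[where h=H])
    show "N n \<cdot> M n = Ide A (deg ?C n) \<boxplus> ((diff ?C (n - 1) \<cdot> H n) \<boxplus> (H (n + 1) \<cdot> diff ?C n))" for n
      by (rule from_cone_eqI[of X Y _ _ n]; simp add: N_def M_def H_def h)
        (rule lin_eqI, ((rule lin_intros HomI) | simp)+)
  qed (simp_all add: H_def)
  then show ?thesis using M N hretract_def by blast
qed

end

section \<open>Morphisms with cone in a triangulated subcategory\<close>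

context additive_category
begin

lemma shift_htpy_class:
  assumes f: "cmap X Y f"
  shows "shift_htpy_arr A (htpy_class A X Y f) = htpy_class A (shift_complex A X) (shift_complex A Y) (\<lambda>n. f (n + 1))"
proof -
  note XY = cmap_simps(1,2)[OF f]
  have "(\<lambda>g n. g (n + 1)) ` {g. chain_map A X Y g \<and> homotopic A X Y f g} =
      {g. chain_map A (shift_complex A X) (shift_complex A Y) g \<and>
          homotopic A (shift_complex A X) (shift_complex A Y) (\<lambda>n. f (n + 1)) g}" (is "?L = ?R")
  proof
    show "?L \<subseteq> ?R"
      using cmap_chain_map[OF f] cmap_chain_map[OF cmap_shift[OF f]] cmap_shift homotopic_shift[OF f] by blast
    \<comment> \<open>Shifting back exhibits each representative between the shifts as the shift of
      a representative.\<close>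
    show "?R \<subseteq> ?L"
    proof
      fix g assume "g \<in> ?R"
      then have g: "cmap (shift_complex A X) (shift_complex A Y) g"
        "homotopic A (shift_complex A X) (shift_complex A Y) (\<lambda>n. f (n + 1)) g"
        using cmap_chain_map[OF cmap_shift[OF f]] by blast+
      have "cmap X Y (\<lambda>n. g (n - 1))" "homotopic A X Y f (\<lambda>n. g (n - 1))"
        using cmap_unshift[OF g(1)] homotopic_unshift[OF cmap_shift[OF f] g] XY by simp_all
      then have "(\<lambda>n. g (n - 1)) \<in> {g. chain_map A X Y g \<and> homotopic A X Y f g}"
        using cmap_def by blast
      then show "g \<in> ?L" by (intro image_eqI[where x="\<lambda>n. g (n - 1)"]) auto
    qed
  qed
  then show ?thesis by (simp only: shift_htpy_arr_def htpy_class_def split_conv)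
qed

lemma standard_triangles_eq:
  "standard_triangles A = {(htpy_class A X Y f, htpy_class A Y (cone A X Y f) (\<lambda>n. ci2 X Y n),
     htpy_class A (cone A X Y f) (shift_complex A X) (\<lambda>n. cp1 X Y n)) | X Y f. cmap X Y f}"
  unfolding standard_triangles_def cmap_def by blast

text \<open>Extracts what decides whether a cone lies in \<open>D\<close>: the square on the first
  arrows, at the level of chain maps, and the isomorphism class of the third object.\<close>

lemma distinguishedE:
  assumes "(\<phi>, g, h) \<in> distinguished_triangles A"
  obtains X Y Z X' Y' f k \<alpha> \<alpha>' \<beta> \<beta>' where "cmap X Y f" "\<phi> = htpy_class A X Y f" "g \<in> Hom (Kb A) Y Z"
    "cmap X' Y' k" "isomorphic (Kb A) Z (cone A X' Y' k)" "heq X X' \<alpha> \<alpha>'" "heq Y Y' \<beta> \<beta>'"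
    "homotopic A X Y' (\<lambda>n. \<beta> n \<cdot> f n) (\<lambda>n. k n \<cdot> \<alpha> n)"
proof -
  obtain X Y Z f' g' h' a b c where \<phi>: "\<phi> \<in> Hom (Kb A) X Y" and g: "g \<in> Hom (Kb A) Y Z"
    and std: "(f', g', h') \<in> standard_triangles A"
    and a: "a \<in> Hom (Kb A) X (Dom (Kb A) f')" "iso_arr (Kb A) a"
    and b: "b \<in> Hom (Kb A) Y (Dom (Kb A) g')" "iso_arr (Kb A) b"
    and c: "c \<in> Hom (Kb A) Z (Dom (Kb A) h')" "iso_arr (Kb A) c"
    and sq: "htpy_comp A b \<phi> = htpy_comp A f' a"
    using assms unfolding distinguished_triangles_def Hom_Kb_cat iso_arr_Kb_cat Kb_cat_simps mem_Collect_eq split_conv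
    by (elim exE conjE bexE case_prodE) blast
  obtain X' Y' k where k: "cmap X' Y' k" "f' = htpy_class A X' Y' k"
    "g' = htpy_class A Y' (cone A X' Y' k) (\<lambda>n. ci2 X' Y' n)"
    "h' = htpy_class A (cone A X' Y' k) (shift_complex A X') (\<lambda>n. cp1 X' Y' n)"
    using std unfolding standard_triangles_eq by blast
  obtain f where f: "cmap X Y f" "\<phi> = htpy_class A X Y f" using \<phi> Hom_Kb by blast
  obtain \<alpha> where \<alpha>: "cmap X X' \<alpha>" "a = htpy_class A X X' \<alpha>" using a k(2) Hom_Kb by auto
  obtain \<beta> where \<beta>: "cmap Y Y' \<beta>" "b = htpy_class A Y Y' \<beta>" using b k(3) Hom_Kb by auto
  obtain \<alpha>' where \<alpha>': "heq X X' \<alpha> \<alpha>'" using a(2) iso_arr_Kb[OF \<alpha>(1)] \<alpha>(2) by blast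
  obtain \<beta>' where \<beta>': "heq Y Y' \<beta> \<beta>'" using b(2) iso_arr_Kb[OF \<beta>(1)] \<beta>(2) by blast
  have "homotopic A X Y' (\<lambda>n. \<beta> n \<cdot> f n) (\<lambda>n. k n \<cdot> \<alpha> n)"
    using sq htpy_class_eq_iff[OF cmap_Comp[OF f(1) \<beta>(1)] cmap_Comp[OF \<alpha>(1) k(1)]] htpy_comp_class f \<alpha> \<beta> k by simp
  moreover have "isomorphic (Kb A) Z (cone A X' Y' k)"
    using c unfolding isomorphic_def k(4) Dom_Cod_Kb by blast
  ultimately show ?thesis using that f g k(1) \<alpha>' \<beta>' by blast
qed

lemma heq_Ide: "bounded_complex A X \<Longrightarrow> heq X X (\<lambda>n. Ide A (deg X n)) (\<lambda>n. Ide A (deg X n))"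
  unfolding heq_def by (auto intro!: cmap_Ide homotopic_eqI cmap_Comp)

lemma standard_distinguished:
  assumes f: "cmap X Y f"
  shows "(htpy_class A X Y f, htpy_class A Y (cone A X Y f) (\<lambda>n. ci2 X Y n),
     htpy_class A (cone A X Y f) (shift_complex A X) (\<lambda>n. cp1 X Y n)) \<in> distinguished_triangles A"
proof -
  let ?C = "cone A X Y f"
  let ?id = "\<lambda>X. htpy_class A X X (\<lambda>n. Ide A (deg X n))"
  note i = cmap_cone_in[OF f] and p = cmap_cone_out[OF f]
  have b: "bounded_complex A X" "bounded_complex A Y" "bounded_complex A ?C" using f cmap_simps(1,2)[OF f] by simp_all
  have id: "?id Z \<in> Hom (Kb A) Z Z \<and> iso_arr (Kb A) (?id Z)" if "bounded_complex A Z" for Z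
    using that cmap_Ide htpy_class_in_Hom iso_arr_Kb heq_Ide by blast
  have l: "htpy_comp A (?id Z') (htpy_class A Z Z' g) = htpy_class A Z Z' g"
    and r: "htpy_comp A (htpy_class A Z Z' g) (?id Z) = htpy_class A Z Z' g" if g: "cmap Z Z' g" for Z Z' g
    using Kb.Comp_Ide_left[OF htpy_class_in_Hom[OF g]] Kb.Comp_Ide_right[OF htpy_class_in_Hom[OF g]] by simp_all
  have s: "shift_htpy_arr A (?id X) = ?id (shift_complex A X)"
    using shift_htpy_class[OF cmap_Ide[OF b(1)]] by simp
  show ?thesis
    unfolding distinguished_triangles_def Hom_Kb_cat iso_arr_Kb_cat Kb_cat_simps
    apply (rule CollectI, rule case_prodI, rule case_prodI)
    apply (rule exI[of _ X], rule exI[of _ Y], rule exI[of _ ?C], intro conjI htpy_class_in_Hom f i p)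
    apply (rule bexI[of _ "(htpy_class A X Y f, htpy_class A Y ?C (\<lambda>n. ci2 X Y n), htpy_class A ?C (shift_complex A X) (\<lambda>n. cp1 X Y n))"])
     apply (rule case_prodI, rule case_prodI)
     apply (rule bexI[of _ "?id X"], rule bexI[of _ "?id Y"], rule bexI[of _ "?id ?C"])
        apply (simp only: l[OF f] r[OF f] l[OF i] r[OF i] s l[OF p] r[OF p])
    using id b f by (auto simp: standard_triangles_eq simp del: deg_cone)
qed

end

locale triangulated_subcategory = additive_category A
  for A :: "('o, 'm, 'z) additive_cat_scheme" (structure) +
  fixes D :: "('o, 'm) cochain set"
  assumes strict: "strict_triangulated_subcat (Kb A) D"
begin

lemma D_bounded: "X \<in> D \<Longrightarrow> bounded_complex A X"
  using strict by (auto simp: strict_triangulated_subcat_def)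

lemma D_iso: "X \<in> D \<Longrightarrow> isomorphic (Kb A) X Y \<Longrightarrow> Y \<in> D"
proof -
  assume X: "X \<in> D" and XY: "isomorphic (Kb A) X Y"
  then have "bounded_complex A Y" using cmap_simps(2) unfolding isomorphic_Kb heq_def by blast
  then show ?thesis using strict X XY unfolding strict_triangulated_subcat_def Kb_simps(1) by blast
qed

lemma D_iso': "X \<in> D \<Longrightarrow> isomorphic (Kb A) Y X \<Longrightarrow> Y \<in> D"
  using D_iso unfolding isomorphic_Kb heq_def by blast

lemma D_shift: "bounded_complex A X \<Longrightarrow> shift_complex A X \<in> D \<longleftrightarrow> X \<in> D"
  using strict by (auto simp: strict_triangulated_subcat_def)

lemma D_unshift: "X \<in> D \<Longrightarrow> unshift_complex X \<in> D"
  using D_shift[of "unshift_complex X"] D_bounded[of X] by simp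

lemma D_cone:
  assumes "cmap X Y f" "X \<in> D" "Y \<in> D"
  shows "cone A X Y f \<in> D"
proof -
  have "\<forall>(f, g, h) \<in> distinguished_triangles A. Dom (Kb A) f \<in> D \<longrightarrow> Cod (Kb A) f \<in> D \<longrightarrow> Cod (Kb A) g \<in> D"
    using strict by (simp add: strict_triangulated_subcat_def)
  from bspec[OF this standard_distinguished[OF assms(1)]] show ?thesis using assms by simp
qed

text \<open>\<open>D\<close> has some zero object, all zero objects are isomorphic, and
  \<open>D\<close> is strict.\<close>

lemma D_zero:
  assumes X: "is_zero_obj (Kb A) X"
  shows "X \<in> D"
proof -
  obtain Z where Z: "Z \<in> D" "is_zero_obj (Kb A) Z"
    using strict by (auto simp: strict_triangulated_subcat_def)
  have b: "bounded_complex A X" "bounded_complex A Z" using X Z(2) by (simp_all add: is_zero_obj_def)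
  have "isomorphic (Kb A) Z X"
    by (rule isomorphicI[OF cmap_Zero[OF b(2,1)] cmap_Zero[OF b]])
      (use homotopic_sym[OF cmap_Ide cmap_Zero zero_is_contractible[OF X]]
         homotopic_sym[OF cmap_Ide cmap_Zero zero_is_contractible[OF Z(2)]] b in simp_all)
  then show ?thesis using Z D_iso by blast
qed

text \<open>The cone \<open>?U\<close> of the composite is the middle of a triangle, whereas closure
  of \<open>D\<close> concerns third objects. The octahedron puts the cone of \<open>w\<close> in
  \<open>D\<close>; rotating then turns the shift of \<open>?U\<close> into a third object.\<close>

lemma cone_Comp_in_D:
  assumes s: "cmap X Y s" and t: "cmap Y Z t" and "cone A X Y s \<in> D" "cone A Y Z t \<in> D"
  shows "cone A X Z (\<lambda>n. t n \<cdot> s n) \<in> D"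
proof -
  let ?U = "cone A X Z (\<lambda>n. t n \<cdot> s n)"
  obtain w where w: "cmap (cone A X Y s) ?U w" "isomorphic (Kb A) (cone A (cone A X Y s) ?U w) (cone A Y Z t)"
    using cone_Comp_octahedron[OF s t] by blast
  have "cone A (cone A X Y s) ?U w \<in> D" using D_iso' w assms by blast
  then have "cone A (cone A (cone A X Y s) ?U w) (shift_complex A (cone A X Y s)) (\<lambda>n. cp1 (cone A X Y s) ?U n) \<in> D"
    using D_cone cmap_cone_out[OF w(1)] D_shift assms(3) D_bounded by blast
  then have "shift_complex A ?U \<in> D" using D_iso cone_rotate[OF w(1)] by blast
  then show ?thesis using D_shift cmap_simps(2)[OF w(1)] by blast
qed

text \<open>\<open>U\<close> is the fibre of \<open>k\<close>.\<close>

lemma annihilate: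
  assumes k: "cmap W C k" and C: "C \<in> D"
  shows "\<exists>U t. cmap U W t \<and> cone A U W t \<in> D \<and>
    homotopic A U C (\<lambda>n. k n \<cdot> t n) (\<lambda>n. Zero A (deg U n) (deg C n)) \<and>
    (\<forall>n. is_zero_obj A (deg W n) \<longrightarrow> is_zero_obj A (deg C (n - 1)) \<longrightarrow> is_zero_obj A (deg U n))"
proof -
  \<comment> \<open>The cone of the unshifted map has the summands \<open>deg W n\<close> and
    \<open>deg C (n - 1)\<close> in degree \<open>n\<close>. This yields the clause on zero objects,
    by which \<open>refine_roof\<close> later controls degrees.\<close>
  let ?W = "unshift_complex W" and ?C = "unshift_complex C" and ?k = "\<lambda>n. k (n - 1)"
  note b [simp] = cmap_simps(1,2)[OF k]
  have k': "cmap ?W ?C ?k" using cmap_unshift[OF k] .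
  have "cmap (cone A ?W ?C ?k) W (\<lambda>n. cp1 ?W ?C n)"
    using cmap_cone_out[OF k'] by simp
  moreover have "cone A (cone A ?W ?C ?k) W (\<lambda>n. cp1 ?W ?C n) \<in> D"
    using cone_rotate[OF k'] D_iso'[OF C] by simp
  moreover have "homotopic A (cone A ?W ?C ?k) C (\<lambda>n. k n \<cdot> cp1 ?W ?C n) (\<lambda>n. Zero A (deg (cone A ?W ?C ?k) n) (deg C n))"
    using cone_out_null[OF k'] by simp
  moreover have "is_zero_obj A (deg (cone A ?W ?C ?k) n)" if "is_zero_obj A (deg W n)" "is_zero_obj A (deg C (n - 1))" for n
    using biproduct_zero[OF cone_biprod, of ?W ?C n] that by simp
  ultimately show ?thesis by blast
qed

text \<open>The obstruction to lifting \<open>f\<close> along \<open>t\<close> is the composite of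
  \<open>f\<close> with the inclusion into the cone of \<open>t\<close>. That cone is in
  \<open>D\<close>, so the obstruction can be annihilated.\<close>

lemma ore_square:
  assumes t: "cmap V Y t" "cone A V Y t \<in> D" and f: "cmap W Y f"
  shows "\<exists>U t' f'. cmap U W t' \<and> cone A U W t' \<in> D \<and> cmap U V f' \<and>
    homotopic A U Y (\<lambda>n. f n \<cdot> t' n) (\<lambda>n. t n \<cdot> f' n)"
proof -
  note [simp] = cmap_simps[OF t(1)] cmap_simps[OF f]
  obtain U t' where t': "cmap U W t'" "cone A U W t' \<in> D" and
    0: "homotopic A U (cone A V Y t) (\<lambda>n. (ci2 V Y n \<cdot> f n) \<cdot> t' n) (\<lambda>n. Zero A (deg U n) (deg (cone A V Y t) n))"
    using annihilate[OF cmap_Comp[OF f cmap_cone_in[OF t(1)]] t(2)] by blast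
  note [simp] = cmap_simps[OF t'(1)]
  obtain f' where f': "cmap U V f'" "homotopic A U Y (\<lambda>n. t n \<cdot> f' n) (\<lambda>n. f n \<cdot> t' n)"
    using lift_of_cone_null[OF t(1) cmap_Comp[OF t'(1) f]] 0 by auto
  show ?thesis
    using t' f' homotopic_sym[OF cmap_Comp[OF f'(1) t(1)] cmap_Comp[OF t'(1) f]] by blast
qed

text \<open>The difference \<open>f - g\<close> lifts to the fibre of \<open>s\<close>, an object of
  \<open>D\<close>, and annihilating the lift annihilates the difference.\<close>

lemma cancel_left:
  assumes s: "cmap X Y s" "cone A X Y s \<in> D" and f: "cmap W X f" and g: "cmap W X g"
    and sfg: "homotopic A W Y (\<lambda>n. s n \<cdot> f n) (\<lambda>n. s n \<cdot> g n)"
  shows "\<exists>U t. cmap U W t \<and> cone A U W t \<in> D \<and> homotopic A U X (\<lambda>n. f n \<cdot> t n) (\<lambda>n. g n \<cdot> t n)"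
proof -
  let ?C = "unshift_complex (cone A X Y s)"
  note [simp] = cmap_simps[OF s(1)] cmap_simps[OF f] cmap_simps[OF g] s(1)
  obtain k where k: "cmap W ?C k" and pk: "\<And>n. cp1 X Y (n - 1) \<cdot> k n = f n \<boxplus> neg A (g n)"
    using cmap_to_unshift_cone[OF s(1) f g sfg] by blast
  obtain U t where t: "cmap U W t" "cone A U W t \<in> D" and
    0: "homotopic A U ?C (\<lambda>n. k n \<cdot> t n) (\<lambda>n. Zero A (deg U n) (deg ?C n))"
    using annihilate[OF k D_unshift[OF s(2)]] by blast
  note [simp] = cmap_simps[OF t(1)] cmap_simps(3-5)[OF k]
  have p: "cmap ?C X (\<lambda>n. cp1 X Y (n - 1))"
    using cmap_unshift[OF cmap_cone_out[OF s(1)]] by simp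
  have [simp]: "cp1 X Y (n - 1) \<in> Arr A" "Dom A (cp1 X Y (n - 1)) = bsum (cone_biprod A X Y (n - 1))"
    "Cod A (cp1 X Y (n - 1)) = deg X n" for n using cmap_simps(3-5)[OF p, of n] by simp_all
  have "cp1 X Y (n - 1) \<cdot> (k n \<cdot> t n) = (f n \<cdot> t n) \<boxplus> neg A (g n \<cdot> t n)" for n
    using pk[of n] by (simp flip: Comp_assoc')
  then have 1: "homotopic A U X (\<lambda>n. (f n \<cdot> t n) \<boxplus> neg A (g n \<cdot> t n)) (\<lambda>n. Zero A (deg U n) (deg X n))"
    using homotopic_Comp_left[OF cmap_Comp[OF t(1) k] cmap_Zero p 0] by simp
  note ft = cmap_Comp[OF t(1) f] and gt = cmap_Comp[OF t(1) g]
  \<comment> \<open>Adding \<open>g t\<close> to both sides turns the vanishing of the difference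
    into the desired homotopy.\<close>
  have "homotopic A U X (\<lambda>n. ((f n \<cdot> t n) \<boxplus> neg A (g n \<cdot> t n)) \<boxplus> (g n \<cdot> t n)) (\<lambda>n. Zero A (deg U n) (deg X n) \<boxplus> (g n \<cdot> t n))"
    by (rule homotopic_Add[OF cmap_Add[OF ft cmap_neg[OF gt]] cmap_Zero gt gt 1 homotopic_refl[OF gt]]) simp_all
  moreover have "((f n \<cdot> t n) \<boxplus> neg A (g n \<cdot> t n)) \<boxplus> (g n \<cdot> t n) = f n \<cdot> t n" for n
    by (rule lin_eqI, ((rule lin_intros HomI) | simp)+)
  ultimately show ?thesis using t by auto
qed

text \<open>A distinguished triangle is only isomorphic to a standard one. Its first arrow is then
  homotopic to \<open>k\<close> conjugated by homotopy equivalences, and all three factors have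
  their cones in \<open>D\<close>; so a representative with standard cone in \<open>D\<close> can be
  chosen.\<close>

lemma cone_in_Kb: "\<phi> \<in> cone_in (Kb A) D \<longleftrightarrow> (\<exists>X Y f. cmap X Y f \<and> \<phi> = htpy_class A X Y f \<and> cone A X Y f \<in> D)"
proof
  assume "\<exists>X Y f. cmap X Y f \<and> \<phi> = htpy_class A X Y f \<and> cone A X Y f \<in> D"
  then obtain X Y f where f: "cmap X Y f" "\<phi> = htpy_class A X Y f" "cone A X Y f \<in> D" by blast
  show "\<phi> \<in> cone_in (Kb A) D"
    unfolding cone_in_def using htpy_class_in_Arr[OF f(1)] standard_distinguished[OF f(1)] f(2,3) by fastforce
next
  assume "\<phi> \<in> cone_in (Kb A) D"
  then obtain g h where gh: "(\<phi>, g, h) \<in> distinguished_triangles A" "Cod (Kb A) g \<in> D"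
    unfolding cone_in_def by auto
  obtain X Y Z X' Y' f k \<alpha> \<alpha>' \<beta> \<beta>' where f: "cmap X Y f" "\<phi> = htpy_class A X Y f" and g: "g \<in> Hom (Kb A) Y Z"
    and k: "cmap X' Y' k" "isomorphic (Kb A) Z (cone A X' Y' k)"
    and \<alpha>': "heq X X' \<alpha> \<alpha>'" and \<beta>': "heq Y Y' \<beta> \<beta>'" and 1: "homotopic A X Y' (\<lambda>n. \<beta> n \<cdot> f n) (\<lambda>n. k n \<cdot> \<alpha> n)"
    using gh(1) by (rule distinguishedE)
  have "Z \<in> D" using gh(2) g by (simp add: Hom_def)
  then have kD: "cone A X' Y' k \<in> D" using D_iso k(2) by blast
  have \<alpha>: "cmap X X' \<alpha>" and \<beta>: "cmap Y Y' \<beta>" using \<alpha>' \<beta>' by (simp_all add: heq_def)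
  have \<beta>'': "heq Y' Y \<beta>' \<beta>" using \<beta>' by (simp add: heq_def)
  then have b': "cmap Y' Y \<beta>'" by (simp add: heq_def)
  note [simp] = cmap_simps[OF f(1)] cmap_simps[OF \<alpha>] cmap_simps[OF \<beta>] cmap_simps[OF k(1)] cmap_simps[OF b']
  let ?f = "\<lambda>n. \<beta>' n \<cdot> (k n \<cdot> \<alpha> n)"
  note k\<alpha> = cmap_Comp[OF \<alpha> k(1)]
  have f': "cmap X Y ?f" using cmap_Comp[OF k\<alpha> b'] .
  have 2: "homotopic A X Y (\<lambda>n. \<beta>' n \<cdot> (\<beta> n \<cdot> f n)) ?f"
    using homotopic_Comp_left[OF cmap_Comp[OF f(1) \<beta>] k\<alpha> b' 1] .
  have 3: "homotopic A X Y (\<lambda>n. \<beta>' n \<cdot> (\<beta> n \<cdot> f n)) f"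
    using homotopic_Comp_right[OF cmap_Comp[OF \<beta> b'] cmap_Ide f(1)] \<beta>' by (simp add: heq_def)
  have bf: "cmap X Y (\<lambda>n. \<beta>' n \<cdot> (\<beta> n \<cdot> f n))" using cmap_Comp[OF cmap_Comp[OF f(1) \<beta>] b'] .
  have "\<phi> = htpy_class A X Y ?f"
    using f(2) htpy_class_eq_iff[OF f(1) f'] homotopic_trans[OF f(1) bf f' homotopic_sym[OF bf f(1) 3] 2] by simp
  moreover have "cone A X Y ?f \<in> D"
    using cone_Comp_in_D[OF k\<alpha> b' cone_Comp_in_D[OF \<alpha> k(1) D_zero[OF cone_of_heq[OF \<alpha>']] kD] D_zero[OF cone_of_heq[OF \<beta>'']]] .
  ultimately show "\<exists>X Y f. cmap X Y f \<and> \<phi> = htpy_class A X Y f \<and> cone A X Y f \<in> D" using f' by blast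
qed

end

section \<open>Calculus of fractions\<close>

text \<open>The axioms for roofs whose inverted leg points to the source, kept apart from complexes
  so that well-definedness is argued with arrows alone.\<close>

locale fraction_calculus = category T
  for T :: "('o, 'm, 'z) tri_cat_scheme" (structure) +
  fixes D :: "'o set"
  assumes Ide_cone_in: "X \<in> Obj T \<Longrightarrow> Ide T X \<in> cone_in T D"
    and Comp_cone_in: "s \<in> cone_in T D \<Longrightarrow> t \<in> cone_in T D \<Longrightarrow> Dom T t = Cod T s \<Longrightarrow> t \<cdot> s \<in> cone_in T D"
    and ore: "f \<in> Hom T W Y \<Longrightarrow> t \<in> Hom T V Y \<Longrightarrow> t \<in> cone_in T D \<Longrightarrow>
      \<exists>U. \<exists>t' \<in> Hom T U W. \<exists>f' \<in> Hom T U V. t' \<in> cone_in T D \<and> f \<cdot> t' = t \<cdot> f'"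
    and cancel: "s \<in> cone_in T D \<Longrightarrow> s \<in> Hom T X Y \<Longrightarrow> f \<in> Hom T W X \<Longrightarrow> g \<in> Hom T W X \<Longrightarrow> s \<cdot> f = s \<cdot> g \<Longrightarrow>
      \<exists>U. \<exists>t \<in> Hom T U W. t \<in> cone_in T D \<and> f \<cdot> t = g \<cdot> t"
begin

lemma cone_in_Arr: "s \<in> cone_in T D \<Longrightarrow> s \<in> Arr T"
  by (simp add: cone_in_def)

lemma roofs_iff:
  "(s, f) \<in> roofs T D X Y \<longleftrightarrow> (\<exists>W. s \<in> cone_in T D \<and> s \<in> Hom T W X \<and> f \<in> Hom T W Y)"
  using cone_in_Arr by (auto simp: roofs_def Hom_def)

lemma roofsI: "s \<in> cone_in T D \<Longrightarrow> s \<in> Hom T W X \<Longrightarrow> f \<in> Hom T W Y \<Longrightarrow> (s, f) \<in> roofs T D X Y"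
  using roofs_iff by blast

lemma roof_equivI:
  assumes "p \<in> Hom T W V" "p' \<in> Hom T W V'" "s \<in> Hom T V X" "s' \<in> Hom T V' X'"
    "s \<cdot> p = s' \<cdot> p'" "f \<cdot> p = f' \<cdot> p'" "s \<cdot> p \<in> cone_in T D"
  shows "roof_equiv T D (s, f) (s', f')"
  unfolding roof_equiv_def split_conv
  using assms HomD[OF assms(3)] HomD[OF assms(4)] by (intro exI[of _ W] bexI[of _ p] bexI[of _ p']) auto

lemma roof_equivE:
  assumes "roof_equiv T D (s, f) (s', f')" "s \<in> Hom T V X" "s' \<in> Hom T V' X'"
  obtains W p p' where "p \<in> Hom T W V" "p' \<in> Hom T W V'" "s \<cdot> p = s' \<cdot> p'" "f \<cdot> p = f' \<cdot> p'" "s \<cdot> p \<in> cone_in T D"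
  using assms(1) HomD(2)[OF assms(2)] HomD(2)[OF assms(3)] unfolding roof_equiv_def split_conv by blast

lemma roof_equiv_refl:
  assumes "(s, f) \<in> roofs T D X Y"
  shows "roof_equiv T D (s, f) (s, f)"
proof -
  obtain W where W: "s \<in> cone_in T D" "s \<in> Hom T W X" "f \<in> Hom T W Y" using assms roofs_iff by blast
  have i: "Ide T W \<in> Hom T W W" using W(2) Hom_Obj Ide_Hom by blast
  show ?thesis
    by (rule roof_equivI[OF i i W(2,2)]) (use W Comp_Ide_right[OF W(2)] in auto)
qed

lemma roof_equiv_sym: "roof_equiv T D r r' \<Longrightarrow> roof_equiv T D r' r"
  unfolding roof_equiv_def by (auto split: prod.splits) metis

lemma roof_equiv_trans:
  assumes r: "(s, f) \<in> roofs T D X Y" "(s', f') \<in> roofs T D X Y" "(s'', f'') \<in> roofs T D X Y"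
    and "roof_equiv T D (s, f) (s', f')" "roof_equiv T D (s', f') (s'', f'')"
  shows "roof_equiv T D (s, f) (s'', f'')"
proof -
  obtain W where W: "s \<in> cone_in T D" "s \<in> Hom T W X" "f \<in> Hom T W Y" using r roofs_iff by blast
  obtain W' where W': "s' \<in> cone_in T D" "s' \<in> Hom T W' X" "f' \<in> Hom T W' Y" using r roofs_iff by blast
  obtain W'' where W'': "s'' \<in> cone_in T D" "s'' \<in> Hom T W'' X" "f'' \<in> Hom T W'' Y" using r roofs_iff by blast
  obtain P p p' where p: "p \<in> Hom T P W" "p' \<in> Hom T P W'" "s \<cdot> p = s' \<cdot> p'" "f \<cdot> p = f' \<cdot> p'" "s \<cdot> p \<in> cone_in T D"
    using roof_equivE[OF assms(4) W(2) W'(2)] by blast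
  obtain Q q q' where q: "q \<in> Hom T Q W'" "q' \<in> Hom T Q W''" "s' \<cdot> q = s'' \<cdot> q'" "f' \<cdot> q = f'' \<cdot> q'" "s' \<cdot> q \<in> cone_in T D"
    using roof_equivE[OF assms(5) W'(2) W''(2)] by blast
  have sp: "s' \<cdot> p' \<in> Hom T P X" "s' \<cdot> q \<in> Hom T Q X" by (rule Comp_Hom[OF p(2) W'(2)], rule Comp_Hom[OF q(1) W'(2)])
  \<comment> \<open>It is \<open>s' \<cdot> q\<close>, not \<open>q\<close>, that is known to have
    its cone in \<open>D\<close>; so the Ore square is formed over \<open>X\<close> and not over
    \<open>W'\<close>.\<close>
  obtain U a b where a: "a \<in> Hom T U P" "b \<in> Hom T U Q" "a \<in> cone_in T D" "(s' \<cdot> p') \<cdot> a = (s' \<cdot> q) \<cdot> b"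
    using ore[OF sp q(5)] by blast
  have pa: "p' \<cdot> a \<in> Hom T U W'" "q \<cdot> b \<in> Hom T U W'" by (rule Comp_Hom[OF a(1) p(2)], rule Comp_Hom[OF a(2) q(1)])
  have "s' \<cdot> (p' \<cdot> a) = s' \<cdot> (q \<cdot> b)"
    using a(4) Comp_assoc[OF a(1) p(2) W'(2)] Comp_assoc[OF a(2) q(1) W'(2)] by simp
  \<comment> \<open>The square commutes only after \<open>s'\<close>, but the numerators must be
    compared on \<open>W'\<close>; cancelling \<open>s'\<close> provides this at the cost of
    \<open>t\<close>.\<close>
  then obtain V t where t: "t \<in> Hom T V U" "t \<in> cone_in T D" "(p' \<cdot> a) \<cdot> t = (q \<cdot> b) \<cdot> t"
    using cancel[OF W'(1,2) pa] by blast
  note [simp] = HomD[OF W(2)] HomD[OF W(3)] HomD[OF W'(2)] HomD[OF W'(3)] HomD[OF W''(2)] HomD[OF W''(3)]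
    HomD[OF p(1)] HomD[OF p(2)] HomD[OF q(1)] HomD[OF q(2)] HomD[OF a(1)] HomD[OF a(2)] HomD[OF t(1)]
  have at: "p' \<cdot> (a \<cdot> t) = q \<cdot> (b \<cdot> t)" using t(3) by simp
  have e: "s \<cdot> (p \<cdot> h) = s' \<cdot> (p' \<cdot> h)" "f \<cdot> (p \<cdot> h) = f' \<cdot> (p' \<cdot> h)" if "h \<in> Hom T V P" for h
    using p(3,4) that by (simp_all add: HomD[OF that] flip: Comp_assoc')
  have e': "s' \<cdot> (q \<cdot> h) = s'' \<cdot> (q' \<cdot> h)" "f' \<cdot> (q \<cdot> h) = f'' \<cdot> (q' \<cdot> h)" if "h \<in> Hom T V Q" for h
    using q(3,4) that by (simp_all add: HomD[OF that] flip: Comp_assoc')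
  have atH: "a \<cdot> t \<in> Hom T V P" "b \<cdot> t \<in> Hom T V Q" by (rule Comp_Hom[OF t(1) a(1)], rule Comp_Hom[OF t(1) a(2)])
  have "s \<cdot> (p \<cdot> (a \<cdot> t)) = (s \<cdot> p) \<cdot> (a \<cdot> t)" by simp
  also have "\<dots> \<in> cone_in T D"
    using Comp_cone_in[OF Comp_cone_in[OF t(2) a(3)] p(5)] by simp
  finally have c: "s \<cdot> (p \<cdot> (a \<cdot> t)) \<in> cone_in T D" .
  show ?thesis
  proof (rule roof_equivI[OF _ _ W(2) W''(2)])
    show "p \<cdot> (a \<cdot> t) \<in> Hom T V W" "q' \<cdot> (b \<cdot> t) \<in> Hom T V W''" by (rule Comp_Hom[OF atH(1) p(1)], rule Comp_Hom[OF atH(2) q(2)])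
    show "s \<cdot> (p \<cdot> (a \<cdot> t)) = s'' \<cdot> (q' \<cdot> (b \<cdot> t))" "f \<cdot> (p \<cdot> (a \<cdot> t)) = f'' \<cdot> (q' \<cdot> (b \<cdot> t))"
      using e[OF atH(1)] e'[OF atH(2)] at by simp_all
  qed (rule c)
qed

lemma roof_class_eq_iff:
  assumes "(s, f) \<in> roofs T D X Y" "(s', f') \<in> roofs T D X Y"
  shows "roof_class T D X Y (s, f) = roof_class T D X Y (s', f') \<longleftrightarrow> roof_equiv T D (s, f) (s', f')"
proof
  assume "roof_class T D X Y (s, f) = roof_class T D X Y (s', f')"
  then have "{r' \<in> roofs T D X Y. roof_equiv T D (s, f) r'} = {r' \<in> roofs T D X Y. roof_equiv T D (s', f') r'}"
    unfolding roof_class_def by blast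
  then show "roof_equiv T D (s, f) (s', f')" using assms roof_equiv_refl by blast
next
  assume "roof_equiv T D (s, f) (s', f')"
  then have "roof_equiv T D (s, f) (t, g) \<longleftrightarrow> roof_equiv T D (s', f') (t, g)" if "(t, g) \<in> roofs T D X Y" for t g
    using assms that roof_equiv_trans roof_equiv_sym by meson
  then show "roof_class T D X Y (s, f) = roof_class T D X Y (s', f')"
    unfolding roof_class_def by auto
qed

text \<open>Only one of the two squares needs a vertical arrow with cone in \<open>D\<close>; the common refinements
  used for well-definedness produce squares of the weaker kind.\<close>

lemma ore_squares_equiv:
  assumes s: "s \<in> Hom T W X" "s \<in> cone_in T D" and f: "f \<in> Hom T W Y" and t: "t \<in> Hom T V Y" "t \<in> cone_in T D"
    and g: "g \<in> Hom T V Z"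
    and sq: "t' \<in> Hom T U W" "t' \<in> cone_in T D" "f' \<in> Hom T U V" "f \<cdot> t' = t \<cdot> f'"
    and sq': "c \<in> Hom T U' W" "e \<in> Hom T U' V" "f \<cdot> c = t \<cdot> e" "s \<cdot> c \<in> cone_in T D"
  shows "roof_equiv T D (s \<cdot> t', g \<cdot> f') (s \<cdot> c, g \<cdot> e)"
proof -
  obtain Q x y where xy: "x \<in> Hom T Q U'" "y \<in> Hom T Q U" "x \<in> cone_in T D" "c \<cdot> x = t' \<cdot> y"
    using ore[OF sq'(1) sq(1,2)] by blast
  note [simp] = HomD[OF s(1)] HomD[OF f] HomD[OF t(1)] HomD[OF g] HomD[OF sq(1)] HomD[OF sq(3)] HomD[OF sq'(1)]
    HomD[OF sq'(2)] HomD[OF xy(1)] HomD[OF xy(2)]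
  have "t \<cdot> (f' \<cdot> y) = (t \<cdot> f') \<cdot> y" by simp
  also have "\<dots> = f \<cdot> (t' \<cdot> y)" by (simp flip: sq(4))
  also have "\<dots> = (f \<cdot> c) \<cdot> x" by (simp flip: xy(4))
  also have "\<dots> = t \<cdot> (e \<cdot> x)" by (simp add: sq'(3))
  finally have "t \<cdot> (f' \<cdot> y) = t \<cdot> (e \<cdot> x)" .
  \<comment> \<open>The two arrows to \<open>V\<close> have been compared only after
    \<open>t\<close>; one further refinement cancels \<open>t\<close>.\<close>
  then obtain R z where z: "z \<in> Hom T R Q" "z \<in> cone_in T D" "(f' \<cdot> y) \<cdot> z = (e \<cdot> x) \<cdot> z"
    using cancel[OF t(2,1) Comp_Hom[OF xy(2) sq(3)] Comp_Hom[OF xy(1) sq'(2)]] by blast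
  note [simp] = HomD[OF z(1)]
  show ?thesis
  proof (rule roof_equivI[OF Comp_Hom[OF z(1) xy(2)] Comp_Hom[OF z(1) xy(1)] Comp_Hom[OF sq(1) s(1)] Comp_Hom[OF sq'(1) s(1)]])
    have "t' \<cdot> (y \<cdot> z) = (t' \<cdot> y) \<cdot> z" by simp
    also have "\<dots> = c \<cdot> (x \<cdot> z)" by (simp flip: xy(4))
    finally have *: "t' \<cdot> (y \<cdot> z) = c \<cdot> (x \<cdot> z)" .
    show "(s \<cdot> t') \<cdot> (y \<cdot> z) = (s \<cdot> c) \<cdot> (x \<cdot> z)" using * by simp
    then show "(s \<cdot> t') \<cdot> (y \<cdot> z) \<in> cone_in T D"
      using Comp_cone_in[OF Comp_cone_in[OF z(2) xy(3)] sq'(4)] by simp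
    show "(g \<cdot> f') \<cdot> (y \<cdot> z) = (g \<cdot> e) \<cdot> (x \<cdot> z)" using z(3) by simp
  qed
qed

section \<open>The Verdier quotient is a category\<close>

lemma Arr_verdier: "Arr (verdier_quotient T D) = {roof_class T D X Y r | X Y r. X \<in> Obj T \<and> Y \<in> Obj T \<and> r \<in> roofs T D X Y}"
  by (simp add: verdier_quotient_def)

lemma verdier_simps [simp]: "Obj (verdier_quotient T D) = Obj T" "Comp (verdier_quotient T D) = fraction_comp T D"
    "Dom (verdier_quotient T D) (roof_class T D X Y r) = X" "Cod (verdier_quotient T D) (roof_class T D X Y r) = Y"
    "Ide (verdier_quotient T D) = (\<lambda>X. roof_class T D X X (Ide T X, Ide T X))"
  by (simp_all add: verdier_quotient_def roof_class_def)

lemma Hom_verdier: "\<phi> \<in> Hom (verdier_quotient T D) X Y \<longleftrightarrow>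
    (\<exists>s f W. s \<in> cone_in T D \<and> s \<in> Hom T W X \<and> f \<in> Hom T W Y \<and> \<phi> = roof_class T D X Y (s, f))"
proof
  assume "\<phi> \<in> Hom (verdier_quotient T D) X Y"
  then obtain s f where "(s, f) \<in> roofs T D X Y" "\<phi> = roof_class T D X Y (s, f)"
    by (auto simp: Hom_def[of "verdier_quotient T D"] Arr_verdier)
  then show "\<exists>s f W. s \<in> cone_in T D \<and> s \<in> Hom T W X \<and> f \<in> Hom T W Y \<and> \<phi> = roof_class T D X Y (s, f)"
    using roofs_iff by blast
next
  assume "\<exists>s f W. s \<in> cone_in T D \<and> s \<in> Hom T W X \<and> f \<in> Hom T W Y \<and> \<phi> = roof_class T D X Y (s, f)"
  then obtain s f where sf: "(s, f) \<in> roofs T D X Y" "\<phi> = roof_class T D X Y (s, f)" and "X \<in> Obj T" "Y \<in> Obj T"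
    using roofs_iff Hom_Obj by metis
  then have "\<phi> \<in> Arr (verdier_quotient T D)" unfolding Arr_verdier by blast
  then show "\<phi> \<in> Hom (verdier_quotient T D) X Y" by (simp add: Hom_def sf)
qed

lemma roof_class_in_Hom:
  "s \<in> cone_in T D \<Longrightarrow> s \<in> Hom T W X \<Longrightarrow> f \<in> Hom T W Y \<Longrightarrow> roof_class T D X Y (s, f) \<in> Hom (verdier_quotient T D) X Y"
  using Hom_verdier by blast

text \<open>The composite is defined from all representatives and all squares. Any such choice is
  compared with the given one through a single square over common refinements.\<close>

lemma fraction_comp_class:
  assumes s: "s \<in> Hom T W X" "s \<in> cone_in T D" and f: "f \<in> Hom T W Y" and t: "t \<in> Hom T V Y" "t \<in> cone_in T D"
    and g: "g \<in> Hom T V Z"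
    and sq: "t' \<in> Hom T U W" "t' \<in> cone_in T D" "f' \<in> Hom T U V" "f \<cdot> t' = t \<cdot> f'"
  shows "fraction_comp T D (roof_class T D Y Z (t, g)) (roof_class T D X Y (s, f)) = roof_class T D X Z (s \<cdot> t', g \<cdot> f')"
proof -
  have st: "s \<cdot> t' \<in> cone_in T D" using Comp_cone_in s sq by (simp add: HomD)
  have st': "(s \<cdot> t', g \<cdot> f') \<in> roofs T D X Z"
    using roofsI[OF st Comp_Hom[OF sq(1) s(1)] Comp_Hom[OF sq(3) g]] .
  have wd: "roof_equiv T D (s1 \<cdot> t1', g1 \<cdot> f1') (s \<cdot> t', g \<cdot> f') \<and> (s1 \<cdot> t1', g1 \<cdot> f1') \<in> roofs T D X Z"
    if 1: "(s1, f1) \<in> roofs T D X Y" "roof_equiv T D (s, f) (s1, f1)" and 2: "(t1, g1) \<in> roofs T D Y Z" "roof_equiv T D (t, g) (t1, g1)"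
      and sq1: "t1' \<in> Hom T U1 (Dom T s1)" "t1' \<in> cone_in T D" "f1' \<in> Hom T U1 (Dom T t1)" "f1 \<cdot> t1' = t1 \<cdot> f1'"
    for s1 f1 t1 g1 U1 t1' f1'
  proof -
    obtain W1 where s1: "s1 \<in> cone_in T D" "s1 \<in> Hom T W1 X" and f1: "f1 \<in> Hom T W1 Y" using 1 roofs_iff by blast
    obtain V1 where t1: "t1 \<in> cone_in T D" "t1 \<in> Hom T V1 Y" and g1: "g1 \<in> Hom T V1 Z" using 2 roofs_iff by blast
    have t1': "t1' \<in> Hom T U1 W1" "f1' \<in> Hom T U1 V1" using sq1 HomD(2)[OF s1(2)] HomD(2)[OF t1(2)] by simp_all
    obtain P p p1 where p: "p \<in> Hom T P W" "p1 \<in> Hom T P W1" "s \<cdot> p = s1 \<cdot> p1" "f \<cdot> p = f1 \<cdot> p1" "s \<cdot> p \<in> cone_in T D"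
      using roof_equivE[OF 1(2) s(1) s1(2)] by blast
    obtain Q q q1 where q: "q \<in> Hom T Q V" "q1 \<in> Hom T Q V1" "t \<cdot> q = t1 \<cdot> q1" "g \<cdot> q = g1 \<cdot> q1" "t \<cdot> q \<in> cone_in T D"
      using roof_equivE[OF 2(2) t(1) t1(2)] by blast
    \<comment> \<open>One square joins the refinement \<open>P\<close> of the first factor to the
      refinement \<open>Q\<close> of the second. Read through \<open>p\<close>, \<open>q\<close> or
      through \<open>p1\<close>, \<open>q1\<close>, it completes either pair of
      representatives.\<close>
    obtain R a b where a: "a \<in> Hom T R P" "b \<in> Hom T R Q" "a \<in> cone_in T D" "(f \<cdot> p) \<cdot> a = (t \<cdot> q) \<cdot> b"
      using ore[OF Comp_Hom[OF p(1) f] Comp_Hom[OF q(1) t(1)] q(5)] by blast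
    note [simp] = HomD[OF s(1)] HomD[OF f] HomD[OF t(1)] HomD[OF g] HomD[OF s1(2)] HomD[OF f1] HomD[OF t1(2)] HomD[OF g1]
      HomD[OF p(1)] HomD[OF p(2)] HomD[OF q(1)] HomD[OF q(2)] HomD[OF a(1)] HomD[OF a(2)] HomD[OF t1'(1)] HomD[OF t1'(2)]
      HomD[OF sq(1)] HomD[OF sq(3)]
    have e: "s1 \<cdot> (p1 \<cdot> a) = s \<cdot> (p \<cdot> a)" "f1 \<cdot> (p1 \<cdot> a) = f \<cdot> (p \<cdot> a)" "t1 \<cdot> (q1 \<cdot> b) = t \<cdot> (q \<cdot> b)" "g1 \<cdot> (q1 \<cdot> b) = g \<cdot> (q \<cdot> b)"
      using p(3,4) q(3,4) by (simp_all flip: Comp_assoc')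
    have c: "s \<cdot> (p \<cdot> a) \<in> cone_in T D" using Comp_cone_in[OF a(3) p(5)] by simp
    have sqe: "f \<cdot> (p \<cdot> a) = t \<cdot> (q \<cdot> b)" using a(4) by simp
    have "roof_equiv T D (s \<cdot> t', g \<cdot> f') (s \<cdot> (p \<cdot> a), g \<cdot> (q \<cdot> b))"
      by (rule ore_squares_equiv[OF s f t g sq Comp_Hom[OF a(1) p(1)] Comp_Hom[OF a(2) q(1)] sqe c])
    moreover have "roof_equiv T D (s1 \<cdot> t1', g1 \<cdot> f1') (s \<cdot> (p \<cdot> a), g \<cdot> (q \<cdot> b))"
      using ore_squares_equiv[OF s1(2,1) f1 t1(2,1) g1 t1'(1) sq1(2) t1'(2) sq1(4) Comp_Hom[OF a(1) p(2)] Comp_Hom[OF a(2) q(2)]]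
        e c sqe by simp
    moreover have r: "(s \<cdot> (p \<cdot> a), g \<cdot> (q \<cdot> b)) \<in> roofs T D X Z"
      using roofsI[OF c] Comp_Hom[OF Comp_Hom[OF a(1) p(1)] s(1)] Comp_Hom[OF Comp_Hom[OF a(2) q(1)] g] by blast
    moreover have st1: "(s1 \<cdot> t1', g1 \<cdot> f1') \<in> roofs T D X Z"
      using roofsI[OF Comp_cone_in[OF sq1(2) s1(1)] Comp_Hom[OF t1'(1) s1(2)] Comp_Hom[OF t1'(2) g1]] by simp
    ultimately show ?thesis
      using roof_equiv_trans[OF st1 r st'] roof_equiv_sym by blast
  qed
  have sf: "(s, f) \<in> roofs T D X Y" "(t, g) \<in> roofs T D Y Z" using roofsI s f t g by auto
  have "{r \<in> roofs T D X Z. \<exists>(s, f) \<in> {r' \<in> roofs T D X Y. roof_equiv T D (s, f) r'}.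
        \<exists>(t, g) \<in> {r' \<in> roofs T D Y Z. roof_equiv T D (t, g) r'}. \<exists>U.
        \<exists>t' \<in> Hom T U (Dom T s) \<inter> cone_in T D. \<exists>f' \<in> Hom T U (Dom T t).
          f \<cdot> t' = t \<cdot> f' \<and> roof_equiv T D (s \<cdot> t', g \<cdot> f') r} = {r \<in> roofs T D X Z. roof_equiv T D (s \<cdot> t', g \<cdot> f') r}"
    (is "?L = ?R")
  proof
    show "?L \<subseteq> ?R"
    proof (clarsimp, rename_tac s2 f2 s1 f1 t1 g1 U1 t1' f1')
      fix s2 f2 s1 f1 t1 g1 U1 t1' f1'
      assume *: "(s2, f2) \<in> roofs T D X Z" "(s1, f1) \<in> roofs T D X Y" "roof_equiv T D (s, f) (s1, f1)"
        "(t1, g1) \<in> roofs T D Y Z" "roof_equiv T D (t, g) (t1, g1)" 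
        "f1' \<in> Hom T U1 (Dom T t1)" "f1 \<cdot> t1' = t1 \<cdot> f1'" "roof_equiv T D (s1 \<cdot> t1', g1 \<cdot> f1') (s2, f2)"
        "t1' \<in> Hom T U1 (Dom T s1)" "t1' \<in> cone_in T D"
      show "roof_equiv T D (s \<cdot> t', g \<cdot> f') (s2, f2)"
        using wd[OF *(2-5) *(9,10) *(6,7)] roof_equiv_trans[OF st' _ *(1)] roof_equiv_sym *(8) by blast
    qed
    show "?R \<subseteq> ?L"
      using sf roof_equiv_refl sq HomD(2)[OF s(1)] HomD(2)[OF t(1)] by fast
  qed
  then show ?thesis by (simp only: fraction_comp_def roof_class_def split_conv)
qed

lemma category_verdier: "category (verdier_quotient T D)"
proof
  fix \<phi> assume "\<phi> \<in> Arr (verdier_quotient T D)"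
  then show "Dom (verdier_quotient T D) \<phi> \<in> Obj (verdier_quotient T D)" "Cod (verdier_quotient T D) \<phi> \<in> Obj (verdier_quotient T D)"
    by (auto simp: Arr_verdier)
next
  fix X assume "X \<in> Obj (verdier_quotient T D)"
  then have X: "X \<in> Obj T" by simp
  show "Ide (verdier_quotient T D) X \<in> Hom (verdier_quotient T D) X X"
    using roof_class_in_Hom[OF Ide_cone_in[OF X] Ide_Hom[OF X] Ide_Hom[OF X]] by simp
next
  fix \<phi> X Y \<psi> Z assume "\<phi> \<in> Hom (verdier_quotient T D) X Y" "\<psi> \<in> Hom (verdier_quotient T D) Y Z"
  then obtain s f W t g V where s: "s \<in> cone_in T D" "s \<in> Hom T W X" and f: "f \<in> Hom T W Y" and \<phi>: "\<phi> = roof_class T D X Y (s, f)"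
    and t: "t \<in> cone_in T D" "t \<in> Hom T V Y" and g: "g \<in> Hom T V Z" and \<psi>: "\<psi> = roof_class T D Y Z (t, g)"
    unfolding Hom_verdier by blast
  obtain U t' f' where sq: "t' \<in> Hom T U W" "f' \<in> Hom T U V" "t' \<in> cone_in T D" "f \<cdot> t' = t \<cdot> f'"
    using ore[OF f t(2,1)] by blast
  have st: "s \<cdot> t' \<in> cone_in T D" using Comp_cone_in s sq by (simp add: HomD)
  have "fraction_comp T D \<psi> \<phi> = roof_class T D X Z (s \<cdot> t', g \<cdot> f')"
    unfolding \<phi> \<psi> by (rule fraction_comp_class[OF s(2,1) f t(2,1) g sq(1,3,2,4)])
  then show "Comp (verdier_quotient T D) \<psi> \<phi> \<in> Hom (verdier_quotient T D) X Z"
    using roof_class_in_Hom[OF st Comp_Hom[OF sq(1) s(2)] Comp_Hom[OF sq(2) g]] by simp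
next
  fix \<phi> X Y assume "\<phi> \<in> Hom (verdier_quotient T D) X Y"
  then obtain s f W where s: "s \<in> cone_in T D" "s \<in> Hom T W X" and f: "f \<in> Hom T W Y" and \<phi>: "\<phi> = roof_class T D X Y (s, f)"
    unfolding Hom_verdier by blast
  have XY: "X \<in> Obj T" "Y \<in> Obj T" "W \<in> Obj T" using Hom_Obj s f by auto
  note i = Ide_Hom[OF XY(1)] Ide_Hom[OF XY(2)] Ide_Hom[OF XY(3)]
  note c = Ide_cone_in[OF XY(1)] Ide_cone_in[OF XY(2)] Ide_cone_in[OF XY(3)]
  show "Comp (verdier_quotient T D) (Ide (verdier_quotient T D) Y) \<phi> = \<phi>"
    using fraction_comp_class[OF s(2,1) f i(2) c(2) i(2) i(3) c(3) f] s f XY by (simp add: HomD[OF s(2)] HomD[OF f] \<phi>)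
  show "Comp (verdier_quotient T D) \<phi> (Ide (verdier_quotient T D) X) = \<phi>"
    using fraction_comp_class[OF i(1) c(1) i(1) s(2,1) f s(2,1) i(3)] s f XY by (simp add: HomD[OF s(2)] HomD[OF f] \<phi>)
next
  fix \<phi> W X \<psi> Y \<chi> Z
  assume "\<phi> \<in> Hom (verdier_quotient T D) W X" "\<psi> \<in> Hom (verdier_quotient T D) X Y" "\<chi> \<in> Hom (verdier_quotient T D) Y Z"
  then obtain s f P t g Q r h R where
    s: "s \<in> cone_in T D" "s \<in> Hom T P W" and f: "f \<in> Hom T P X" and \<phi>: "\<phi> = roof_class T D W X (s, f)"
    and t: "t \<in> cone_in T D" "t \<in> Hom T Q X" and g: "g \<in> Hom T Q Y" and \<psi>: "\<psi> = roof_class T D X Y (t, g)"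
    and r: "r \<in> cone_in T D" "r \<in> Hom T R Y" and h: "h \<in> Hom T R Z" and \<chi>: "\<chi> = roof_class T D Y Z (r, h)"
    unfolding Hom_verdier by metis
  obtain U t' f' where sq: "t' \<in> Hom T U P" "f' \<in> Hom T U Q" "t' \<in> cone_in T D" "f \<cdot> t' = t \<cdot> f'"
    using ore[OF f t(2,1)] by blast
  obtain V r' k where sq': "r' \<in> Hom T V Q" "k \<in> Hom T V R" "r' \<in> cone_in T D" "g \<cdot> r' = r \<cdot> k"
    using ore[OF g r(2,1)] by blast
  \<comment> \<open>The three squares form a pyramid over the three roofs; both bracketings are
    computed from it and give literally the same roof.\<close>
  obtain L x e where x: "x \<in> Hom T L U" "e \<in> Hom T L V" "x \<in> cone_in T D" "f' \<cdot> x = r' \<cdot> e"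
    using ore[OF sq(2) sq'(1,3)] by blast
  note [simp] = HomD[OF s(2)] HomD[OF f] HomD[OF t(2)] HomD[OF g] HomD[OF r(2)] HomD[OF h] HomD[OF sq(1)] HomD[OF sq(2)]
    HomD[OF sq'(1)] HomD[OF sq'(2)] HomD[OF x(1)] HomD[OF x(2)]
  have st: "s \<cdot> t' \<in> cone_in T D" "t \<cdot> r' \<in> cone_in T D" "t' \<cdot> x \<in> cone_in T D" using Comp_cone_in s t sq sq' x by auto
  have "(g \<cdot> f') \<cdot> x = g \<cdot> (f' \<cdot> x)" by simp
  also have "\<dots> = (g \<cdot> r') \<cdot> e" by (simp add: x(4))
  also have "\<dots> = r \<cdot> (k \<cdot> e)" by (simp add: sq'(4))
  finally have 1: "(g \<cdot> f') \<cdot> x = r \<cdot> (k \<cdot> e)" .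
  have "f \<cdot> (t' \<cdot> x) = (f \<cdot> t') \<cdot> x" by simp
  also have "\<dots> = t \<cdot> (f' \<cdot> x)" by (simp add: sq(4))
  also have "\<dots> = (t \<cdot> r') \<cdot> e" by (simp add: x(4))
  finally have 2: "f \<cdot> (t' \<cdot> x) = (t \<cdot> r') \<cdot> e" .
  have "fraction_comp T D \<chi> (fraction_comp T D \<psi> \<phi>) = roof_class T D W Z ((s \<cdot> t') \<cdot> x, h \<cdot> (k \<cdot> e))"
    unfolding \<phi> \<psi> \<chi> fraction_comp_class[OF s(2,1) f t(2,1) g sq(1,3,2,4)]
    by (rule fraction_comp_class[OF Comp_Hom[OF sq(1) s(2)] st(1) Comp_Hom[OF sq(2) g] r(2,1) h x(1,3) Comp_Hom[OF x(2) sq'(2)] 1])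
  moreover have "fraction_comp T D (fraction_comp T D \<chi> \<psi>) \<phi> = roof_class T D W Z (s \<cdot> (t' \<cdot> x), (h \<cdot> k) \<cdot> e)"
    unfolding \<phi> \<psi> \<chi> fraction_comp_class[OF t(2,1) g r(2,1) h sq'(1,3,2,4)]
    by (rule fraction_comp_class[OF s(2,1) f Comp_Hom[OF sq'(1) t(2)] st(2) Comp_Hom[OF sq'(2) h] Comp_Hom[OF x(1) sq(1)] st(3) x(2) 2])
  ultimately show "Comp (verdier_quotient T D) (Comp (verdier_quotient T D) \<chi> \<psi>) \<phi>
      = Comp (verdier_quotient T D) \<chi> (Comp (verdier_quotient T D) \<psi> \<phi>)" by simp
qed

lemma fraction_comp_localization:
  assumes s: "s \<in> Hom T W X" "s \<in> cone_in T D" and f: "f \<in> Hom T W Y" and g: "g \<in> Hom T Y Z"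
  shows "fraction_comp T D (roof_class T D Y Z (Ide T Y, g)) (roof_class T D X Y (s, f)) = roof_class T D X Z (s, g \<cdot> f)"
proof -
  have o: "W \<in> Obj T" "Y \<in> Obj T" using Hom_Obj f by auto
  show ?thesis
    using fraction_comp_class[OF s f Ide_Hom[OF o(2)] Ide_cone_in[OF o(2)] g Ide_Hom[OF o(1)] Ide_cone_in[OF o(1)] f]
      HomD[OF s(1)] HomD[OF f] o by simp
qed

end

section \<open>Generated triangulated subcategories\<close>

context additive_category
begin

lemma isomorphic_sym: "isomorphic (Kb A) X Y \<Longrightarrow> isomorphic (Kb A) Y X"
  unfolding isomorphic_Kb heq_def by blast

lemma isomorphic_bounded: "isomorphic (Kb A) X Y \<Longrightarrow> bounded_complex A X \<and> bounded_complex A Y"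
  unfolding isomorphic_Kb heq_def using cmap_simps(1,2) by blast

text \<open>Closure under isomorphism reduces an arbitrary distinguished triangle to a standard
  cone, and the equivalence required for shifts to closure in both directions.\<close>

lemma strict_triangulatedI:
  assumes b: "\<And>X. X \<in> D \<Longrightarrow> bounded_complex A X"
    and z: "Z \<in> D" "is_zero_obj (Kb A) Z"
    and iso: "\<And>X Y. X \<in> D \<Longrightarrow> isomorphic (Kb A) X Y \<Longrightarrow> Y \<in> D"
    and sh: "\<And>X. X \<in> D \<Longrightarrow> shift_complex A X \<in> D" "\<And>X. X \<in> D \<Longrightarrow> unshift_complex X \<in> D"
    and c: "\<And>X Y f. cmap X Y f \<Longrightarrow> X \<in> D \<Longrightarrow> Y \<in> D \<Longrightarrow> cone A X Y f \<in> D"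
  shows "strict_triangulated_subcat (Kb A) D"
proof -
  have "Cod (Kb A) g \<in> D" if t: "(f, g, h) \<in> distinguished_triangles A" "Dom (Kb A) f \<in> D" "Cod (Kb A) f \<in> D" for f g h
    using t(1)
  proof (rule distinguishedE)
    fix X Y Z X' Y' f' k \<alpha> \<alpha>' \<beta> \<beta>'
    assume *: "cmap X Y f'" "f = htpy_class A X Y f'" "g \<in> Hom (Kb A) Y Z" "cmap X' Y' k"
      "isomorphic (Kb A) Z (cone A X' Y' k)" "heq X X' \<alpha> \<alpha>'" "heq Y Y' \<beta> \<beta>'"
    have "X' \<in> D" "Y' \<in> D" using t(2,3) iso isomorphic_Kb *(2,6,7) by auto
    then have "cone A X' Y' k \<in> D" using c *(4) by blast
    then have "Z \<in> D" using iso isomorphic_sym[OF *(5)] by blast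
    then show ?thesis using *(3) by (simp add: Hom_def)
  qed
  moreover have "X \<in> D \<longleftrightarrow> shift_complex A X \<in> D" if "bounded_complex A X" for X
    using sh unshift_shift[OF that] by metis
  ultimately show ?thesis
    unfolding strict_triangulated_subcat_def Kb_simps using b z iso by blast
qed

text \<open>Ensures that the family intersected in a generated subcategory is non-empty, so that the
  intersection consists of bounded complexes.\<close>

lemma strict_triangulated_UNIV: "strict_triangulated_subcat (Kb A) (Collect (bounded_complex A))"
proof -
  let ?Z = "\<lparr>deg = \<lambda>n. zero_obj A, diff = \<lambda>n. Zero A (zero_obj A) (zero_obj A)\<rparr>"
  have "bounded_complex A ?Z"
    by (rule bounded_complexI) (simp_all add: zero_obj)
  then have "is_zero_obj (Kb A) ?Z" by (rule zero_complex_is_zero) (simp add: zero_obj)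
  then show ?thesis
    using \<open>bounded_complex A ?Z\<close> isomorphic_bounded
    by (intro strict_triangulatedI[where Z="?Z"]) auto
qed

lemma strict_triangulated_generated:
  assumes "P \<subseteq> Collect (bounded_complex A)"
  shows "strict_triangulated_subcat (Kb A) (generated_triangulated_subcat (Kb A) P)"
proof -
  let ?G = "generated_triangulated_subcat (Kb A) P"
  have ts: "triangulated_subcategory A D" if "strict_triangulated_subcat (Kb A) D" for D
    using that by unfold_locales
  have G: "X \<in> ?G \<longleftrightarrow> (\<forall>D. strict_triangulated_subcat (Kb A) D \<and> P \<subseteq> D \<longrightarrow> X \<in> D)" for X
    by (auto simp: generated_triangulated_subcat_def)
  obtain Z where Z: "is_zero_obj (Kb A) Z"
    using strict_triangulated_UNIV by (auto simp: strict_triangulated_subcat_def)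
  show ?thesis
  proof (rule strict_triangulatedI)
    \<comment> \<open>Each member of the family contains all zero objects, so one fixed zero object
      is common to them.\<close>
    show "Z \<in> ?G" unfolding G using triangulated_subcategory.D_zero[OF ts Z] by blast
    show b: "bounded_complex A X" if "X \<in> ?G" for X
      using that strict_triangulated_UNIV assms unfolding G by blast
    show "Y \<in> ?G" if "X \<in> ?G" "isomorphic (Kb A) X Y" for X Y
      using that triangulated_subcategory.D_iso[OF ts] unfolding G by blast
    show "shift_complex A X \<in> ?G" if "X \<in> ?G" for X
      using that triangulated_subcategory.D_shift[OF ts b[OF that]] unfolding G by blast
    show "unshift_complex X \<in> ?G" if "X \<in> ?G" for X
      using that triangulated_subcategory.D_unshift[OF ts] unfolding G by blast
    show "cone A X Y f \<in> ?G" if "cmap X Y f" "X \<in> ?G" "Y \<in> ?G" for X Y f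
      using that triangulated_subcategory.D_cone[OF ts] unfolding G by blast
  qed (rule Z)
qed

lemma generated_subset:
  "strict_triangulated_subcat (Kb A) D \<Longrightarrow> P \<subseteq> D \<Longrightarrow> generated_triangulated_subcat (Kb A) P \<subseteq> D"
  by (auto simp: generated_triangulated_subcat_def)

lemma from_zero_obj_eq:
  "is_zero_obj A (Dom A f) \<Longrightarrow> f \<in> Arr A \<Longrightarrow> g \<in> Arr A \<Longrightarrow> Dom A f = Dom A g \<Longrightarrow> Cod A f = Cod A g \<Longrightarrow> f = g"
  using from_zero_obj by metis

lemma to_zero_obj_eq:
  "is_zero_obj A (Cod A f) \<Longrightarrow> f \<in> Arr A \<Longrightarrow> g \<in> Arr A \<Longrightarrow> Dom A f = Dom A g \<Longrightarrow> Cod A f = Cod A g \<Longrightarrow> f = g"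
  using to_zero_obj by metis

end

section \<open>Calculus of fractions for bounded complexes\<close>

context triangulated_subcategory
begin

sublocale frac: fraction_calculus "Kb A" D
proof
  fix X assume "X \<in> Obj (Kb A)"
  then show "Ide (Kb A) X \<in> cone_in (Kb A) D"
    unfolding cone_in_Kb Kb_simps mem_Collect_eq using D_zero[OF cone_of_heq[OF heq_Ide]] cmap_Ide by blast
next
  fix s t assume st: "s \<in> cone_in (Kb A) D" "t \<in> cone_in (Kb A) D" "Dom (Kb A) t = Cod (Kb A) s"
  then obtain X Y Z s1 t1 where *: "cmap X Y s1" "s = htpy_class A X Y s1" "cone A X Y s1 \<in> D"
    "cmap Y Z t1" "t = htpy_class A Y Z t1" "cone A Y Z t1 \<in> D"
    unfolding cone_in_Kb by (elim exE conjE) (metis Dom_Cod_Kb)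
  then show "Comp (Kb A) t s \<in> cone_in (Kb A) D"
    unfolding cone_in_Kb Kb_simps using cone_Comp_in_D[OF *(1,4,3,6)] cmap_Comp[OF *(1,4)] htpy_comp_class[OF *(1,4)]
    by blast
next
  fix f W Y t V assume f: "f \<in> Hom (Kb A) W Y" and t: "t \<in> Hom (Kb A) V Y" "t \<in> cone_in (Kb A) D"
  obtain f1 where f1: "cmap W Y f1" "f = htpy_class A W Y f1" using f Hom_Kb by blast
  obtain t1 where t1: "cmap V Y t1" "t = htpy_class A V Y t1" "cone A V Y t1 \<in> D"
    using t unfolding cone_in_Kb by (auto simp: Hom_def)
  obtain U t' f' where *: "cmap U W t'" "cone A U W t' \<in> D" "cmap U V f'" "homotopic A U Y (\<lambda>n. f1 n \<cdot> t' n) (\<lambda>n. t1 n \<cdot> f' n)"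
    using ore_square[OF t1(1,3) f1(1)] by blast
  show "\<exists>U. \<exists>t' \<in> Hom (Kb A) U W. \<exists>f' \<in> Hom (Kb A) U V. t' \<in> cone_in (Kb A) D \<and> Comp (Kb A) f t' = Comp (Kb A) t f'"
  proof (intro exI bexI conjI)
    show "htpy_class A U W t' \<in> cone_in (Kb A) D" unfolding cone_in_Kb using * by blast
    show "Comp (Kb A) f (htpy_class A U W t') = Comp (Kb A) t (htpy_class A U V f')"
      using * f1 t1 htpy_class_eq_iff[OF cmap_Comp cmap_Comp] by (simp add: htpy_comp_class)
  qed (use * htpy_class_in_Hom in auto)
next
  fix s X Y f W g
  assume s: "s \<in> cone_in (Kb A) D" "s \<in> Hom (Kb A) X Y" and f: "f \<in> Hom (Kb A) W X" and g: "g \<in> Hom (Kb A) W X"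
    and eq: "Comp (Kb A) s f = Comp (Kb A) s g"
  obtain s1 where s1: "cmap X Y s1" "s = htpy_class A X Y s1" "cone A X Y s1 \<in> D"
    using s unfolding cone_in_Kb by (auto simp: Hom_def)
  obtain f1 where f1: "cmap W X f1" "f = htpy_class A W X f1" using f Hom_Kb by blast
  obtain g1 where g1: "cmap W X g1" "g = htpy_class A W X g1" using g Hom_Kb by blast
  have "homotopic A W Y (\<lambda>n. s1 n \<cdot> f1 n) (\<lambda>n. s1 n \<cdot> g1 n)"
    using eq s1 f1 g1 htpy_class_eq_iff[OF cmap_Comp cmap_Comp] by (simp add: htpy_comp_class)
  then obtain U t where *: "cmap U W t" "cone A U W t \<in> D" "homotopic A U X (\<lambda>n. f1 n \<cdot> t n) (\<lambda>n. g1 n \<cdot> t n)"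
    using cancel_left[OF s1(1,3) f1(1) g1(1)] by blast
  show "\<exists>U. \<exists>t \<in> Hom (Kb A) U W. t \<in> cone_in (Kb A) D \<and> Comp (Kb A) f t = Comp (Kb A) g t"
  proof (intro exI bexI conjI)
    show "htpy_class A U W t \<in> cone_in (Kb A) D" unfolding cone_in_Kb using * by blast
    show "Comp (Kb A) f (htpy_class A U W t) = Comp (Kb A) g (htpy_class A U W t)"
      using * f1 g1 htpy_class_eq_iff[OF cmap_Comp cmap_Comp] by (simp add: htpy_comp_class)
  qed (use * htpy_class_in_Hom in auto)
qed

end


section \<open>Stalk complexes\<close>

context additive_category
begin

lemma deg_stalk [simp]: "deg (stalk A X) n = (if n = 0 then X else zero_obj A)"
  by (simp add: stalk_def Let_def)

lemma diff_stalk [simp]: "diff (stalk A X) n = Zero A (deg (stalk A X) n) (deg (stalk A X) (n + 1))"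
  by (simp add: stalk_def Let_def)

lemma bounded_stalk [simp]: "X \<in> Obj A \<Longrightarrow> bounded_complex A (stalk A X)"
proof (rule bounded_complexI)
  show "finite {n. \<not> is_zero_obj A (deg (stalk A X) n)}"
    by (rule finite_subset[of _ "{0}"]) (auto simp: zero_obj split: if_splits)
qed simp_all

lemma deg_arrow_cone [simp]:
  "deg (arrow_cone A s) n = (if n = - 1 then Dom A s else if n = 0 then Cod A s else zero_obj A)"
  by (simp add: arrow_cone_def Let_def)

lemma diff_arrow_cone [simp]:
  "diff (arrow_cone A s) n = (if n = - 1 then s else Zero A (deg (arrow_cone A s) n) (deg (arrow_cone A s) (n + 1)))"
  by (simp add: arrow_cone_def Let_def)

lemma bounded_arrow_cone [simp]: "s \<in> Arr A \<Longrightarrow> bounded_complex A (arrow_cone A s)"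
proof (rule bounded_complexI)
  show "finite {n. \<not> is_zero_obj A (deg (arrow_cone A s) n)}"
    by (rule finite_subset[of _ "{-1, 0}"]) (auto simp: zero_obj split: if_splits)
qed auto

text \<open>Off degree 0 the value is the one used by \<open>stalk_functor\<close>; on a zero object
  it is also the zero arrow.\<close>

definition stalk_map :: "'m \<Rightarrow> int \<Rightarrow> 'm" where
  "stalk_map f n = (if n = 0 then f else Ide A (zero_obj A))"

lemma cmap_stalk_map: "f \<in> Hom A X Y \<Longrightarrow> cmap (stalk A X) (stalk A Y) (stalk_map f)"
proof -
  assume f: "f \<in> Hom A X Y"
  note [simp] = HomD[OF f]
  have [simp]: "X \<in> Obj A" "Y \<in> Obj A" using Hom_Obj[OF f] by auto
  show ?thesis
    by (rule cmapI) (auto simp: stalk_map_def intro: to_zero_obj_eq from_zero_obj_eq simp: zero_obj)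
qed

lemma zero_obj_is [simp]: "Ide A (zero_obj A) = Zero A (zero_obj A) (zero_obj A)"
  using zero_obj is_zero_obj_iff by blast

lemma stalk_functor_simps:
  "on_obj (stalk_functor A) X = stalk A X"
  "f \<in> Hom A X Y \<Longrightarrow> on_arr (stalk_functor A) f = htpy_class A (stalk A X) (stalk A Y) (stalk_map f)"
  by (simp_all add: stalk_functor_def Hom_def stalk_map_def[abs_def])

text \<open>The terms of the standard cone are biproducts with zero objects, so it is isomorphic to
  the two-term complex without being equal to it. The arrows \<open>a\<close> and \<open>b\<close>
  are inverse on the nose, as components from zero objects agree automatically.\<close>

lemma cone_stalk_map:
  assumes s: "s \<in> Hom A X Y"
  shows "isomorphic (Kb A) (cone A (stalk A X) (stalk A Y) (stalk_map s)) (arrow_cone A s)"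
proof -
  let ?X = "stalk A X" and ?Y = "stalk A Y"
  let ?C = "cone A ?X ?Y (stalk_map s)" and ?K = "arrow_cone A s"
  note c = cmap_stalk_map[OF s]
  note [simp] = HomD[OF s] c diff_cone[OF c] diff_cone'[OF c]
  have [simp]: "X \<in> Obj A" "Y \<in> Obj A" using Hom_Obj[OF s] by auto
  note bp = cone_biprod_simps[of ?X ?Y "-1"] cone_biprod_simps[of ?X ?Y 0]
  define a where "a n = (if n = -1 then cp1 ?X ?Y n else if n = 0 then cp2 ?X ?Y n
     else Zero A (deg ?C n) (zero_obj A))" for n
  define b where "b n = (if n = -1 then ci1 ?X ?Y n else if n = 0 then ci2 ?X ?Y n
     else Zero A (zero_obj A) (deg ?C n))" for n
  have a_arr [simp]: "a n \<in> Arr A" "Dom A (a n) = deg ?C n" "Cod A (a n) = deg ?K n" for n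
    using bp by (auto simp: a_def)
  have b_arr [simp]: "b n \<in> Arr A" "Dom A (b n) = deg ?K n" "Cod A (b n) = deg ?C n" for n
    using bp by (auto simp: b_def)
  have a: "cmap ?C ?K a"
  proof (rule cmapI)
    fix n :: int
    \<comment> \<open>In the remaining degrees the target \<open>deg ?K (n + 1)\<close> is a zero
      object.\<close>
    consider "n = -2" | "n = -1" | "n \<noteq> -1" "n \<noteq> -2" by blast
    then show "diff ?K n \<cdot> a n = a (n + 1) \<cdot> diff ?C n"
    proof cases
      case 1
      then show ?thesis using bp diff_cone(6)[OF c, of "-1" "-2"] cone_biprod_simps[of ?X ?Y "-2"] diff_cone(1-3)[OF c, of "-2"]
        by (simp add: a_def)
    next
      case 2
      then show ?thesis using bp diff_cone(7)[OF c, of 0 "-1"] by (simp add: a_def stalk_map_def)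
    next
      case 3
      then show ?thesis by (intro to_zero_obj_eq) (simp_all add: zero_obj)
    qed
  qed simp_all
  have b: "cmap ?K ?C b"
  proof (rule cmapI)
    fix n :: int
    consider "n = -1" | "n = 0" | "n \<noteq> -1" "n \<noteq> 0" by blast
    then show "diff ?C n \<cdot> b n = b (n + 1) \<cdot> diff ?K n"
    proof cases
      case 1
      then show ?thesis using bp diff_cone(4)[OF c, of "-1"] by (simp add: b_def stalk_map_def)
    next
      case 2
      then show ?thesis using bp diff_cone(5)[OF c, of 0] cone_biprod_simps[of ?X ?Y 1] by (simp add: b_def)
    next
      case 3
      then show ?thesis by (intro from_zero_obj_eq) (simp_all add: zero_obj)
    qed
  qed simp_all
  have ab: "a n \<cdot> b n = Ide A (deg ?K n)" for n
    using bp by (auto simp: a_def b_def)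
  have ba: "b n \<cdot> a n = Ide A (deg ?C n)" for n
  proof -
    have 1: "(b n \<cdot> a n) \<cdot> ci1 ?X ?Y n = Ide A (deg ?C n) \<cdot> ci1 ?X ?Y n"
    proof (cases "n = -1")
      case True
      then show ?thesis using bp by (simp add: a_def b_def)
    next
      case False
      then show ?thesis by (intro from_zero_obj_eq) (simp_all add: zero_obj)
    qed
    have 2: "(b n \<cdot> a n) \<cdot> ci2 ?X ?Y n = Ide A (deg ?C n) \<cdot> ci2 ?X ?Y n"
    proof (cases "n = 0")
      case True
      then show ?thesis using bp by (simp add: a_def b_def)
    next
      case False
      then show ?thesis by (intro from_zero_obj_eq) (simp_all add: zero_obj)
    qed
    show ?thesis by (rule from_cone_eqI[OF _ _ _ _ _ _ _ 1 2]) simp_all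
  qed
  show ?thesis
    by (rule isomorphicI[OF a b homotopic_eqI[OF cmap_Comp[OF a b] ba] homotopic_eqI[OF cmap_Comp[OF b a] ab]])
qed

end

section \<open>Truncation of complexes built from cones\<close>

context triangulated_subcategory
begin

text \<open>\<open>C'\<close> plays the role of the brutal truncation \<open>C\<^sup>\<ge>\<^sup>n\<close>, which itself need not belong to
  \<open>D\<close>; the degree \<open>n - 1\<close> leaves room for the source of an element of \<open>S\<close>.\<close>

definition approximable :: "('o, 'm) cochain \<Rightarrow> bool" where
  "approximable C \<longleftrightarrow> bounded_complex A C \<and> (\<forall>n. \<exists>C' i. C' \<in> D \<and> cmap C' C i \<and>
     (\<forall>k < n - 1. is_zero_obj A (deg C' k)) \<and> (\<forall>k \<ge> n. iso_arr A (i k)))"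

lemma approximableE:
  assumes "approximable C"
  obtains C' i where "C' \<in> D" "cmap C' C i" "\<And>k. k < n - 1 \<Longrightarrow> is_zero_obj A (deg C' k)" "\<And>k. k \<ge> n \<Longrightarrow> iso_arr A (i k)"
  using assms unfolding approximable_def by meson

lemma approximable_shift:
  assumes "approximable C"
  shows "approximable (shift_complex A C)"
  unfolding approximable_def
proof (intro conjI allI)
  show "bounded_complex A (shift_complex A C)" using assms by (simp add: approximable_def)
  fix n :: int
  obtain C' i where C': "C' \<in> D" "cmap C' C i" "\<And>k. k < n + 1 - 1 \<Longrightarrow> is_zero_obj A (deg C' k)" "\<And>k. k \<ge> n + 1 \<Longrightarrow> iso_arr A (i k)"
    using approximableE[OF assms] by metis
  show "\<exists>C' i. C' \<in> D \<and> cmap C' (shift_complex A C) i \<and>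
     (\<forall>k < n - 1. is_zero_obj A (deg C' k)) \<and> (\<forall>k \<ge> n. iso_arr A (i k))"
    by (rule exI[of _ "shift_complex A C'"], rule exI[of _ "\<lambda>k. i (k + 1)"])
      (use C' D_shift[OF D_bounded[OF C'(1)]] cmap_shift[OF C'(2)] in simp)
qed

lemma approximable_unshift:
  assumes "approximable C"
  shows "approximable (unshift_complex C)"
  unfolding approximable_def
proof (intro conjI allI)
  show "bounded_complex A (unshift_complex C)" using assms by (simp add: approximable_def)
  fix n :: int
  obtain C' i where C': "C' \<in> D" "cmap C' C i" "\<And>k. k < n - 1 - 1 \<Longrightarrow> is_zero_obj A (deg C' k)" "\<And>k. k \<ge> n - 1 \<Longrightarrow> iso_arr A (i k)"
    using approximableE[OF assms] by metis
  show "\<exists>C' i. C' \<in> D \<and> cmap C' (unshift_complex C) i \<and>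
     (\<forall>k < n - 1. is_zero_obj A (deg C' k)) \<and> (\<forall>k \<ge> n. iso_arr A (i k))"
    by (rule exI[of _ "unshift_complex C'"], rule exI[of _ "\<lambda>k. i (k - 1)"])
      (use C' D_unshift cmap_unshift[OF C'(2)] in simp)
qed

text \<open>The map lifts to the approximations as \<open>f i\<close> followed by the inverse of
  \<open>j\<close>. This is possible because \<open>X'\<close> vanishes in the degrees where
  \<open>j\<close> is not known to be invertible; the cone of the lift is then the
  approximation.\<close>

lemma approximable_cone:
  assumes f: "cmap X Y f" and X: "approximable X" and Y: "approximable Y"
  shows "approximable (cone A X Y f)"
  unfolding approximable_def
proof (intro conjI allI)
  show "bounded_complex A (cone A X Y f)" using f by simp
  fix n :: int
  \<comment> \<open>\<open>X\<close> enters the cone one degree higher, hence the threshold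
    \<open>n + 1\<close>. It makes \<open>X'\<close> vanish below \<open>n\<close>, while
    \<open>j\<close> is invertible from \<open>n\<close> on.\<close>
  obtain X' i where X': "X' \<in> D" "cmap X' X i" "\<And>k. k < n + 1 - 1 \<Longrightarrow> is_zero_obj A (deg X' k)" "\<And>k. k \<ge> n + 1 \<Longrightarrow> iso_arr A (i k)"
    using approximableE[OF X] by metis
  obtain Y' j where Y': "Y' \<in> D" "cmap Y' Y j" "\<And>k. k < n - 1 \<Longrightarrow> is_zero_obj A (deg Y' k)" "\<And>k. k \<ge> n \<Longrightarrow> iso_arr A (j k)"
    using approximableE[OF Y] by metis
  note [simp] = cmap_simps[OF f] cmap_simps[OF X'(2)] cmap_simps[OF Y'(2)]
  have "\<forall>k. \<exists>j'. k \<ge> n \<longrightarrow> j' \<in> Hom A (deg Y k) (deg Y' k) \<and> j' \<cdot> j k = Ide A (deg Y' k) \<and> j k \<cdot> j' = Ide A (deg Y k)"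
    using Y'(4) by (auto simp: iso_arr_def)
  then obtain j' where j': "\<And>k. k \<ge> n \<Longrightarrow> j' k \<in> Hom A (deg Y k) (deg Y' k)"
    "\<And>k. k \<ge> n \<Longrightarrow> j' k \<cdot> j k = Ide A (deg Y' k)" "\<And>k. k \<ge> n \<Longrightarrow> j k \<cdot> j' k = Ide A (deg Y k)" by metis
  note [simp] = j'(2,3) HomD[OF j'(1)]
  have [simp]: "Cod A h = deg Y k \<Longrightarrow> j k \<cdot> (j' k \<cdot> h) = h" "Cod A h = deg Y' k \<Longrightarrow> j' k \<cdot> (j k \<cdot> h) = h"
    if "k \<ge> n" "h \<in> Arr A" for h k
    using that by (simp_all flip: Comp_assoc')
  define f' where "f' k = (if k \<ge> n then j' k \<cdot> (f k \<cdot> i k) else Zero A (deg X' k) (deg Y' k))" for k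
  have [simp]: "f' k \<in> Arr A" "Dom A (f' k) = deg X' k" "Cod A (f' k) = deg Y' k" for k
    by (auto simp: f'_def)
  have jf': "j k \<cdot> f' k = f k \<cdot> i k" for k
  proof (cases "k \<ge> n")
    case True
    then show ?thesis by (simp add: f'_def)
  next
    case False
    then show ?thesis using X'(3) by (intro from_zero_obj_eq) simp_all
  qed
  have f': "cmap X' Y' f'"
  proof (rule cmapI)
    fix k
    show "diff Y' k \<cdot> f' k = f' (k + 1) \<cdot> diff X' k"
    proof (cases "k \<ge> n")
      case True
      have "j (k + 1) \<cdot> (diff Y' k \<cdot> f' k) = diff Y k \<cdot> (j k \<cdot> f' k)"
        using cmap_simps(7)[OF Y'(2), of "f' k" k] by simp
      also have "\<dots> = (f (k + 1) \<cdot> i (k + 1)) \<cdot> diff X' k" unfolding jf' by simp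
      also have "\<dots> = j (k + 1) \<cdot> (f' (k + 1) \<cdot> diff X' k)" unfolding jf'[symmetric] by simp
      finally have "j' (k + 1) \<cdot> (j (k + 1) \<cdot> (diff Y' k \<cdot> f' k)) = j' (k + 1) \<cdot> (j (k + 1) \<cdot> (f' (k + 1) \<cdot> diff X' k))"
        by simp
      then show ?thesis using True by simp
    next
      case False
      then show ?thesis using X'(3) by (intro from_zero_obj_eq) simp_all
    qed
  qed simp_all
  let ?C = "cone A X Y f" and ?C' = "cone A X' Y' f'"
  note [simp] = f f' diff_cone[OF f] diff_cone'[OF f] diff_cone[OF f'] diff_cone'[OF f']
  define c where "c k = ccp X' Y' k (ci1 X Y k \<cdot> i (k + 1)) (ci2 X Y k \<cdot> j k)" for k
  have c: "cmap ?C' ?C c"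
  proof (rule cmapI)
    show "diff ?C k \<cdot> c k = c (k + 1) \<cdot> diff ?C' k" for k
      by (rule from_cone_eqI[of X' Y' _ _ k]; simp add: c_def jf')
  qed (simp_all add: c_def)
  have "?C' \<in> D" using D_cone[OF f' X'(1) Y'(1)] .
  moreover have "is_zero_obj A (deg ?C' k)" if "k < n - 1" for k
    using biproduct_zero[OF cone_biprod, of X' Y' k] X'(3)[of "k + 1"] Y'(3)[of k] that by simp
  moreover have "iso_arr A (c k)" if k: "k \<ge> n" for k
  proof -
    obtain i' where i': "i' \<in> Hom A (deg X (k + 1)) (deg X' (k + 1))" "i' \<cdot> i (k + 1) = Ide A (deg X' (k + 1))"
      "i (k + 1) \<cdot> i' = Ide A (deg X (k + 1))"
      using X'(4)[of "k + 1"] k by (auto simp: iso_arr_def)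
    note [simp] = i'(2,3) HomD[OF i'(1)]
    have [simp]: "Cod A h = deg X (k + 1) \<Longrightarrow> i (k + 1) \<cdot> (i' \<cdot> h) = h" "Cod A h = deg X' (k + 1) \<Longrightarrow> i' \<cdot> (i (k + 1) \<cdot> h) = h"
      if "h \<in> Arr A" for h
      using that by (simp_all flip: Comp_assoc')
    define e where "e = ccp X Y k (ci1 X' Y' k \<cdot> i') (ci2 X' Y' k \<cdot> j' k)"
    have [simp]: "c k \<in> Arr A" "Dom A (c k) = bsum (cone_biprod A X' Y' k)" "Cod A (c k) = bsum (cone_biprod A X Y k)"
      using cmap_simps(3-5)[OF c, of k] by simp_all
    have e: "e \<in> Arr A" "Dom A e = bsum (cone_biprod A X Y k)" "Cod A e = bsum (cone_biprod A X' Y' k)"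
      using k by (simp_all add: e_def)
    have "e \<cdot> c k = Ide A (bsum (cone_biprod A X' Y' k))"
      by (rule from_cone_eqI[of X' Y' _ _ k]; use k in \<open>simp add: c_def e_def\<close>)
    moreover have "c k \<cdot> e = Ide A (bsum (cone_biprod A X Y k))"
      by (rule from_cone_eqI[of X Y _ _ k]; use k in \<open>simp add: c_def e_def\<close>)
    ultimately show ?thesis
      unfolding iso_arr_def using e by (auto simp: Hom_def intro!: exI[of _ e])
  qed
  ultimately show "\<exists>C' i. C' \<in> D \<and> cmap C' ?C i \<and>
     (\<forall>k < n - 1. is_zero_obj A (deg C' k)) \<and> (\<forall>k \<ge> n. iso_arr A (i k))"
    using c by blast
qed

lemma iso_arr_Ide: "X \<in> Obj A \<Longrightarrow> iso_arr A (Ide A X)"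
  unfolding iso_arr_def by (auto simp: Hom_def intro!: exI[of _ "Ide A X"])

lemma iso_arr_zero:
  assumes "f \<in> Arr A" "is_zero_obj A (Dom A f)" "is_zero_obj A (Cod A f)"
  shows "iso_arr A f"
  unfolding iso_arr_def
proof (intro conjI bexI)
  show "Zero A (Cod A f) (Dom A f) \<in> Hom A (Cod A f) (Dom A f)" using assms Zero_Hom by simp
  show "Zero A (Cod A f) (Dom A f) \<cdot> f = Ide A (Dom A f)" "f \<cdot> Zero A (Cod A f) (Dom A f) = Ide A (Cod A f)"
    using assms by (auto simp: is_zero_obj_iff)
qed (rule assms)

text \<open>For a threshold at most \<open>a\<close>, the complex \<open>C\<close> serves unchanged,
  its term in degree \<open>a - 1\<close> being covered by the one degree of slack. Beyond
  \<open>a\<close> the zero complex serves.\<close>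

lemma approximable_of_degrees:
  assumes C: "C \<in> D" and lo: "\<And>k. k < a - 1 \<Longrightarrow> is_zero_obj A (deg C k)" and hi: "\<And>k. k > a \<Longrightarrow> is_zero_obj A (deg C k)"
  shows "approximable C"
  unfolding approximable_def
proof (intro conjI allI)
  note b [simp] = D_bounded[OF C]
  show "bounded_complex A C" by simp
  fix n :: int
  show "\<exists>C' i. C' \<in> D \<and> cmap C' C i \<and> (\<forall>k < n - 1. is_zero_obj A (deg C' k)) \<and> (\<forall>k \<ge> n. iso_arr A (i k))"
  proof (cases "n \<le> a")
    case True
    then show ?thesis using C cmap_Ide[OF b] lo iso_arr_Ide
      by (intro exI[of _ C] exI[of _ "\<lambda>n. Ide A (deg C n)"]) auto
  next
    case False
    obtain Z where Z: "Z \<in> D" "\<And>k. is_zero_obj A (deg Z k)"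
    proof
      have b: "bounded_complex A (stalk A (zero_obj A))" by simp
      have z: "is_zero_obj A (deg (stalk A (zero_obj A)) k)" for k by (simp add: zero_obj)
      show "stalk A (zero_obj A) \<in> D" using D_zero[OF zero_complex_is_zero[OF b z]] .
    qed (simp add: zero_obj)
    have "iso_arr A (Zero A (deg Z k) (deg C k))" if "k \<ge> n" for k
      using iso_arr_zero[of "Zero A (deg Z k) (deg C k)"] Z D_bounded[OF Z(1)] hi[of k] False that by simp
    then show ?thesis using Z cmap_Zero[OF D_bounded[OF Z(1)] b]
      by (intro exI[of _ Z] exI[of _ "\<lambda>n. Zero A (deg Z n) (deg C n)"]) auto
  qed
qed

section \<open>Retracts of approximable complexes\<close>

lemma hretract_refl: "bounded_complex A X \<Longrightarrow> hretract X X"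
  unfolding hretract_def using heq_Ide heq_def by blast

lemma isomorphic_hretract: "isomorphic (Kb A) X Y \<Longrightarrow> hretract X Y"
  unfolding hretract_def isomorphic_Kb heq_def by blast

lemma hretract_shift: "hretract X Y \<Longrightarrow> hretract (shift_complex A X) (shift_complex A Y)"
proof -
  assume "hretract X Y"
  then obtain j r where j: "cmap X Y j" and r: "cmap Y X r" and rj: "homotopic A X X (\<lambda>n. r n \<cdot> j n) (\<lambda>n. Ide A (deg X n))"
    using hretract_def by blast
  have b: "bounded_complex A X" using cmap_simps(1)[OF j] .
  show ?thesis unfolding hretract_def
    using cmap_shift[OF j] cmap_shift[OF r] homotopic_shift[OF cmap_Comp[OF j r] cmap_Ide[OF b] rj] by auto
qed

lemma hretract_unshift: "hretract X Y \<Longrightarrow> hretract (unshift_complex X) (unshift_complex Y)"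
proof -
  assume "hretract X Y"
  then obtain j r where j: "cmap X Y j" and r: "cmap Y X r" and rj: "homotopic A X X (\<lambda>n. r n \<cdot> j n) (\<lambda>n. Ide A (deg X n))"
    using hretract_def by blast
  have b: "bounded_complex A X" using cmap_simps(1)[OF j] .
  show ?thesis unfolding hretract_def
    using cmap_unshift[OF j] cmap_unshift[OF r] homotopic_unshift[OF cmap_Comp[OF j r] cmap_Ide[OF b] rj] by auto
qed

text \<open>One-sided retracts suffice below, and unlike homotopy equivalences they pass to cones by an
  explicit formula.\<close>

definition retracts_of_approximable :: "('o, 'm) cochain set" where
  "retracts_of_approximable = {C \<in> D. \<exists>C'. approximable C' \<and> hretract C C'}"

text \<open>Approximations ask for invertible arrows of \<open>A\<close>, which homotopy
  equivalences need not respect; the retract clause supplies closure under isomorphism. For cones,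
  first the target and then the source is replaced.\<close>

lemma strict_triangulated_retracts:
  "strict_triangulated_subcat (Kb A) retracts_of_approximable"
proof -
  let ?R = retracts_of_approximable and ?Z = "stalk A (zero_obj A)"
  have b: "bounded_complex A ?Z" by simp
  have z: "is_zero_obj A (deg ?Z k)" for k by (simp add: zero_obj)
  have zz: "is_zero_obj (Kb A) ?Z" using zero_complex_is_zero[OF b z] .
  show ?thesis
  proof (rule strict_triangulatedI)
    show "?Z \<in> ?R"
      using D_zero[OF zz] approximable_of_degrees[OF D_zero[OF zz] z z] hretract_refl[OF b]
      unfolding retracts_of_approximable_def by blast
    show "is_zero_obj (Kb A) ?Z" by (rule zz)
    show "bounded_complex A X" if "X \<in> ?R" for X using that D_bounded unfolding retracts_of_approximable_def by blast
    show "Y \<in> ?R" if "X \<in> ?R" "isomorphic (Kb A) X Y" for X Y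
      using that D_iso isomorphic_hretract[OF isomorphic_sym[OF that(2)]] hretract_trans
      unfolding retracts_of_approximable_def by blast
    show "shift_complex A X \<in> ?R" if "X \<in> ?R" for X
      using that D_shift[OF D_bounded] approximable_shift hretract_shift unfolding retracts_of_approximable_def by blast
    show "unshift_complex X \<in> ?R" if "X \<in> ?R" for X
      using that D_unshift approximable_unshift hretract_unshift unfolding retracts_of_approximable_def by blast
    show "cone A X Y f \<in> ?R" if f: "cmap X Y f" and X: "X \<in> ?R" and Y: "Y \<in> ?R" for X Y f
    proof -
      obtain X' where X': "X \<in> D" "approximable X'" "hretract X X'" using X retracts_of_approximable_def by blast
      obtain Y' where Y': "Y \<in> D" "approximable Y'" "hretract Y Y'" using Y retracts_of_approximable_def by blast
      obtain j r where j: "cmap X X' j" and r: "cmap X' X r" and rj: "homotopic A X X (\<lambda>n. r n \<cdot> j n) (\<lambda>n. Ide A (deg X n))"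
        using X' hretract_def by blast
      obtain j' r' where j': "cmap Y Y' j'" and r': "cmap Y' Y r'" and rj': "homotopic A Y Y (\<lambda>n. r' n \<cdot> j' n) (\<lambda>n. Ide A (deg Y n))"
        using Y' hretract_def by blast
      note jf = cmap_Comp[OF f j']
      have "hretract (cone A X Y f) (cone A X' Y' (\<lambda>n. (j' n \<cdot> f n) \<cdot> r n))"
        using hretract_trans[OF hretract_cone_target[OF f j' r' rj'] hretract_cone_source[OF jf j r rj]] .
      moreover have "approximable (cone A X' Y' (\<lambda>n. (j' n \<cdot> f n) \<cdot> r n))"
        using approximable_cone[OF cmap_Comp[OF r jf] X'(2) Y'(2)] .
      ultimately show ?thesis
        using D_cone[OF f X'(1) Y'(1)] unfolding retracts_of_approximable_def by blast
    qed
  qed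
qed

text \<open>A map from a stalk only involves degrees 0 and 1. It is lifted by the inverse of
  \<open>i\<close> in degree 0, and the lift is seen to be a cycle in degree 1, where
  \<open>i\<close> can be cancelled.\<close>

lemma factor_through_truncation:
  assumes C: "C \<in> retracts_of_approximable" and x: "cmap (stalk A X) C x"
  shows "\<exists>C' x' c. C' \<in> D \<and> (\<forall>k < -1. is_zero_obj A (deg C' k)) \<and> cmap (stalk A X) C' x' \<and> cmap C' C c \<and>
    homotopic A (stalk A X) C (\<lambda>n. c n \<cdot> x' n) x"
proof -
  let ?X = "stalk A X"
  obtain E where E: "approximable E" "hretract C E" using C retracts_of_approximable_def by blast
  obtain j r where j: "cmap C E j" and r: "cmap E C r" and rj: "homotopic A C C (\<lambda>n. r n \<cdot> j n) (\<lambda>n. Ide A (deg C n))"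
    using E hretract_def by blast
  obtain C' i where C': "C' \<in> D" "cmap C' E i" "\<And>k. k < 0 - 1 \<Longrightarrow> is_zero_obj A (deg C' k)" "\<And>k. k \<ge> 0 \<Longrightarrow> iso_arr A (i k)"
    using approximableE[OF E(1)] by metis
  note [simp] = cmap_simps(1-5)[OF x] cmap_simps(1-5)[OF j] cmap_simps(1-5)[OF r] cmap_simps(1-5)[OF C'(2)]
  have X [simp]: "X \<in> Obj A" using bounded_complex_simps(1)[of ?X 0] by simp
  have zX: "is_zero_obj A (deg ?X k)" if "k \<noteq> 0" for k using that by (simp add: zero_obj)
  obtain u where u: "u \<in> Hom A (deg E 0) (deg C' 0)" "i 0 \<cdot> u = Ide A (deg E 0)"
    using C'(4)[of 0] by (auto simp: iso_arr_def)
  obtain v where v: "v \<in> Hom A (deg E 1) (deg C' 1)" "v \<cdot> i 1 = Ide A (deg C' 1)"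
    using C'(4)[of 1] by (auto simp: iso_arr_def)
  note [simp] = HomD[OF u(1)] HomD[OF v(1)]
  define x' where "x' k = (if k = 0 then u \<cdot> (j 0 \<cdot> x 0) else Zero A (deg ?X k) (deg C' k))" for k
  have x'_arr [simp]: "x' k \<in> Arr A" "Dom A (x' k) = deg ?X k" "Cod A (x' k) = deg C' k" for k
    by (auto simp: x'_def simp del: deg_stalk)
  have ix': "i k \<cdot> x' k = j k \<cdot> x k" for k
  proof (cases "k = 0")
    case True
    have "i 0 \<cdot> (u \<cdot> (j 0 \<cdot> x 0)) = (i 0 \<cdot> u) \<cdot> (j 0 \<cdot> x 0)" by simp
    also have "\<dots> = j 0 \<cdot> x 0" by (simp add: u(2))
    finally show ?thesis using True by (simp add: x'_def)
  next
    case False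
    then show ?thesis using zX by (intro from_zero_obj_eq) (simp_all del: deg_stalk)
  qed
  have x': "cmap ?X C' x'"
  proof (rule cmapI)
    fix k
    show "diff C' k \<cdot> x' k = x' (k + 1) \<cdot> diff ?X k"
    proof (cases "k = 0")
      case True
      have "i 1 \<cdot> (diff C' 0 \<cdot> x' 0) = (i (0 + 1) \<cdot> diff C' 0) \<cdot> x' 0" by simp
      also have "\<dots> = diff E 0 \<cdot> (i 0 \<cdot> x' 0)" unfolding cmap_simps(6)[OF C'(2), symmetric] by simp
      also have "\<dots> = diff E 0 \<cdot> (j 0 \<cdot> x 0)" by (simp only: ix')
      also have "\<dots> = (j 1 \<cdot> x 1) \<cdot> diff ?X 0"
        using cmap_simps(6)[OF cmap_Comp[OF x j], of 0] by simp
      also have "\<dots> = Zero A X (deg E 1)" by simp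
      finally have "v \<cdot> (i 1 \<cdot> (diff C' 0 \<cdot> x' 0)) = v \<cdot> Zero A X (deg E 1)" by simp
      moreover have "v \<cdot> (i 1 \<cdot> (diff C' 0 \<cdot> x' 0)) = (v \<cdot> i 1) \<cdot> (diff C' 0 \<cdot> x' 0)" by simp
      ultimately have "diff C' 0 \<cdot> x' 0 = Zero A X (deg C' 1)" using v(2) by simp
      then show ?thesis using True by simp
    next
      case False
      then show ?thesis using zX by (intro from_zero_obj_eq) (simp_all del: deg_stalk)
    qed
  qed simp_all
  have jx: "cmap ?X C (\<lambda>n. r n \<cdot> (j n \<cdot> x n))" using cmap_Comp[OF cmap_Comp[OF x j] r] .
  have "homotopic A ?X C (\<lambda>n. (r n \<cdot> i n) \<cdot> x' n) (\<lambda>n. r n \<cdot> (j n \<cdot> x n))"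
    by (rule homotopic_eqI[OF cmap_Comp[OF x' cmap_Comp[OF C'(2) r]]]) (simp add: ix')
  moreover have "homotopic A ?X C (\<lambda>n. r n \<cdot> (j n \<cdot> x n)) x"
    using homotopic_Comp_right[OF cmap_Comp[OF j r] cmap_Ide x rj] by simp
  ultimately have "homotopic A ?X C (\<lambda>n. (r n \<cdot> i n) \<cdot> x' n) x"
    using homotopic_trans[OF cmap_Comp[OF x' cmap_Comp[OF C'(2) r]] jx x] by blast
  then show ?thesis using C' x' cmap_Comp[OF C'(2) r] by (intro exI[of _ C'] exI[of _ x'] exI[of _ "\<lambda>n. r n \<cdot> i n"]) simp
qed

text \<open>The new apex is the fibre of a map from the stalk to a truncated approximation of the
  cone of \<open>s\<close>. The inclusion of the stalk into that cone factors through this map up to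
  homotopy, so it dies on the fibre and \<open>t\<close> lifts along \<open>s\<close>. The
  truncation starts in degree -1, and the fibre moves it to degree 0.\<close>

lemma refine_roof:
  assumes D: "D \<subseteq> retracts_of_approximable" and s: "cmap W (stalk A X) s" "cone A W (stalk A X) s \<in> D"
  shows "\<exists>U t p. cmap U (stalk A X) t \<and> cone A U (stalk A X) t \<in> D \<and> cmap U W p \<and>
    homotopic A U (stalk A X) (\<lambda>n. s n \<cdot> p n) t \<and> (\<forall>n<0. is_zero_obj A (deg U n))"
proof -
  let ?X = "stalk A X" and ?C = "cone A W (stalk A X) s"
  note i = cmap_cone_in[OF s(1)]
  obtain C' x' c where C': "C' \<in> D" "\<And>k. k < -1 \<Longrightarrow> is_zero_obj A (deg C' k)" "cmap ?X C' x'" "cmap C' ?C c"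
    "homotopic A ?X ?C (\<lambda>n. c n \<cdot> x' n) (\<lambda>n. ci2 W ?X n)"
    using factor_through_truncation[OF _ i] D s(2) by blast
  obtain U t where t: "cmap U ?X t" "cone A U ?X t \<in> D"
    and 0: "homotopic A U C' (\<lambda>n. x' n \<cdot> t n) (\<lambda>n. Zero A (deg U n) (deg C' n))"
    and z: "\<And>n. is_zero_obj A (deg ?X n) \<Longrightarrow> is_zero_obj A (deg C' (n - 1)) \<Longrightarrow> is_zero_obj A (deg U n)"
    using annihilate[OF C'(3,1)] by blast
  note [simp] = cmap_simps(1-5)[OF t(1)] cmap_simps(1-5)[OF C'(3)] cmap_simps(1-5)[OF C'(4)] cmap_simps(1-5)[OF s(1)]
  note it = cmap_Comp[OF t(1) i] and cxt = cmap_Comp[OF cmap_Comp[OF t(1) C'(3)] C'(4)]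
  have 1: "homotopic A U ?C (\<lambda>n. c n \<cdot> (x' n \<cdot> t n)) (\<lambda>n. Zero A (deg U n) (deg ?C n))"
    using homotopic_Comp_left[OF cmap_Comp[OF t(1) C'(3)] cmap_Zero C'(4) 0] by simp
  have 2: "homotopic A U ?C (\<lambda>n. c n \<cdot> (x' n \<cdot> t n)) (\<lambda>n. ci2 W ?X n \<cdot> t n)"
    using homotopic_Comp_right[OF cmap_Comp[OF C'(3,4)] i t(1) C'(5)] by simp
  have "homotopic A U ?C (\<lambda>n. ci2 W ?X n \<cdot> t n) (\<lambda>n. Zero A (deg U n) (deg ?C n))"
    using homotopic_trans[OF it cxt cmap_Zero homotopic_sym[OF cxt it 2] 1] s(1) by simp
  then obtain p where p: "cmap U W p" "homotopic A U ?X (\<lambda>n. s n \<cdot> p n) t"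
    using lift_of_cone_null[OF s(1) t(1)] by blast
  have "is_zero_obj A (deg U n)" if "n < 0" for n
    using z[of n] C'(2)[of "n - 1"] that by (simp add: zero_obj)
  then show ?thesis using t p by blast
qed

end

section \<open>Functors inverting the given arrows\<close>

context additive_functor
begin

abbreviation "Fo \<equiv> on_obj F"
abbreviation "Fm \<equiv> on_arr F"

lemma Fo_Obj [simp]: "X \<in> Obj A \<Longrightarrow> Fo X \<in> Obj B"
  by (rule on_obj_Obj)

lemma Fm_arr [simp]:
  assumes "f \<in> Arr A"
  shows "Fm f \<in> Arr B" "Dom B (Fm f) = Fo (Dom A f)" "Cod B (Fm f) = Fo (Cod A f)"
  using on_arr_Hom[of f "Dom A f" "Cod A f"] assms by (auto simp: Hom_def)

lemma Fm_Comp [simp]: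
  "f \<in> Arr A \<Longrightarrow> g \<in> Arr A \<Longrightarrow> Dom A g = Cod A f \<Longrightarrow> Fm (g \<cdot>\<^bsub>A\<^esub> f) = Fm g \<cdot>\<^bsub>B\<^esub> Fm f"
  using on_arr_Comp[of f "Dom A f" "Cod A f" g "Cod A g"] by (auto simp: Hom_def)

lemma Fm_Add [simp]:
  "f \<in> Arr A \<Longrightarrow> g \<in> Arr A \<Longrightarrow> Dom A f = Dom A g \<Longrightarrow> Cod A f = Cod A g \<Longrightarrow> Fm (f \<boxplus>\<^bsub>A\<^esub> g) = Fm f \<boxplus>\<^bsub>B\<^esub> Fm g"
  using on_arr_Add[of f "Dom A f" "Cod A f" g] by (auto simp: Hom_def)

lemma Fm_Ide [simp]: "X \<in> Obj A \<Longrightarrow> Fm (Ide A X) = Ide B (Fo X)"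
  by (rule on_arr_Ide)

lemma Fm_Zero [simp]:
  assumes "X \<in> Obj A" "Y \<in> Obj A"
  shows "Fm (Zero A X Y) = Zero B (Fo X) (Fo Y)"
proof (rule cod.Add_idem_Zero)
  show "Fm (Zero A X Y) \<boxplus>\<^bsub>B\<^esub> Fm (Zero A X Y) = Fm (Zero A X Y)"
    using assms Fm_Add[of "Zero A X Y" "Zero A X Y"] by simp
qed (use assms on_arr_Hom dom.Zero_Hom in auto)

lemma Fm_neg [simp]:
  assumes "f \<in> Arr A"
  shows "Fm (neg A f) = neg B (Fm f)"
proof (rule cod.Add_eq_Zero_neg)
  show "Fm (neg A f) \<boxplus>\<^bsub>B\<^esub> Fm f = Zero B (Fo (Dom A f)) (Fo (Cod A f))"
    using assms Fm_Add[of "neg A f" f] dom.neg_Add[OF assms refl refl] by (simp del: Fm_Add)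
qed (use assms in \<open>auto simp: Hom_def\<close>)

lemma Fo_zero: "is_zero_obj A Z \<Longrightarrow> is_zero_obj B (Fo Z)"
  unfolding dom.is_zero_obj_iff cod.is_zero_obj_iff using Fm_Ide Fm_Zero Fo_Obj by metis

text \<open>An additive functor preserves the equations of a biproduct, so the images of the
  projections are jointly monic, even if the image is not the biproduct chosen in
  \<open>B\<close>.\<close>

lemma to_image_biproduct_eqI:
  assumes P: "is_biproduct A X Y P" and c: "c \<in> Hom B T (Fo (bsum P))" "c' \<in> Hom B T (Fo (bsum P))"
    and eq: "Fm (pr1 P) \<cdot>\<^bsub>B\<^esub> c = Fm (pr1 P) \<cdot>\<^bsub>B\<^esub> c'" "Fm (pr2 P) \<cdot>\<^bsub>B\<^esub> c = Fm (pr2 P) \<cdot>\<^bsub>B\<^esub> c'"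
  shows "c = c'"
proof -
  let ?Q = "\<lparr>bsum = Fo (bsum P), in1 = Fm (in1 P), in2 = Fm (in2 P), pr1 = Fm (pr1 P), pr2 = Fm (pr2 P)\<rparr>"
  note p = dom.biproduct_simps[OF P]
  have XY: "X \<in> Obj A" "Y \<in> Obj A" using p by auto
  have "is_biproduct B (Fo X) (Fo Y) ?Q"
    unfolding is_biproduct_def biproduct.simps
    using p(1-13) XY p(14-18)[THEN arg_cong[where f=Fm]] by (simp add: Hom_def)
  then show ?thesis using cod.biproduct_to_eqI[of "Fo X" "Fo Y" ?Q c T c'] c eq by simp
qed

section \<open>Complexes made exact by the functor\<close>

text \<open>Exactness of all the complexes of groups \<open>Hom(T, F C)\<close>; it replaces the contractibility of
  \<open>F C\<close>.\<close>

definition F_acyclic :: "('o, 'm) cochain \<Rightarrow> bool" where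
  "F_acyclic C \<longleftrightarrow> bounded_complex A C \<and> (\<forall>T n. \<forall>c \<in> Hom B T (Fo (deg C n)).
     Fm (diff C n) \<cdot>\<^bsub>B\<^esub> c = Zero B T (Fo (deg C (n + 1))) \<longrightarrow>
     (\<exists>b \<in> Hom B T (Fo (deg C (n - 1))). c = Fm (diff C (n - 1)) \<cdot>\<^bsub>B\<^esub> b))"

lemma F_acyclicD:
  assumes "F_acyclic C" "c \<in> Hom B T (Fo (deg C n))" "Fm (diff C n) \<cdot>\<^bsub>B\<^esub> c = Zero B T (Fo (deg C (n + 1)))"
  obtains b where "b \<in> Hom B T (Fo (deg C (n - 1)))" "c = Fm (diff C (n - 1)) \<cdot>\<^bsub>B\<^esub> b"
  using assms unfolding F_acyclic_def by blast

lemma F_acyclic_bounded: "F_acyclic C \<Longrightarrow> bounded_complex A C"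
  unfolding F_acyclic_def by blast

lemma F_acyclicI:
  assumes "bounded_complex A C"
    "\<And>T n c. c \<in> Hom B T (Fo (deg C n)) \<Longrightarrow> Fm (diff C n) \<cdot>\<^bsub>B\<^esub> c = Zero B T (Fo (deg C (n + 1))) \<Longrightarrow>
     \<exists>b. b \<in> Hom B T (Fo (deg C (n - 1))) \<and> c = Fm (diff C (n - 1)) \<cdot>\<^bsub>B\<^esub> b"
  shows "F_acyclic C"
  using assms unfolding F_acyclic_def by blast

lemma neg_Zero_iff:
  assumes "f \<in> Arr B" "Dom B f = X" "Cod B f = Y"
  shows "neg B f = Zero B X Y \<longleftrightarrow> f = Zero B X Y"
proof -
  have "X \<in> Obj B" "Y \<in> Obj B" using assms by auto
  then show ?thesis using cod.neg_neg[OF assms] cod.neg_Zero by metis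
qed

lemma F_acyclic_shift:
  assumes C: "F_acyclic C"
  shows "F_acyclic (shift_complex A C)"
proof (rule F_acyclicI)
  have b [simp]: "bounded_complex A C" using C by (simp add: F_acyclic_def)
  show "bounded_complex A (shift_complex A C)" by simp
  fix T n c assume c: "c \<in> Hom B T (Fo (deg (shift_complex A C) n))"
    and z: "Fm (diff (shift_complex A C) n) \<cdot>\<^bsub>B\<^esub> c = Zero B T (Fo (deg (shift_complex A C) (n + 1)))"
  note [simp] = cod.HomD[OF c]
  have "Fm (diff C (n + 1)) \<cdot>\<^bsub>B\<^esub> c = Zero B T (Fo (deg C (n + 1 + 1)))"
    using z by (simp add: neg_Zero_iff)
  then obtain d where d: "d \<in> Hom B T (Fo (deg C (n + 1 - 1)))" "c = Fm (diff C (n + 1 - 1)) \<cdot>\<^bsub>B\<^esub> d"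
    using F_acyclicD[OF C, of c T "n + 1"] c by auto
  note [simp] = cod.HomD[OF d(1)]
  show "\<exists>b. b \<in> Hom B T (Fo (deg (shift_complex A C) (n - 1))) \<and> c = Fm (diff (shift_complex A C) (n - 1)) \<cdot>\<^bsub>B\<^esub> b"
    by (intro exI[of _ "neg B d"]) (use d in \<open>simp add: Hom_def\<close>)
qed

lemma F_acyclic_unshift:
  assumes C: "F_acyclic C"
  shows "F_acyclic (dom.unshift_complex C)"
proof (rule F_acyclicI)
  have b [simp]: "bounded_complex A C" using C by (simp add: F_acyclic_def)
  show "bounded_complex A (dom.unshift_complex C)" by simp
  fix T n c assume c: "c \<in> Hom B T (Fo (deg (dom.unshift_complex C) n))"
    and z: "Fm (diff (dom.unshift_complex C) n) \<cdot>\<^bsub>B\<^esub> c = Zero B T (Fo (deg (dom.unshift_complex C) (n + 1)))"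
  note [simp] = cod.HomD[OF c]
  have "Fm (diff C (n - 1)) \<cdot>\<^bsub>B\<^esub> c = Zero B T (Fo (deg C (n - 1 + 1)))"
    using z by (simp add: neg_Zero_iff)
  then obtain d where d: "d \<in> Hom B T (Fo (deg C (n - 1 - 1)))" "c = Fm (diff C (n - 1 - 1)) \<cdot>\<^bsub>B\<^esub> d"
    using F_acyclicD[OF C, of c T "n - 1"] c by auto
  note [simp] = cod.HomD[OF d(1)]
  have [simp]: "Cod A (diff C (n - 1 - 1)) = deg C (n - 1)" using dom.bounded_complex_simps(4)[OF b, of "n - 1 - 1"] by simp
  show "\<exists>b. b \<in> Hom B T (Fo (deg (dom.unshift_complex C) (n - 1))) \<and> c = Fm (diff (dom.unshift_complex C) (n - 1)) \<cdot>\<^bsub>B\<^esub> b"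
    by (intro exI[of _ "neg B d"]) (use d in \<open>simp add: Hom_def\<close>)
qed

text \<open>Up to the boundary of \<open>h c\<close>, a cycle \<open>c\<close> equals
  \<open>a b c\<close>. Here \<open>b c\<close> is a cycle for \<open>C\<close>, hence a boundary,
  and \<open>a\<close> carries boundaries to boundaries.\<close>

lemma F_acyclic_iso:
  assumes C: "F_acyclic C" and iso: "isomorphic (Kb A) C C'"
  shows "F_acyclic C'"
proof (rule F_acyclicI)
  obtain a b where ab: "dom.heq C C' a b" using iso dom.isomorphic_Kb by blast
  then have a: "dom.cmap C C' a" and b: "dom.cmap C' C b"
    and h': "homotopic A C' C' (\<lambda>n. a n \<cdot>\<^bsub>A\<^esub> b n) (\<lambda>n. Ide A (deg C' n))" by (simp_all add: dom.heq_def)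
  obtain h where h: "dom.hmap C' C' h" "\<And>n. a n \<cdot>\<^bsub>A\<^esub> b n = Ide A (deg C' n) \<boxplus>\<^bsub>A\<^esub>
      ((diff C' (n - 1) \<cdot>\<^bsub>A\<^esub> h n) \<boxplus>\<^bsub>A\<^esub> (h (n + 1) \<cdot>\<^bsub>A\<^esub> diff C' n))"
    using h' unfolding dom.homotopic_iff by blast
  note [simp] = dom.cmap_simps(1-5)[OF a] dom.cmap_simps(1-5)[OF b] dom.hmap_simps[OF h(1)]
  show "bounded_complex A C'" by simp
  fix T n c assume c: "c \<in> Hom B T (Fo (deg C' n))"
    and z: "Fm (diff C' n) \<cdot>\<^bsub>B\<^esub> c = Zero B T (Fo (deg C' (n + 1)))"
  note [simp] = cod.HomD[OF c] z
  have T [simp]: "T \<in> Obj B" using cod.Hom_Obj[OF c] by blast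
  have bd: "Fm (diff C n) \<cdot>\<^bsub>B\<^esub> Fm (b n) = Fm (b (n + 1)) \<cdot>\<^bsub>B\<^esub> Fm (diff C' n)"
    using dom.cmap_simps(6)[OF b, THEN arg_cong[where f=Fm], of n] by simp
  have "Fm (diff C n) \<cdot>\<^bsub>B\<^esub> (Fm (b n) \<cdot>\<^bsub>B\<^esub> c) = Zero B T (Fo (deg C (n + 1)))"
    by (subst cod.Comp_rewrite[OF bd]) simp_all
  then obtain e where e: "e \<in> Hom B T (Fo (deg C (n - 1)))" "Fm (b n) \<cdot>\<^bsub>B\<^esub> c = Fm (diff C (n - 1)) \<cdot>\<^bsub>B\<^esub> e"
    using F_acyclicD[OF C, of "Fm (b n) \<cdot>\<^bsub>B\<^esub> c" T n] by (auto simp: Hom_def)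
  note [simp] = cod.HomD[OF e(1)]
  have ad: "Fm (diff C' (n - 1)) \<cdot>\<^bsub>B\<^esub> Fm (a (n - 1)) = Fm (a n) \<cdot>\<^bsub>B\<^esub> Fm (diff C (n - 1))"
    using dom.cmap_simps(6)[OF a, THEN arg_cong[where f=Fm], of "n - 1"] by simp
  have "Fm (a n \<cdot>\<^bsub>A\<^esub> b n) \<cdot>\<^bsub>B\<^esub> c = c \<boxplus>\<^bsub>B\<^esub> (Fm (diff C' (n - 1)) \<cdot>\<^bsub>B\<^esub> (Fm (h n) \<cdot>\<^bsub>B\<^esub> c))"
    unfolding h(2) by simp
  moreover have "Fm (a n \<cdot>\<^bsub>A\<^esub> b n) \<cdot>\<^bsub>B\<^esub> c = Fm (diff C' (n - 1)) \<cdot>\<^bsub>B\<^esub> (Fm (a (n - 1)) \<cdot>\<^bsub>B\<^esub> e)"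
    using cod.Comp_rewrite[OF ad, of e] by (simp add: e(2))
  ultimately have "c \<boxplus>\<^bsub>B\<^esub> (Fm (diff C' (n - 1)) \<cdot>\<^bsub>B\<^esub> (Fm (h n) \<cdot>\<^bsub>B\<^esub> c)) = Fm (diff C' (n - 1)) \<cdot>\<^bsub>B\<^esub> (Fm (a (n - 1)) \<cdot>\<^bsub>B\<^esub> e)"
    by simp
  moreover have "c = (c \<boxplus>\<^bsub>B\<^esub> (Fm (diff C' (n - 1)) \<cdot>\<^bsub>B\<^esub> (Fm (h n) \<cdot>\<^bsub>B\<^esub> c))) \<boxplus>\<^bsub>B\<^esub>
      neg B (Fm (diff C' (n - 1)) \<cdot>\<^bsub>B\<^esub> (Fm (h n) \<cdot>\<^bsub>B\<^esub> c))"
    by (rule cod.lin_eqI, ((rule cod.lin_intros cod.HomI) | simp)+)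
  ultimately have "c = Fm (diff C' (n - 1)) \<cdot>\<^bsub>B\<^esub> ((Fm (a (n - 1)) \<cdot>\<^bsub>B\<^esub> e) \<boxplus>\<^bsub>B\<^esub> neg B (Fm (h n) \<cdot>\<^bsub>B\<^esub> c))"
    by simp
  then show "\<exists>b. b \<in> Hom B T (Fo (deg C' (n - 1))) \<and> c = Fm (diff C' (n - 1)) \<cdot>\<^bsub>B\<^esub> b"
    by (intro exI[of _ "(Fm (a (n - 1)) \<cdot>\<^bsub>B\<^esub> e) \<boxplus>\<^bsub>B\<^esub> neg B (Fm (h n) \<cdot>\<^bsub>B\<^esub> c)"]) (simp add: Hom_def)
qed

text \<open>The component \<open>x\<close> of a cycle is a cycle for \<open>X\<close>, so it is the
  boundary of some \<open>u\<close>. Then \<open>f u + y\<close> is a cycle for \<open>Y\<close>, so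
  it is the boundary of some \<open>v\<close>. The pair \<open>(- u, v)\<close> has the given cycle
  as boundary.\<close>

lemma F_acyclic_cone:
  assumes f: "dom.cmap X Y f" and X: "F_acyclic X" and Y: "F_acyclic Y"
  shows "F_acyclic (cone A X Y f)"
proof (rule F_acyclicI)
  note [simp] = dom.cmap_simps(1-5)[OF f] dom.diff_cone(1-3)[OF f] f
  let ?C = "cone A X Y f"
  let ?p = "\<lambda>n. pr1 (cone_biprod A X Y n)" and ?q = "\<lambda>n. pr2 (cone_biprod A X Y n)"
  let ?i = "\<lambda>n. in1 (cone_biprod A X Y n)" and ?j = "\<lambda>n. in2 (cone_biprod A X Y n)"
  show "bounded_complex A ?C" by simp
  fix T n c assume c: "c \<in> Hom B T (Fo (deg ?C n))"
    and z: "Fm (diff ?C n) \<cdot>\<^bsub>B\<^esub> c = Zero B T (Fo (deg ?C (n + 1)))"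
  note [simp] = cod.HomD[OF c]
  have T [simp]: "T \<in> Obj B" using cod.Hom_Obj[OF c] by blast
  have dp: "Fm (?p (n + 1)) \<cdot>\<^bsub>B\<^esub> Fm (diff ?C n) = neg B (Fm (diff X (n + 1)) \<cdot>\<^bsub>B\<^esub> Fm (?p n))"
    using dom.diff_cone(6)[OF f, of "n + 1" n, THEN arg_cong[where f=Fm]] by simp
  have dq: "Fm (?q (n + 1)) \<cdot>\<^bsub>B\<^esub> Fm (diff ?C n) = (Fm (f (n + 1)) \<cdot>\<^bsub>B\<^esub> Fm (?p n)) \<boxplus>\<^bsub>B\<^esub> (Fm (diff Y n) \<cdot>\<^bsub>B\<^esub> Fm (?q n))"
    using dom.diff_cone(7)[OF f, of "n + 1" n, THEN arg_cong[where f=Fm]] by simp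
  define x where "x = Fm (?p n) \<cdot>\<^bsub>B\<^esub> c"
  define y where "y = Fm (?q n) \<cdot>\<^bsub>B\<^esub> c"
  have [simp]: "x \<in> Arr B" "Dom B x = T" "Cod B x = Fo (deg X (n + 1))" "y \<in> Arr B" "Dom B y = T" "Cod B y = Fo (deg Y n)"
    by (simp_all add: x_def y_def)
  have "neg B (Fm (diff X (n + 1)) \<cdot>\<^bsub>B\<^esub> x) = Fm (?p (n + 1)) \<cdot>\<^bsub>B\<^esub> (Fm (diff ?C n) \<cdot>\<^bsub>B\<^esub> c)"
    by (subst cod.Comp_rewrite[OF dp]) (simp_all add: x_def)
  then have "Fm (diff X (n + 1)) \<cdot>\<^bsub>B\<^esub> x = Zero B T (Fo (deg X (n + 1 + 1)))"
    using z by (simp add: neg_Zero_iff)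
  then obtain u where u: "u \<in> Hom B T (Fo (deg X n))" "x = Fm (diff X n) \<cdot>\<^bsub>B\<^esub> u"
    using F_acyclicD[OF X, of x T "n + 1"] by (auto simp: Hom_def)
  note [simp] = cod.HomD[OF u(1)]
  have "(Fm (f (n + 1)) \<cdot>\<^bsub>B\<^esub> x) \<boxplus>\<^bsub>B\<^esub> (Fm (diff Y n) \<cdot>\<^bsub>B\<^esub> y) = Fm (?q (n + 1)) \<cdot>\<^bsub>B\<^esub> (Fm (diff ?C n) \<cdot>\<^bsub>B\<^esub> c)"
    by (subst cod.Comp_rewrite[OF dq]) (simp_all add: x_def y_def)
  then have y0: "(Fm (f (n + 1)) \<cdot>\<^bsub>B\<^esub> (Fm (diff X n) \<cdot>\<^bsub>B\<^esub> u)) \<boxplus>\<^bsub>B\<^esub> (Fm (diff Y n) \<cdot>\<^bsub>B\<^esub> y) = Zero B T (Fo (deg Y (n + 1)))"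
    using z by (simp add: u(2))
  have fd: "Fm (diff Y n) \<cdot>\<^bsub>B\<^esub> Fm (f n) = Fm (f (n + 1)) \<cdot>\<^bsub>B\<^esub> Fm (diff X n)"
    using dom.cmap_simps(6)[OF f, THEN arg_cong[where f=Fm], of n] by simp
  have "Fm (diff Y n) \<cdot>\<^bsub>B\<^esub> ((Fm (f n) \<cdot>\<^bsub>B\<^esub> u) \<boxplus>\<^bsub>B\<^esub> y) = Zero B T (Fo (deg Y (n + 1)))"
    using y0 cod.Comp_rewrite[OF fd, of u] by simp
  then obtain v where v: "v \<in> Hom B T (Fo (deg Y (n - 1)))" "(Fm (f n) \<cdot>\<^bsub>B\<^esub> u) \<boxplus>\<^bsub>B\<^esub> y = Fm (diff Y (n - 1)) \<cdot>\<^bsub>B\<^esub> v"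
    using F_acyclicD[OF Y, of "(Fm (f n) \<cdot>\<^bsub>B\<^esub> u) \<boxplus>\<^bsub>B\<^esub> y" T n] by (auto simp: Hom_def)
  note [simp] = cod.HomD[OF v(1)]
  define b where "b = neg B (Fm (?i (n - 1)) \<cdot>\<^bsub>B\<^esub> u) \<boxplus>\<^bsub>B\<^esub> (Fm (?j (n - 1)) \<cdot>\<^bsub>B\<^esub> v)"
  note bp [simp] = dom.cone_biprod_simps[of X Y "n - 1", simplified]
  have b: "b \<in> Hom B T (Fo (deg ?C (n - 1)))" by (simp add: b_def Hom_def)
  have di: "Fm (diff ?C (n - 1)) \<cdot>\<^bsub>B\<^esub> Fm (?i (n - 1)) = neg B (Fm (?i n) \<cdot>\<^bsub>B\<^esub> Fm (diff X n)) \<boxplus>\<^bsub>B\<^esub> (Fm (?j n) \<cdot>\<^bsub>B\<^esub> Fm (f n))"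
    using dom.diff_cone(4)[OF f, of "n - 1", THEN arg_cong[where f=Fm]] by simp
  have dj: "Fm (diff ?C (n - 1)) \<cdot>\<^bsub>B\<^esub> Fm (?j (n - 1)) = Fm (?j n) \<cdot>\<^bsub>B\<^esub> Fm (diff Y (n - 1))"
    using dom.diff_cone(5)[OF f, of "n - 1", THEN arg_cong[where f=Fm]] by simp
  have db: "Fm (diff ?C (n - 1)) \<cdot>\<^bsub>B\<^esub> b = (Fm (?i n) \<cdot>\<^bsub>B\<^esub> x) \<boxplus>\<^bsub>B\<^esub> (Fm (?j n) \<cdot>\<^bsub>B\<^esub> y)"
  proof -
    have "Fm (diff ?C (n - 1)) \<cdot>\<^bsub>B\<^esub> b = ((Fm (?i n) \<cdot>\<^bsub>B\<^esub> x) \<boxplus>\<^bsub>B\<^esub> neg B (Fm (?j n) \<cdot>\<^bsub>B\<^esub> (Fm (f n) \<cdot>\<^bsub>B\<^esub> u)))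
        \<boxplus>\<^bsub>B\<^esub> (Fm (?j n) \<cdot>\<^bsub>B\<^esub> (Fm (diff Y (n - 1)) \<cdot>\<^bsub>B\<^esub> v))"
      using cod.Comp_rewrite[OF di, of u] cod.Comp_rewrite[OF dj, of v] by (simp add: b_def u(2))
    also have "\<dots> = (Fm (?i n) \<cdot>\<^bsub>B\<^esub> x) \<boxplus>\<^bsub>B\<^esub> (Fm (?j n) \<cdot>\<^bsub>B\<^esub> y)"
      unfolding v(2)[symmetric] by simp (rule cod.lin_eqI, ((rule cod.lin_intros cod.HomI) | simp)+)
    finally show ?thesis .
  qed
  have pi: "Fm (?p n) \<cdot>\<^bsub>B\<^esub> Fm (?i n) = Ide B (Fo (deg X (n + 1)))" "Fm (?q n) \<cdot>\<^bsub>B\<^esub> Fm (?j n) = Ide B (Fo (deg Y n))"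
      "Fm (?p n) \<cdot>\<^bsub>B\<^esub> Fm (?j n) = Zero B (Fo (deg Y n)) (Fo (deg X (n + 1)))"
      "Fm (?q n) \<cdot>\<^bsub>B\<^esub> Fm (?i n) = Zero B (Fo (deg X (n + 1))) (Fo (deg Y n))"
    by (simp_all flip: Fm_Comp)
  have "c = (Fm (?i n) \<cdot>\<^bsub>B\<^esub> x) \<boxplus>\<^bsub>B\<^esub> (Fm (?j n) \<cdot>\<^bsub>B\<^esub> y)"
  proof (rule to_image_biproduct_eqI[OF dom.cone_biprod[of X Y n]])
    show "Fm (?p n) \<cdot>\<^bsub>B\<^esub> c = Fm (?p n) \<cdot>\<^bsub>B\<^esub> ((Fm (?i n) \<cdot>\<^bsub>B\<^esub> x) \<boxplus>\<^bsub>B\<^esub> (Fm (?j n) \<cdot>\<^bsub>B\<^esub> y))"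
      using cod.Comp_rewrite[OF pi(1), of x] cod.Comp_rewrite[OF pi(3), of y] by (simp flip: x_def)
    show "Fm (?q n) \<cdot>\<^bsub>B\<^esub> c = Fm (?q n) \<cdot>\<^bsub>B\<^esub> ((Fm (?i n) \<cdot>\<^bsub>B\<^esub> x) \<boxplus>\<^bsub>B\<^esub> (Fm (?j n) \<cdot>\<^bsub>B\<^esub> y))"
      using cod.Comp_rewrite[OF pi(2), of y] cod.Comp_rewrite[OF pi(4), of x] by (simp flip: y_def)
  qed (simp_all add: Hom_def)
  then show "\<exists>b. b \<in> Hom B T (Fo (deg ?C (n - 1))) \<and> c = Fm (diff ?C (n - 1)) \<cdot>\<^bsub>B\<^esub> b"
    using b db by auto
qed

lemma F_acyclic_zero:
  assumes "bounded_complex A C" "\<And>n. is_zero_obj A (deg C n)"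
  shows "F_acyclic C"
proof (rule F_acyclicI[OF assms(1)])
  fix T n c assume c: "c \<in> Hom B T (Fo (deg C n))"
  note [simp] = cod.HomD[OF c] assms(1)
  have [simp]: "T \<in> Obj B" using cod.Hom_Obj[OF c] by blast
  have "c = Zero B T (Fo (deg C n))" using cod.to_zero_obj[of c] Fo_zero[OF assms(2)] by simp
  then show "\<exists>b. b \<in> Hom B T (Fo (deg C (n - 1))) \<and> c = Fm (diff C (n - 1)) \<cdot>\<^bsub>B\<^esub> b"
    by (intro exI[of _ "Zero B T (Fo (deg C (n - 1)))"]) (simp add: Hom_def)
qed

lemma strict_triangulated_F_acyclic: "strict_triangulated_subcat (Kb A) (Collect F_acyclic)"
proof (rule dom.strict_triangulatedI)
  let ?Z = "stalk A (zero_obj A)"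
  have b: "bounded_complex A ?Z" by simp
  have z: "is_zero_obj A (deg ?Z k)" for k by (simp add: dom.zero_obj)
  show "?Z \<in> Collect F_acyclic" using F_acyclic_zero[OF b z] by simp
  show "is_zero_obj (Kb A) ?Z" using dom.zero_complex_is_zero[OF b z] .
qed (use F_acyclic_shift F_acyclic_unshift F_acyclic_iso F_acyclic_cone F_acyclic_bounded in blast)+

text \<open>Invertibility of \<open>F s\<close> enters here: a left inverse shows that cycles in
  degree -1 vanish, and a right inverse makes every element of degree 0 a boundary.\<close>

lemma F_acyclic_arrow_cone:
  assumes s: "s \<in> Arr A" and iso: "iso_arr B (Fm s)"
  shows "F_acyclic (arrow_cone A s)"
proof (rule F_acyclicI)
  note [simp] = s
  obtain r where r: "r \<in> Hom B (Fo (Cod A s)) (Fo (Dom A s))" "r \<cdot>\<^bsub>B\<^esub> Fm s = Ide B (Fo (Dom A s))"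
      "Fm s \<cdot>\<^bsub>B\<^esub> r = Ide B (Fo (Cod A s))"
    using iso by (auto simp: iso_arr_def)
  note [simp] = cod.HomD[OF r(1)]
  let ?K = "arrow_cone A s"
  show "bounded_complex A ?K" by simp
  fix T and n :: int and c assume c: "c \<in> Hom B T (Fo (deg ?K n))"
    and z: "Fm (diff ?K n) \<cdot>\<^bsub>B\<^esub> c = Zero B T (Fo (deg ?K (n + 1)))"
  have cA [simp]: "c \<in> Arr B" "Dom B c = T" and cC: "Cod B c = Fo (deg ?K n)" using cod.HomD[OF c] by auto
  have [simp]: "T \<in> Obj B" using cod.Hom_Obj[OF c] by blast
  consider "n = -1" | "n = 0" | "n \<noteq> -1" "n \<noteq> 0" by blast
  then show "\<exists>b. b \<in> Hom B T (Fo (deg ?K (n - 1))) \<and> c = Fm (diff ?K (n - 1)) \<cdot>\<^bsub>B\<^esub> b"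
  proof cases
    case 1
    then have [simp]: "Cod B c = Fo (Dom A s)" using cC by simp
    have "c = (r \<cdot>\<^bsub>B\<^esub> Fm s) \<cdot>\<^bsub>B\<^esub> c" by (simp add: r(2))
    also have "\<dots> = r \<cdot>\<^bsub>B\<^esub> (Fm s \<cdot>\<^bsub>B\<^esub> c)" by simp
    also have "\<dots> = Zero B T (Fo (Dom A s))" using z 1 by simp
    finally have "c = Zero B T (Fo (Dom A s))" .
    then show ?thesis using 1 by (intro exI[of _ "Zero B T (Fo (zero_obj A))"]) (simp add: Hom_def)
  next
    case 2
    then have [simp]: "Cod B c = Fo (Cod A s)" using cC by simp
    have "c = (Fm s \<cdot>\<^bsub>B\<^esub> r) \<cdot>\<^bsub>B\<^esub> c" by (simp add: r(3))
    also have "\<dots> = Fm s \<cdot>\<^bsub>B\<^esub> (r \<cdot>\<^bsub>B\<^esub> c)" by simp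
    finally show ?thesis using 2 by (intro exI[of _ "r \<cdot>\<^bsub>B\<^esub> c"]) (simp add: Hom_def)
  next
    case 3
    then have [simp]: "Cod B c = Fo (zero_obj A)" using cC by simp
    have "c = Zero B T (Fo (zero_obj A))" using cod.to_zero_obj[of c] Fo_zero[OF dom.zero_obj] by simp
    then show ?thesis using 3 by (intro exI[of _ "Zero B T (Fo (deg ?K (n - 1)))"]) (auto simp: Hom_def)
  qed
qed

end

section \<open>The universal property\<close>

locale inverting_functor = triangulated_subcategory A D + additive_functor A B F
  for A :: "('o, 'm, 'y) additive_cat_scheme" (structure) and B :: "('p, 'n, 'z) additive_cat_scheme"
    and F :: "('o, 'm, 'p, 'n) functor_data" and D :: "('o, 'm) cochain set" +
  assumes D_acyclic: "D \<subseteq> Collect F_acyclic"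
begin

text \<open>A generalized element, defined over \<open>T\<close>, of the kernel of the differential
  of \<open>F W\<close> in degree 0; the kernel itself need not exist in \<open>B\<close>.\<close>

definition cycle :: "('o, 'm) cochain \<Rightarrow> 'p \<Rightarrow> 'n \<Rightarrow> bool" where
  "cycle W T q \<longleftrightarrow> q \<in> Hom B T (Fo (deg W 0)) \<and> Fm (diff W 0) \<cdot>\<^bsub>B\<^esub> q = Zero B T (Fo (deg W 1))"

text \<open>The inclusion of \<open>X\<close> in degree 0 is a cycle for the cone, hence the
  boundary of some \<open>b\<close>. The components of this equation say that the \<open>W\<close>
  component of \<open>b\<close> is a cycle and is sent to the identity by \<open>s\<close>.\<close>

lemma section_exists:
  assumes X: "X \<in> Obj A" and s: "cmap W (stalk A X) s" and ac: "F_acyclic (cone A W (stalk A X) s)"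
  shows "\<exists>q. cycle W (Fo X) q \<and> Fm (s 0) \<cdot>\<^bsub>B\<^esub> q = Ide B (Fo X)"
proof -
  let ?X = "stalk A X"
  let ?C = "cone A W ?X s"
  note [simp] = X cmap_simps(1-5)[OF s] diff_cone(1-3)[OF s] s
  note bp = cone_biprod_simps[of W ?X 0, simplified] cone_biprod_simps[of W ?X "-1", simplified]
  let ?c = "Fm (ci2 W ?X 0)"
  have c: "?c \<in> Hom B (Fo X) (Fo (deg ?C 0))" using bp by (simp add: Hom_def)
  have "Fm (diff ?C 0 \<cdot> ci2 W ?X 0) = Fm (ci2 W ?X 1 \<cdot> diff ?X 0)"
    using diff_cone(5)[OF s, of 0] by simp
  also have "\<dots> = Zero B (Fo X) (Fo (deg ?C (0 + 1)))"
    using cone_biprod_simps[of W ?X 1] by simp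
  finally have "Fm (diff ?C 0) \<cdot>\<^bsub>B\<^esub> ?c = Zero B (Fo X) (Fo (deg ?C (0 + 1)))"
    using bp by (simp del: deg_cone)
  then obtain b where b: "b \<in> Hom B (Fo X) (Fo (deg ?C (-1)))" "?c = Fm (diff ?C (-1)) \<cdot>\<^bsub>B\<^esub> b"
    using F_acyclicD[OF ac c] by auto
  note [simp] = cod.HomD[OF b(1)]
  let ?q = "Fm (cp1 W ?X (-1)) \<cdot>\<^bsub>B\<^esub> b"
  have q: "?q \<in> Hom B (Fo X) (Fo (deg W 0))" using bp by (simp add: Hom_def)
  have "cp1 W ?X 0 \<cdot> diff ?C (-1) = neg A (diff W 0 \<cdot> cp1 W ?X (-1))"
    using diff_cone(6)[OF s, of 0 "-1"] by simp
  from arg_cong[OF this, of Fm]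
  have 1: "Fm (cp1 W ?X 0) \<cdot>\<^bsub>B\<^esub> Fm (diff ?C (-1)) = neg B (Fm (diff W 0) \<cdot>\<^bsub>B\<^esub> Fm (cp1 W ?X (-1)))"
    using bp by simp
  have "cp2 W ?X 0 \<cdot> diff ?C (-1) = s 0 \<cdot> cp1 W ?X (-1)"
    using diff_cone(7)[OF s, of 0 "-1"] bp by simp
  from arg_cong[OF this, of Fm]
  have 2: "Fm (cp2 W ?X 0) \<cdot>\<^bsub>B\<^esub> Fm (diff ?C (-1)) = Fm (s 0) \<cdot>\<^bsub>B\<^esub> Fm (cp1 W ?X (-1))"
    using bp by simp
  have "neg B (Fm (diff W 0) \<cdot>\<^bsub>B\<^esub> ?q) = Fm (cp1 W ?X 0) \<cdot>\<^bsub>B\<^esub> ?c"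
    unfolding b(2) by (subst cod.Comp_rewrite[OF 1]) (use bp in simp_all)
  also have "\<dots> = Zero B (Fo X) (Fo (deg W 1))" using bp by (simp flip: Fm_Comp)
  finally have "Fm (diff W 0) \<cdot>\<^bsub>B\<^esub> ?q = Zero B (Fo X) (Fo (deg W 1))"
    using bp by (subst (asm) neg_Zero_iff) simp_all
  moreover have "Fm (s 0) \<cdot>\<^bsub>B\<^esub> ?q = Fm (cp2 W ?X 0) \<cdot>\<^bsub>B\<^esub> ?c"
    unfolding b(2) by (subst cod.Comp_rewrite[OF 2]) (use bp in simp_all)
  moreover have "Fm (cp2 W ?X 0) \<cdot>\<^bsub>B\<^esub> ?c = Ide B (Fo X)" using bp by (simp flip: Fm_Comp)
  ultimately show ?thesis using q unfolding cycle_def by auto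
qed

text \<open>Because \<open>s\<close> kills \<open>q\<close>, the element with \<open>W\<close>
  component \<open>q\<close> and no \<open>X\<close> component is a cycle of the cone in degree -1.
  The \<open>W\<close> component of an element bounding it bounds \<open>q\<close> up to
  sign.\<close>

lemma cycle_boundary:
  assumes X: "X \<in> Obj A" and s: "cmap W (stalk A X) s" and ac: "F_acyclic (cone A W (stalk A X) s)"
    and q: "cycle W T q" and sq: "Fm (s 0) \<cdot>\<^bsub>B\<^esub> q = Zero B T (Fo X)"
  shows "\<exists>h \<in> Hom B T (Fo (deg W (-1))). q = Fm (diff W (-1)) \<cdot>\<^bsub>B\<^esub> h"
proof -
  let ?X = "stalk A X"
  let ?C = "cone A W ?X s"
  note [simp] = X cmap_simps(1-5)[OF s] diff_cone(1-3)[OF s] s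
  note bp = cone_biprod_simps[of W ?X 0, simplified] cone_biprod_simps[of W ?X "-1", simplified] cone_biprod_simps[of W ?X "-2", simplified]
  have q': "q \<in> Hom B T (Fo (deg W 0))" "Fm (diff W 0) \<cdot>\<^bsub>B\<^esub> q = Zero B T (Fo (deg W 1))"
    using q by (simp_all add: cycle_def)
  note [simp] = cod.HomD[OF q'(1)]
  have [simp]: "T \<in> Obj B" using cod.Hom_Obj[OF q'(1)] by blast
  let ?c = "Fm (ci1 W ?X (-1)) \<cdot>\<^bsub>B\<^esub> q"
  have c: "?c \<in> Hom B T (Fo (deg ?C (-1)))" using bp by (simp add: Hom_def)
  have "diff ?C (-1) \<cdot> ci1 W ?X (-1) = neg A (ci1 W ?X 0 \<cdot> diff W 0) \<boxplus> (ci2 W ?X 0 \<cdot> s 0)"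
    using diff_cone(4)[OF s, of "-1"] by simp
  from arg_cong[OF this, of Fm]
  have 1: "Fm (diff ?C (-1)) \<cdot>\<^bsub>B\<^esub> Fm (ci1 W ?X (-1)) =
      neg B (Fm (ci1 W ?X 0) \<cdot>\<^bsub>B\<^esub> Fm (diff W 0)) \<boxplus>\<^bsub>B\<^esub> (Fm (ci2 W ?X 0) \<cdot>\<^bsub>B\<^esub> Fm (s 0))"
    using bp by simp
  have "Fm (diff ?C (-1)) \<cdot>\<^bsub>B\<^esub> ?c = Zero B T (Fo (deg ?C (-1 + 1)))"
    by (subst cod.Comp_rewrite[OF 1]) (use bp in \<open>simp_all add: q'(2) sq\<close>)
  then obtain b where b: "b \<in> Hom B T (Fo (deg ?C (-2)))" "?c = Fm (diff ?C (-2)) \<cdot>\<^bsub>B\<^esub> b"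
    using F_acyclicD[OF ac c] by auto
  note [simp] = cod.HomD[OF b(1)]
  have [simp]: "Cod A (diff ?C (-2)) = bsum (cone_biprod A W ?X (-1))" "Cod A (diff W (-1)) = deg W 0"
    using diff_cone(3)[OF s, of "-2"] bounded_complex_simps(4)[of W "-1"] by simp_all
  have "cp1 W ?X (-1) \<cdot> diff ?C (-2) = neg A (diff W (-1) \<cdot> cp1 W ?X (-2))"
    using diff_cone(6)[OF s, of "-1" "-2"] by simp
  from arg_cong[OF this, of Fm]
  have 2: "Fm (cp1 W ?X (-1)) \<cdot>\<^bsub>B\<^esub> Fm (diff ?C (-2)) = neg B (Fm (diff W (-1)) \<cdot>\<^bsub>B\<^esub> Fm (cp1 W ?X (-2)))"
    using bp by simp
  have 3: "Fm (cp1 W ?X (-1)) \<cdot>\<^bsub>B\<^esub> Fm (ci1 W ?X (-1)) = Ide B (Fo (deg W 0))"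
    using bp by (simp flip: Fm_Comp)
  have "q = Fm (cp1 W ?X (-1)) \<cdot>\<^bsub>B\<^esub> ?c"
    by (subst cod.Comp_rewrite[OF 3]) (use bp in simp_all)
  also have "\<dots> = neg B (Fm (diff W (-1)) \<cdot>\<^bsub>B\<^esub> Fm (cp1 W ?X (-2))) \<cdot>\<^bsub>B\<^esub> b"
    unfolding b(2) by (subst cod.Comp_rewrite[OF 2]) (use bp in simp_all)
  also have "\<dots> = Fm (diff W (-1)) \<cdot>\<^bsub>B\<^esub> neg B (Fm (cp1 W ?X (-2)) \<cdot>\<^bsub>B\<^esub> b)"
    using bp by simp
  finally show ?thesis using bp by (intro bexI[of _ "neg B (Fm (cp1 W ?X (-2)) \<cdot>\<^bsub>B\<^esub> b)"]) (auto simp: Hom_def)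
qed

text \<open>Two lifts with the same image under \<open>s\<close> differ by a boundary, and
  \<open>f\<close> kills boundaries because the differentials of a stalk are zero.\<close>

lemma cycle_eq:
  assumes X: "X \<in> Obj A" and s: "cmap W (stalk A X) s" and ac: "F_acyclic (cone A W (stalk A X) s)"
    and f: "cmap W (stalk A Y) f" and Y: "Y \<in> Obj A" and q: "cycle W T q" "cycle W T q'"
    and eq: "Fm (s 0) \<cdot>\<^bsub>B\<^esub> q = Fm (s 0) \<cdot>\<^bsub>B\<^esub> q'"
  shows "Fm (f 0) \<cdot>\<^bsub>B\<^esub> q = Fm (f 0) \<cdot>\<^bsub>B\<^esub> q'"
proof -
  note [simp] = X Y cmap_simps(1-5)[OF s] cmap_simps(1-5)[OF f]
  have qH: "q \<in> Hom B T (Fo (deg W 0))" "q' \<in> Hom B T (Fo (deg W 0))"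
    and dq: "Fm (diff W 0) \<cdot>\<^bsub>B\<^esub> q = Zero B T (Fo (deg W 1))" "Fm (diff W 0) \<cdot>\<^bsub>B\<^esub> q' = Zero B T (Fo (deg W 1))"
    using q by (simp_all add: cycle_def)
  note [simp] = cod.HomD[OF qH(1)] cod.HomD[OF qH(2)]
  have [simp]: "T \<in> Obj B" using cod.Hom_Obj[OF qH(1)] by blast
  let ?r = "q \<boxplus>\<^bsub>B\<^esub> neg B q'"
  have r: "cycle W T ?r" using qH dq by (simp add: cycle_def Hom_def)
  have "Fm (s 0) \<cdot>\<^bsub>B\<^esub> ?r = Zero B T (Fo X)" by (simp add: eq)
  then obtain h where h: "h \<in> Hom B T (Fo (deg W (-1)))" "?r = Fm (diff W (-1)) \<cdot>\<^bsub>B\<^esub> h"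
    using cycle_boundary[OF X s ac r] by blast
  note [simp] = cod.HomD[OF h(1)] bounded_complex_simps(4)[of W "-1", simplified]
  have "f 0 \<cdot> diff W (-1) = Zero A (deg W (-1)) Y"
    using cmap_simps(6)[OF f, of "-1"] by simp
  from arg_cong[OF this, of Fm]
  have fd: "Fm (f 0) \<cdot>\<^bsub>B\<^esub> Fm (diff W (-1)) = Zero B (Fo (deg W (-1))) (Fo Y)" by simp
  have "Fm (f 0) \<cdot>\<^bsub>B\<^esub> ?r = Zero B T (Fo Y)"
    unfolding h(2) by (subst cod.Comp_rewrite[OF fd]) simp_all
  then have "(Fm (f 0) \<cdot>\<^bsub>B\<^esub> q) \<boxplus>\<^bsub>B\<^esub> neg B (Fm (f 0) \<cdot>\<^bsub>B\<^esub> q') = Zero B T (Fo Y)" by simp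
  then show ?thesis
    using cod.Add_eq_Zero_neg[of "Fm (f 0) \<cdot>\<^bsub>B\<^esub> q" T "Fo Y" "neg B (Fm (f 0) \<cdot>\<^bsub>B\<^esub> q')"] by (simp add: Hom_def)
qed

text \<open>With zero differentials in the stalk, the homotopy contributes only \<open>h\<close>
  after the differential of \<open>W\<close>, which vanishes on a cycle.\<close>

lemma cycle_homotopic:
  assumes fg: "cmap W (stalk A Y) f" "cmap W (stalk A Y) g" "homotopic A W (stalk A Y) f g"
    and Y: "Y \<in> Obj A" and q: "cycle W T q"
  shows "Fm (f 0) \<cdot>\<^bsub>B\<^esub> q = Fm (g 0) \<cdot>\<^bsub>B\<^esub> q"
proof -
  note [simp] = Y cmap_simps(1-5)[OF fg(1)] cmap_simps(1-5)[OF fg(2)]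
  have qH: "q \<in> Hom B T (Fo (deg W 0))" and dq: "Fm (diff W 0) \<cdot>\<^bsub>B\<^esub> q = Zero B T (Fo (deg W 1))"
    using q by (simp_all add: cycle_def)
  note [simp] = cod.HomD[OF qH]
  have [simp]: "T \<in> Obj B" using cod.Hom_Obj[OF qH] by blast
  obtain h where h: "hmap W (stalk A Y) h" "\<And>n. f n = g n \<boxplus> ((diff (stalk A Y) (n - 1) \<cdot> h n) \<boxplus> (h (n + 1) \<cdot> diff W n))"
    using fg(3) by (auto simp: homotopic_iff)
  note hh = hmap_simps[OF h(1), of 0] hmap_simps[OF h(1), of 1]
  have "f 0 = g 0 \<boxplus> (h 1 \<cdot> diff W 0)" using h(2)[of 0] hh by simp
  then show ?thesis using hh by (simp add: dq)
qed

lemma cycle_map: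
  assumes p: "cmap W V p" and q: "cycle W T q"
  shows "cycle V T (Fm (p 0) \<cdot>\<^bsub>B\<^esub> q)"
proof -
  note [simp] = cmap_simps(1-5)[OF p]
  have qH: "q \<in> Hom B T (Fo (deg W 0))" and dq: "Fm (diff W 0) \<cdot>\<^bsub>B\<^esub> q = Zero B T (Fo (deg W 1))"
    using q by (simp_all add: cycle_def)
  note [simp] = cod.HomD[OF qH]
  have [simp]: "T \<in> Obj B" using cod.Hom_Obj[OF qH] by blast
  have "diff V 0 \<cdot> p 0 = p 1 \<cdot> diff W 0" using cmap_simps(6)[OF p, of 0] by simp
  from arg_cong[OF this, of Fm] have 1: "Fm (diff V 0) \<cdot>\<^bsub>B\<^esub> Fm (p 0) = Fm (p 1) \<cdot>\<^bsub>B\<^esub> Fm (diff W 0)" by simp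
  have "Fm (diff V 0) \<cdot>\<^bsub>B\<^esub> (Fm (p 0) \<cdot>\<^bsub>B\<^esub> q) = Zero B T (Fo (deg V 1))"
    by (subst cod.Comp_rewrite[OF 1]) (simp_all add: dq)
  then show ?thesis by (simp add: cycle_def Hom_def)
qed

lemma cycle_Comp:
  assumes q: "cycle W T q" and a: "a \<in> Hom B T' T" and W: "bounded_complex A W"
  shows "cycle W T' (q \<cdot>\<^bsub>B\<^esub> a)"
proof -
  note [simp] = W cod.HomD[OF a]
  have qH: "q \<in> Hom B T (Fo (deg W 0))" and dq: "Fm (diff W 0) \<cdot>\<^bsub>B\<^esub> q = Zero B T (Fo (deg W 1))"
    using q by (simp_all add: cycle_def)
  note [simp] = cod.HomD[OF qH]
  show ?thesis
    unfolding cycle_def using cod.Comp_rewrite[OF refl, of "Fm (diff W 0)" q a]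
    by (simp add: Hom_def dq flip: cod.Comp_assoc')
qed

section \<open>The value at a roof\<close>

lemma cone_D_acyclic: "cone A W X s \<in> D \<Longrightarrow> F_acyclic (cone A W X s)"
  using D_acyclic by blast

text \<open>\<open>\<phi>\<close> is represented by a roof \<open>X \<leftarrow> W \<rightarrow> Y\<close>, and \<open>F\<close> turns its left leg into a
  quasi-isomorphism, along which the identity of \<open>F X\<close> is lifted to \<open>q\<close>.\<close>

definition evaluates ::
  "'o \<Rightarrow> 'o \<Rightarrow> (('o, 'm) cochain, ('o, 'm) htpy_arr) fraction \<Rightarrow> 'n \<Rightarrow> bool" where
  "evaluates X Y \<phi> g \<longleftrightarrow> (\<exists>W s f q. cmap W (stalk A X) s \<and> cone A W (stalk A X) s \<in> D \<and> cmap W (stalk A Y) f \<and>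
     \<phi> = roof_class (Kb A) D (stalk A X) (stalk A Y) (htpy_class A W (stalk A X) s, htpy_class A W (stalk A Y) f) \<and>
     cycle W (Fo X) q \<and> Fm (s 0) \<cdot>\<^bsub>B\<^esub> q = Ide B (Fo X) \<and> g = Fm (f 0) \<cdot>\<^bsub>B\<^esub> q)"

lemma evaluatesI:
  assumes "cmap W (stalk A X) s" "cone A W (stalk A X) s \<in> D" "cmap W (stalk A Y) f"
    "\<phi> = roof_class (Kb A) D (stalk A X) (stalk A Y) (htpy_class A W (stalk A X) s, htpy_class A W (stalk A Y) f)"
    "cycle W (Fo X) q" "Fm (s 0) \<cdot>\<^bsub>B\<^esub> q = Ide B (Fo X)" "g = Fm (f 0) \<cdot>\<^bsub>B\<^esub> q"
  shows "evaluates X Y \<phi> g"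
  using assms unfolding evaluates_def by blast

lemma Hom_verdier_stalkE:
  assumes "\<phi> \<in> Hom (verdier_quotient (Kb A) D) P Q"
  obtains W s f where "cmap W P s" "cone A W P s \<in> D" "cmap W Q f"
    "\<phi> = roof_class (Kb A) D P Q (htpy_class A W P s, htpy_class A W Q f)"
proof -
  obtain s f W where s: "s \<in> cone_in (Kb A) D" "s \<in> Hom (Kb A) W P" and f: "f \<in> Hom (Kb A) W Q"
    and \<phi>: "\<phi> = roof_class (Kb A) D P Q (s, f)"
    using assms frac.Hom_verdier by blast
  obtain s1 where s1: "cmap W P s1" "s = htpy_class A W P s1" "cone A W P s1 \<in> D"
    using s unfolding cone_in_Kb by (auto simp: Hom_def)
  obtain f1 where "cmap W Q f1" "f = htpy_class A W Q f1" using f Hom_Kb by blast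
  then show ?thesis using that s1 \<phi> by blast
qed

lemma evaluates_exists:
  assumes X: "X \<in> Obj A" and \<phi>: "\<phi> \<in> Hom (verdier_quotient (Kb A) D) (stalk A X) (stalk A Y)"
  shows "\<exists>g. evaluates X Y \<phi> g"
  using \<phi>
proof (rule Hom_verdier_stalkE)
  fix W s f
  assume *: "cmap W (stalk A X) s" "cone A W (stalk A X) s \<in> D" "cmap W (stalk A Y) f"
    "\<phi> = roof_class (Kb A) D (stalk A X) (stalk A Y) (htpy_class A W (stalk A X) s, htpy_class A W (stalk A Y) f)"
  then obtain q where "cycle W (Fo X) q" "Fm (s 0) \<cdot>\<^bsub>B\<^esub> q = Ide B (Fo X)"
    using section_exists[OF X *(1)] cone_D_acyclic by blast
  then show ?thesis using evaluatesI[OF *] by blast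
qed

lemma cone_in_class: "cmap W X s \<Longrightarrow> cone A W X s \<in> D \<Longrightarrow> htpy_class A W X s \<in> cone_in (Kb A) D"
  unfolding cone_in_Kb by blast

lemma class_roof:
  "cmap W P s \<Longrightarrow> cone A W P s \<in> D \<Longrightarrow> cmap W Q f \<Longrightarrow> (htpy_class A W P s, htpy_class A W Q f) \<in> roofs (Kb A) D P Q"
  using frac.roofsI[OF cone_in_class htpy_class_in_Hom htpy_class_in_Hom] by blast

text \<open>A lift over a common refinement maps to lifts over both roofs. By
  \<open>cycle_eq\<close> these may replace the given lifts, and the two numerators agree on the
  refinement up to homotopy.\<close>

lemma evaluates_unique:
  assumes X: "X \<in> Obj A" and Y: "Y \<in> Obj A" and "evaluates X Y \<phi> g" "evaluates X Y \<phi> g'"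
  shows "g = g'"
proof -
  let ?X = "stalk A X" and ?Y = "stalk A Y"
  obtain W s f q where s: "cmap W ?X s" "cone A W ?X s \<in> D" and f: "cmap W ?Y f"
    and \<phi>: "\<phi> = roof_class (Kb A) D ?X ?Y (htpy_class A W ?X s, htpy_class A W ?Y f)"
    and q: "cycle W (Fo X) q" "Fm (s 0) \<cdot>\<^bsub>B\<^esub> q = Ide B (Fo X)" "g = Fm (f 0) \<cdot>\<^bsub>B\<^esub> q"
    using assms(3) evaluates_def by blast
  obtain W' s' f' q' where s': "cmap W' ?X s'" "cone A W' ?X s' \<in> D" and f': "cmap W' ?Y f'"
    and \<phi>': "\<phi> = roof_class (Kb A) D ?X ?Y (htpy_class A W' ?X s', htpy_class A W' ?Y f')"
    and q': "cycle W' (Fo X) q'" "Fm (s' 0) \<cdot>\<^bsub>B\<^esub> q' = Ide B (Fo X)" "g' = Fm (f' 0) \<cdot>\<^bsub>B\<^esub> q'"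
    using assms(4) evaluates_def by blast
  have "roof_equiv (Kb A) D (htpy_class A W ?X s, htpy_class A W ?Y f) (htpy_class A W' ?X s', htpy_class A W' ?Y f')"
    using frac.roof_class_eq_iff[OF class_roof[OF s f] class_roof[OF s' f']] \<phi> \<phi>' by simp
  then obtain V P P' where P: "P \<in> Hom (Kb A) V W" "P' \<in> Hom (Kb A) V W'"
      "htpy_comp A (htpy_class A W ?X s) P = htpy_comp A (htpy_class A W' ?X s') P'"
      "htpy_comp A (htpy_class A W ?Y f) P = htpy_comp A (htpy_class A W' ?Y f') P'"
      "htpy_comp A (htpy_class A W ?X s) P \<in> cone_in (Kb A) D"
    using frac.roof_equivE[OF _ htpy_class_in_Hom[OF s(1)] htpy_class_in_Hom[OF s'(1)]] unfolding Kb_simps by blast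
  obtain p where p: "cmap V W p" "P = htpy_class A V W p" using P(1) Hom_Kb by blast
  obtain p' where p': "cmap V W' p'" "P' = htpy_class A V W' p'" using P(2) Hom_Kb by blast
  note sp = cmap_Comp[OF p(1) s(1)] and fp = cmap_Comp[OF p(1) f]
    and sp' = cmap_Comp[OF p'(1) s'(1)] and fp' = cmap_Comp[OF p'(1) f']
  have h1: "homotopic A V ?X (\<lambda>n. s n \<cdot> p n) (\<lambda>n. s' n \<cdot> p' n)"
    using P(3) htpy_class_eq_iff[OF sp sp'] htpy_comp_class s s' p p' by simp
  have h2: "homotopic A V ?Y (\<lambda>n. f n \<cdot> p n) (\<lambda>n. f' n \<cdot> p' n)"
    using P(4) htpy_class_eq_iff[OF fp fp'] htpy_comp_class f f' p p' by simp
  have "htpy_class A V ?X (\<lambda>n. s n \<cdot> p n) \<in> cone_in (Kb A) D"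
    using P(5) htpy_comp_class[OF p(1) s(1)] p(2) by simp
  \<comment> \<open>Membership in \<open>cone_in\<close> provides a homotopic representative
    \<open>k\<close> with its cone in \<open>D\<close>, not this for \<open>s p\<close> itself. A
    section of \<open>k\<close> also serves \<open>s p\<close>, by
    \<open>cycle_homotopic\<close>.\<close>
  then obtain k where k: "cmap V ?X k" "htpy_class A V ?X (\<lambda>n. s n \<cdot> p n) = htpy_class A V ?X k" "cone A V ?X k \<in> D"
    unfolding cone_in_Kb by (elim exE conjE) (metis Dom_Cod_Kb)
  have h3: "homotopic A V ?X (\<lambda>n. s n \<cdot> p n) k" using htpy_class_eq_iff[OF sp k(1)] k(2) by simp
  obtain r where r: "cycle V (Fo X) r" "Fm (k 0) \<cdot>\<^bsub>B\<^esub> r = Ide B (Fo X)"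
    using section_exists[OF X k(1) cone_D_acyclic[OF k(3)]] by blast
  have rH: "r \<in> Hom B (Fo X) (Fo (deg V 0))" using r by (simp add: cycle_def)
  note [simp] = cmap_simps(1-5)[OF p(1)] cmap_simps(1-5)[OF p'(1)] cmap_simps(1-5)[OF s(1)] cmap_simps(1-5)[OF s'(1)]
    cmap_simps(1-5)[OF f] cmap_simps(1-5)[OF f'] cod.HomD[OF rH]
  have spr: "Fm (s 0) \<cdot>\<^bsub>B\<^esub> (Fm (p 0) \<cdot>\<^bsub>B\<^esub> r) = Ide B (Fo X)"
    using cycle_homotopic[OF sp k(1) h3 X r(1)] r(2) by simp
  then have spr': "Fm (s' 0) \<cdot>\<^bsub>B\<^esub> (Fm (p' 0) \<cdot>\<^bsub>B\<^esub> r) = Ide B (Fo X)"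
    using cycle_homotopic[OF sp sp' h1 X r(1)] by simp
  have "g = Fm (f 0) \<cdot>\<^bsub>B\<^esub> (Fm (p 0) \<cdot>\<^bsub>B\<^esub> r)"
    unfolding q(3) by (rule cycle_eq[OF X s(1) cone_D_acyclic[OF s(2)] f Y q(1) cycle_map[OF p(1) r(1)]]) (simp add: q(2) spr)
  also have "\<dots> = Fm (f' 0) \<cdot>\<^bsub>B\<^esub> (Fm (p' 0) \<cdot>\<^bsub>B\<^esub> r)"
    using cycle_homotopic[OF fp fp' h2 Y r(1)] by simp
  also have "\<dots> = g'"
    unfolding q'(3) by (rule cycle_eq[OF X s'(1) cone_D_acyclic[OF s'(2)] f' Y cycle_map[OF p'(1) r(1)] q'(1)]) (simp add: q'(2) spr')
  finally show ?thesis .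
qed

lemma evaluates_Hom: "evaluates X Y \<phi> g \<Longrightarrow> g \<in> Hom B (Fo X) (Fo Y)"
proof -
  assume "evaluates X Y \<phi> g"
  then obtain W f q where f: "cmap W (stalk A Y) f" and q: "cycle W (Fo X) q" "g = Fm (f 0) \<cdot>\<^bsub>B\<^esub> q"
    unfolding evaluates_def by blast
  have "q \<in> Hom B (Fo X) (Fo (deg W 0))" using q by (simp add: cycle_def)
  then show ?thesis using q(2) cmap_simps(3-5)[OF f, of 0] by (simp add: Hom_def)
qed

lemma cmap_Ide_in_D: "bounded_complex A P \<Longrightarrow> cone A P P (\<lambda>n. Ide A (deg P n)) \<in> D"
  using D_zero[OF cone_of_heq[OF heq_Ide]] .

lemma evaluates_localization:
  assumes f: "f \<in> Hom A X Y"
  shows "evaluates X Y (roof_class (Kb A) D (stalk A X) (stalk A Y)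
    (Ide (Kb A) (stalk A X), htpy_class A (stalk A X) (stalk A Y) (stalk_map f))) (Fm f)"
proof -
  have X: "X \<in> Obj A" using Hom_Obj[OF f] by blast
  then have b: "bounded_complex A (stalk A X)" by simp
  show ?thesis
    by (rule evaluatesI[OF cmap_Ide[OF b] cmap_Ide_in_D[OF b] cmap_stalk_map[OF f], where q="Ide B (Fo X)"])
      (use X HomD[OF f] in \<open>simp_all add: cycle_def Hom_def stalk_map_def\<close>)
qed

text \<open>Let \<open>q\<close> lift the identity over the composite roof. Then \<open>f' q\<close>
  and \<open>q2 g1\<close> are cycles on \<open>V\<close>, both with image \<open>g1\<close> under
  \<open>t\<close>, so \<open>g\<close> takes the same value on them. This comparison is why cycles
  are allowed over arbitrary test objects.\<close>

lemma evaluates_Comp: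
  assumes X: "X \<in> Obj A" and Y: "Y \<in> Obj A" and Z: "Z \<in> Obj A" and g1: "evaluates X Y \<phi> g1" and g2: "evaluates Y Z \<psi> g2"
  shows "evaluates X Z (fraction_comp (Kb A) D \<psi> \<phi>) (g2 \<cdot>\<^bsub>B\<^esub> g1)"
proof -
  let ?X = "stalk A X" and ?Y = "stalk A Y" and ?Z = "stalk A Z"
  obtain W s f q1 where s: "cmap W ?X s" "cone A W ?X s \<in> D" and f: "cmap W ?Y f"
    and \<phi>: "\<phi> = roof_class (Kb A) D ?X ?Y (htpy_class A W ?X s, htpy_class A W ?Y f)"
    and q1: "cycle W (Fo X) q1" "Fm (s 0) \<cdot>\<^bsub>B\<^esub> q1 = Ide B (Fo X)" "g1 = Fm (f 0) \<cdot>\<^bsub>B\<^esub> q1"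
    using g1 evaluates_def by blast
  obtain V t g q2 where t: "cmap V ?Y t" "cone A V ?Y t \<in> D" and g: "cmap V ?Z g"
    and \<psi>: "\<psi> = roof_class (Kb A) D ?Y ?Z (htpy_class A V ?Y t, htpy_class A V ?Z g)"
    and q2: "cycle V (Fo Y) q2" "Fm (t 0) \<cdot>\<^bsub>B\<^esub> q2 = Ide B (Fo Y)" "g2 = Fm (g 0) \<cdot>\<^bsub>B\<^esub> q2"
    using g2 evaluates_def by blast
  obtain U t' f' where t': "cmap U W t'" "cone A U W t' \<in> D" and f': "cmap U V f'"
    and sq: "homotopic A U ?Y (\<lambda>n. f n \<cdot> t' n) (\<lambda>n. t n \<cdot> f' n)"
    using ore_square[OF t f] by blast
  note st' = cmap_Comp[OF t'(1) s(1)] and ft' = cmap_Comp[OF t'(1) f] and tf' = cmap_Comp[OF f' t(1)] and gf' = cmap_Comp[OF f' g]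
  have stD: "cone A U ?X (\<lambda>n. s n \<cdot> t' n) \<in> D" using cone_Comp_in_D[OF t'(1) s(1) t'(2) s(2)] .
  have sq': "Comp (Kb A) (htpy_class A W ?Y f) (htpy_class A U W t') = Comp (Kb A) (htpy_class A V ?Y t) (htpy_class A U V f')"
    using sq htpy_class_eq_iff[OF ft' tf'] htpy_comp_class[OF t'(1) f] htpy_comp_class[OF f' t(1)] by simp
  have comp: "fraction_comp (Kb A) D \<psi> \<phi> = roof_class (Kb A) D ?X ?Z
      (htpy_class A U ?X (\<lambda>n. s n \<cdot> t' n), htpy_class A U ?Z (\<lambda>n. g n \<cdot> f' n))"
    unfolding \<phi> \<psi>
    using frac.fraction_comp_class[OF htpy_class_in_Hom[OF s(1)] cone_in_class[OF s] htpy_class_in_Hom[OF f]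
        htpy_class_in_Hom[OF t(1)] cone_in_class[OF t] htpy_class_in_Hom[OF g]
        htpy_class_in_Hom[OF t'(1)] cone_in_class[OF t'] htpy_class_in_Hom[OF f'] sq']
      htpy_comp_class[OF t'(1) s(1)] htpy_comp_class[OF f' g] by simp
  obtain q where q: "cycle U (Fo X) q" "Fm (s 0 \<cdot> t' 0) \<cdot>\<^bsub>B\<^esub> q = Ide B (Fo X)"
    using section_exists[OF X st' cone_D_acyclic[OF stD]] by blast
  have qH: "q \<in> Hom B (Fo X) (Fo (deg U 0))" "q1 \<in> Hom B (Fo X) (Fo (deg W 0))" "q2 \<in> Hom B (Fo Y) (Fo (deg V 0))"
    using q q1 q2 by (simp_all add: cycle_def)
  note g1H = evaluates_Hom[OF g1] and g2H = evaluates_Hom[OF g2]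
  note [simp] = cmap_simps(1-5)[OF s(1)] cmap_simps(1-5)[OF f] cmap_simps(1-5)[OF t(1)] cmap_simps(1-5)[OF g]
    cmap_simps(1-5)[OF t'(1)] cmap_simps(1-5)[OF f'] cod.HomD[OF qH(1)] cod.HomD[OF qH(2)] cod.HomD[OF qH(3)]
    cod.HomD[OF g1H] cod.HomD[OF g2H]
  have "g1 = Fm (f 0) \<cdot>\<^bsub>B\<^esub> (Fm (t' 0) \<cdot>\<^bsub>B\<^esub> q)"
    unfolding q1(3)
    by (rule cycle_eq[OF X s(1) cone_D_acyclic[OF s(2)] f Y q1(1) cycle_map[OF t'(1) q(1)]]) (use q(2) q1(2) in simp)
  also have "\<dots> = Fm (t 0) \<cdot>\<^bsub>B\<^esub> (Fm (f' 0) \<cdot>\<^bsub>B\<^esub> q)"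
    using cycle_homotopic[OF ft' tf' sq Y q(1)] by simp
  finally have g1_eq: "g1 = Fm (t 0) \<cdot>\<^bsub>B\<^esub> (Fm (f' 0) \<cdot>\<^bsub>B\<^esub> q)" .
  have "Fm (t 0) \<cdot>\<^bsub>B\<^esub> (q2 \<cdot>\<^bsub>B\<^esub> g1) = (Fm (t 0) \<cdot>\<^bsub>B\<^esub> q2) \<cdot>\<^bsub>B\<^esub> g1" by simp
  also have "\<dots> = g1" by (simp add: q2(2))
  finally have "Fm (t 0) \<cdot>\<^bsub>B\<^esub> (q2 \<cdot>\<^bsub>B\<^esub> g1) = Fm (t 0) \<cdot>\<^bsub>B\<^esub> (Fm (f' 0) \<cdot>\<^bsub>B\<^esub> q)" using g1_eq by simp
  then have "Fm (g 0) \<cdot>\<^bsub>B\<^esub> (q2 \<cdot>\<^bsub>B\<^esub> g1) = Fm (g 0) \<cdot>\<^bsub>B\<^esub> (Fm (f' 0) \<cdot>\<^bsub>B\<^esub> q)"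
    by (intro cycle_eq[OF Y t(1) cone_D_acyclic[OF t(2)] g Z cycle_Comp[OF q2(1) g1H] cycle_map[OF f' q(1)]]) simp_all
  then have "g2 \<cdot>\<^bsub>B\<^esub> g1 = Fm (g 0 \<cdot> f' 0) \<cdot>\<^bsub>B\<^esub> q" unfolding q2(3) by simp
  then show ?thesis by (rule evaluatesI[OF st' stD gf' comp q])
qed

end

section \<open>The full subcategory on stalks\<close>

lemma full_subcat_simps [simp]:
  "Obj (full_subcat C P) = P" "Dom (full_subcat C P) = Dom C" "Cod (full_subcat C P) = Cod C"
  "Ide (full_subcat C P) = Ide C" "Comp (full_subcat C P) = Comp C"
  by (simp_all add: full_subcat_def)

lemma Hom_full_subcat: "Hom (full_subcat C P) X Y = (if X \<in> P \<and> Y \<in> P then Hom C X Y else {})"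
  by (auto simp: full_subcat_def Hom_def)

lemma (in category) category_full_subcat:
  assumes "P \<subseteq> Obj C"
  shows "category (full_subcat C P)"
proof
  fix f assume "f \<in> Arr (full_subcat C P)"
  then show "Dom (full_subcat C P) f \<in> Obj (full_subcat C P)" "Cod (full_subcat C P) f \<in> Obj (full_subcat C P)"
    by (auto simp: full_subcat_def)
qed (use assms Ide_Hom Comp_Hom Comp_Ide_left Comp_Ide_right Comp_assoc in
    \<open>auto simp: Hom_full_subcat split: if_splits\<close>)

lemma is_functor_iso_arr:
  assumes G: "is_functor C E G" and f: "f \<in> Hom C X Y" and g: "g \<in> Hom C Y X"
    and gf: "g \<cdot>\<^bsub>C\<^esub> f = Ide C X" and fg: "f \<cdot>\<^bsub>C\<^esub> g = Ide C Y"
  shows "iso_arr E (on_arr G f)"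
proof -
  interpret is_functor C E G by (rule G)
  have XY: "X \<in> Obj C" "Y \<in> Obj C" using dom.Hom_Obj[OF f] by auto
  note Gf = on_arr_Hom[OF f] and Gg = on_arr_Hom[OF g]
  have "on_arr G g \<cdot>\<^bsub>E\<^esub> on_arr G f = Ide E (on_obj G X)" "on_arr G f \<cdot>\<^bsub>E\<^esub> on_arr G g = Ide E (on_obj G Y)"
    using on_arr_Comp[OF f g] on_arr_Comp[OF g f] gf fg on_arr_Ide XY by simp_all
  then show ?thesis
    unfolding iso_arr_def using Gf Gg by (auto simp: Hom_def)
qed

context triangulated_subcategory
begin

definition loc_cat where
  "loc_cat = full_subcat (verdier_quotient (Kb A) D) (stalk A ` Obj A)"

definition loc_functor where
  "loc_functor = functor_comp (verdier_localization (Kb A) D) (stalk_functor A)"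

lemma category_loc_cat: "category loc_cat"
  unfolding loc_cat_def
  by (rule category.category_full_subcat[OF frac.category_verdier]) (auto simp: verdier_quotient_def)

lemma loc_cat_simps:
  "Obj loc_cat = stalk A ` Obj A" "Comp loc_cat = fraction_comp (Kb A) D"
  "Ide loc_cat P = roof_class (Kb A) D P P (Ide (Kb A) P, Ide (Kb A) P)"
  by (simp_all add: loc_cat_def verdier_quotient_def)

lemma Hom_loc_cat:
  "X \<in> Obj A \<Longrightarrow> Y \<in> Obj A \<Longrightarrow> Hom loc_cat (stalk A X) (stalk A Y) = Hom (verdier_quotient (Kb A) D) (stalk A X) (stalk A Y)"
  by (simp add: loc_cat_def Hom_full_subcat)

lemma Hom_loc_catE:
  assumes "\<phi> \<in> Hom loc_cat P Q"
  obtains X Y where "X \<in> Obj A" "Y \<in> Obj A" "P = stalk A X" "Q = stalk A Y"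
    "\<phi> \<in> Hom (verdier_quotient (Kb A) D) (stalk A X) (stalk A Y)"
  using assms by (auto simp: loc_cat_def Hom_full_subcat split: if_splits)

lemma loc_functor_simps:
  "on_obj loc_functor X = stalk A X"
  "f \<in> Hom A X Y \<Longrightarrow> on_arr loc_functor f = roof_class (Kb A) D (stalk A X) (stalk A Y)
     (Ide (Kb A) (stalk A X), htpy_class A (stalk A X) (stalk A Y) (stalk_map f))"
  unfolding loc_functor_def functor_comp_def verdier_localization_def
  using stalk_functor_simps by (simp_all del: Kb_simps)

lemma loc_functor_Hom:
  assumes f: "f \<in> Hom A X Y"
  shows "on_arr loc_functor f \<in> Hom loc_cat (stalk A X) (stalk A Y)"
proof -
  have XY: "X \<in> Obj A" "Y \<in> Obj A" using Hom_Obj[OF f] by auto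
  have o: "stalk A X \<in> Obj (Kb A)" using XY by simp
  show ?thesis
    unfolding Hom_loc_cat[OF XY] loc_functor_simps(2)[OF f]
    using frac.roof_class_in_Hom[OF frac.Ide_cone_in[OF o] Kb.Ide_Hom[OF o] htpy_class_in_Hom[OF cmap_stalk_map[OF f]]] .
qed

lemma loc_functor_Comp:
  assumes s: "cmap W P s" "cone A W P s \<in> D" and f: "cmap W (stalk A X) f" and g: "g \<in> Hom A X Y"
  shows "fraction_comp (Kb A) D (on_arr loc_functor g) (roof_class (Kb A) D P (stalk A X) (htpy_class A W P s, htpy_class A W (stalk A X) f))
    = roof_class (Kb A) D P (stalk A Y) (htpy_class A W P s, htpy_class A W (stalk A Y) (\<lambda>n. stalk_map g n \<cdot> f n))"
proof -
  have s': "htpy_class A W P s \<in> cone_in (Kb A) D" unfolding cone_in_Kb using s by blast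
  show ?thesis
    unfolding loc_functor_simps(2)[OF g]
      frac.fraction_comp_localization[OF htpy_class_in_Hom[OF s(1)] s' htpy_class_in_Hom[OF f] htpy_class_in_Hom[OF cmap_stalk_map[OF g]]]
    by (simp add: htpy_comp_class[OF f cmap_stalk_map[OF g]])
qed

text \<open>The inverse is the roof with legs \<open>s\<close> and the identity. One composite is
  computed by a square of identities; the other is the roof with both legs \<open>s\<close>, which
  \<open>s\<close> itself identifies with the identity.\<close>

lemma loc_functor_inverts:
  assumes s: "s \<in> Hom A X Y" and D: "arrow_cone A s \<in> D"
  shows "\<exists>\<psi> \<in> Hom loc_cat (stalk A Y) (stalk A X). Comp loc_cat \<psi> (on_arr loc_functor s) = Ide loc_cat (stalk A X) \<and>
    Comp loc_cat (on_arr loc_functor s) \<psi> = Ide loc_cat (stalk A Y)"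
proof -
  let ?X = "stalk A X" and ?Y = "stalk A Y"
  have XY: "X \<in> Obj A" "Y \<in> Obj A" using Hom_Obj[OF s] by auto
  have o: "?X \<in> Obj (Kb A)" "?Y \<in> Obj (Kb A)" using XY by simp_all
  note sm = cmap_stalk_map[OF s]
  let ?s = "htpy_class A ?X ?Y (stalk_map s)"
  have sH: "?s \<in> Hom (Kb A) ?X ?Y" using htpy_class_in_Hom[OF sm] .
  have sD: "?s \<in> cone_in (Kb A) D" unfolding cone_in_Kb using sm D_iso'[OF D cone_stalk_map[OF s]] by blast
  note i = Kb.Ide_Hom[OF o(1)] and i' = Kb.Ide_Hom[OF o(2)]
  note c = frac.Ide_cone_in[OF o(1)] and c' = frac.Ide_cone_in[OF o(2)]
  have si: "Comp (Kb A) ?s (Ide (Kb A) ?X) = ?s" using Kb.Comp_Ide_right[OF sH] .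
  have ii: "Comp (Kb A) (Ide (Kb A) ?X) (Ide (Kb A) ?X) = Ide (Kb A) ?X" using Kb.Comp_Ide_right[OF i] .
  let ?\<psi> = "roof_class (Kb A) D ?Y ?X (?s, Ide (Kb A) ?X)"
  have "?\<psi> \<in> Hom loc_cat ?Y ?X"
    unfolding Hom_loc_cat[OF XY(2,1)] using frac.roof_class_in_Hom[OF sD sH i] .
  moreover have "Comp loc_cat ?\<psi> (on_arr loc_functor s) = Ide loc_cat ?X"
    unfolding loc_cat_simps loc_functor_simps(2)[OF s]
    using frac.fraction_comp_class[OF i c sH sH sD i i c i refl] ii by (simp only: )
  moreover have "Comp loc_cat (on_arr loc_functor s) ?\<psi> = Ide loc_cat ?Y"
  proof -
    have "fraction_comp (Kb A) D (on_arr loc_functor s) ?\<psi> = roof_class (Kb A) D ?Y ?Y (?s, Comp (Kb A) ?s (Ide (Kb A) ?X))"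
      unfolding loc_functor_simps(2)[OF s] using frac.fraction_comp_localization[OF sH sD i sH] .
    also have "\<dots> = roof_class (Kb A) D ?Y ?Y (Ide (Kb A) ?Y, Ide (Kb A) ?Y)"
      unfolding si
    proof (subst frac.roof_class_eq_iff)
      show "(?s, ?s) \<in> roofs (Kb A) D ?Y ?Y" using frac.roofsI[OF sD sH sH] .
      show "(Ide (Kb A) ?Y, Ide (Kb A) ?Y) \<in> roofs (Kb A) D ?Y ?Y" using frac.roofsI[OF c' i' i'] .
      have ids: "Comp (Kb A) (Ide (Kb A) ?Y) ?s = ?s" using Kb.Comp_Ide_left[OF sH] .
      show "roof_equiv (Kb A) D (?s, ?s) (Ide (Kb A) ?Y, Ide (Kb A) ?Y)"
        by (rule frac.roof_equivI[OF i sH sH i']) (simp_all only: si ids sD)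
    qed
    finally show ?thesis unfolding loc_cat_simps .
  qed
  ultimately show ?thesis by blast
qed

end

section \<open>Existence and uniqueness of the factorization\<close>

context inverting_functor
begin

text \<open>Objects here are stalks, so the underlying object is read off in degree 0. Arrows carry
  their ends, so the description of the value depends on \<open>\<phi>\<close> alone.\<close>

definition extension where
  "extension = \<lparr>on_obj = (\<lambda>C. Fo (deg C 0)),
     on_arr = (\<lambda>\<phi>. THE g. evaluates (deg (fst \<phi>) 0) (deg (fst (snd \<phi>)) 0) \<phi> g)\<rparr>"

lemma extension_evaluates:
  assumes X: "X \<in> Obj A" and Y: "Y \<in> Obj A" and \<phi>: "\<phi> \<in> Hom (verdier_quotient (Kb A) D) (stalk A X) (stalk A Y)"
  shows "evaluates X Y \<phi> (on_arr extension \<phi>)"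
proof -
  have "fst \<phi> = stalk A X" "fst (snd \<phi>) = stalk A Y"
    using \<phi> unfolding frac.Hom_verdier roof_class_def by fastforce+
  then have "on_arr extension \<phi> = (THE g. evaluates X Y \<phi> g)" by (simp add: extension_def)
  moreover obtain g where g: "evaluates X Y \<phi> g" using evaluates_exists[OF X \<phi>] by blast
  ultimately show ?thesis
    using theI[of "evaluates X Y \<phi>" g] evaluates_unique[OF X Y _ g] by metis
qed

lemma extension_is_functor: "is_functor loc_cat B extension"
proof -
  have obj: "on_obj extension (stalk A X) = Fo X" for X by (simp add: extension_def)
  show ?thesis
  proof (intro is_functor.intro category_loc_cat is_functor_axioms.intro)
    show "category B" by (rule cod.category_axioms)
    show "on_obj extension P \<in> Obj B" if "P \<in> Obj loc_cat" for P
      using that by (auto simp: loc_cat_simps obj)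
    show "on_arr extension \<phi> \<in> Hom B (on_obj extension P) (on_obj extension Q)" if "\<phi> \<in> Hom loc_cat P Q" for \<phi> P Q
      using that
    proof (rule Hom_loc_catE)
      fix X Y assume *: "X \<in> Obj A" "Y \<in> Obj A" "P = stalk A X" "Q = stalk A Y"
        "\<phi> \<in> Hom (verdier_quotient (Kb A) D) (stalk A X) (stalk A Y)"
      show ?thesis using evaluates_Hom[OF extension_evaluates[OF *(1,2,5)]] by (simp add: * obj)
    qed
    show "on_arr extension (Ide loc_cat P) = Ide B (on_obj extension P)" if "P \<in> Obj loc_cat" for P
    proof -
      obtain X where X: "X \<in> Obj A" "P = stalk A X" using \<open>P \<in> Obj loc_cat\<close> by (auto simp: loc_cat_simps)
      have i: "Ide A X \<in> Hom A X X" using Ide_Hom[OF X(1)] .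
      have o: "stalk A X \<in> Obj (Kb A)" using X by simp
      have id: "htpy_class A (stalk A X) (stalk A X) (stalk_map (Ide A X)) = Ide (Kb A) (stalk A X)"
        unfolding Kb_simps using X
        by (subst htpy_class_eq_iff[OF cmap_stalk_map[OF i] cmap_Ide]) (auto intro!: homotopic_eqI cmap_stalk_map i simp: stalk_map_def)
      have "Ide loc_cat P \<in> Hom (verdier_quotient (Kb A) D) (stalk A X) (stalk A X)"
        unfolding loc_cat_simps X(2)
        using frac.roof_class_in_Hom[OF frac.Ide_cone_in[OF o] Kb.Ide_Hom[OF o] Kb.Ide_Hom[OF o]] .
      from extension_evaluates[OF X(1) X(1) this]
      show ?thesis
        using evaluates_unique[OF X(1) X(1)] evaluates_localization[OF i] id X by (simp add: loc_cat_simps obj del: Kb_simps)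
    qed
    show "on_arr extension (Comp loc_cat \<psi> \<phi>) = on_arr extension \<psi> \<cdot>\<^bsub>B\<^esub> on_arr extension \<phi>"
      if \<phi>: "\<phi> \<in> Hom loc_cat P Q" and \<psi>: "\<psi> \<in> Hom loc_cat Q R" for \<phi> \<psi> P Q R
    proof -
      obtain X Y where X: "X \<in> Obj A" "Y \<in> Obj A" "P = stalk A X" "Q = stalk A Y"
        "\<phi> \<in> Hom (verdier_quotient (Kb A) D) (stalk A X) (stalk A Y)"
        using \<phi> by (rule Hom_loc_catE)
      obtain Z where Z: "Z \<in> Obj A" "R = stalk A Z" using \<psi> by (rule Hom_loc_catE)
      have \<psi>': "\<psi> \<in> Hom (verdier_quotient (Kb A) D) (stalk A Y) (stalk A Z)"
        using \<psi> Hom_loc_cat[OF X(2) Z(1)] X Z by simp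
      have comp: "Comp loc_cat \<psi> \<phi> \<in> Hom (verdier_quotient (Kb A) D) (stalk A X) (stalk A Z)"
        using category.Comp_Hom[OF category_loc_cat \<phi> \<psi>] Hom_loc_cat[OF X(1) Z(1)] X Z by simp
      show ?thesis
        using evaluates_unique[OF X(1) Z(1) extension_evaluates[OF X(1) Z(1) comp]]
          evaluates_Comp[OF X(1,2) Z(1) extension_evaluates[OF X(1,2,5)] extension_evaluates[OF X(2) Z(1) \<psi>']]
        by (simp add: loc_cat_simps)
    qed
  qed
qed

lemma extension_factorizes: "functor_eq A F (functor_comp extension loc_functor)"
  unfolding functor_eq_def
proof (intro conjI ballI)
  fix X assume "X \<in> Obj A"
  show "Fo X = on_obj (functor_comp extension loc_functor) X"
    by (simp add: functor_comp_def extension_def loc_functor_simps)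
next
  fix f assume "f \<in> Arr A"
  then have f: "f \<in> Hom A (Dom A f) (Cod A f)" by (simp add: Hom_def)
  have XY: "Dom A f \<in> Obj A" "Cod A f \<in> Obj A" using Hom_Obj[OF f] by auto
  have "evaluates (Dom A f) (Cod A f) (on_arr loc_functor f) (on_arr extension (on_arr loc_functor f))"
    using extension_evaluates[OF XY] loc_functor_Hom[OF f] Hom_loc_cat[OF XY] by simp
  moreover have "evaluates (Dom A f) (Cod A f) (on_arr loc_functor f) (Fm f)"
    unfolding loc_functor_simps(2)[OF f] by (rule evaluates_localization[OF f])
  ultimately show "Fm f = on_arr (functor_comp extension loc_functor) f"
    using evaluates_unique[OF XY] by (simp add: functor_comp_def)
qed

text \<open>After refining the roof to one with \<open>U\<close> in nonnegative degrees, the arrow \<open>\<tau>\<close> from \<open>X\<close> to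
  \<open>U\<^sup>0\<close> which it defines in the quotient is annihilated by the differential of \<open>U\<close>, and so \<open>G\<close>
  takes it to a lift of the identity of \<open>F X\<close>.\<close>

lemma factorization_evaluates:
  assumes retr: "D \<subseteq> retracts_of_approximable"
    and G: "is_functor loc_cat B G" and GF: "functor_eq A F (functor_comp G loc_functor)"
    and X: "X \<in> Obj A" and Y: "Y \<in> Obj A" and \<phi>: "\<phi> \<in> Hom loc_cat (stalk A X) (stalk A Y)"
  shows "evaluates X Y \<phi> (on_arr G \<phi>)"
proof -
  let ?X = "stalk A X" and ?Y = "stalk A Y"
  have Gobj: "on_obj G (stalk A Z) = Fo Z" if "Z \<in> Obj A" for Z
    using GF that by (simp add: functor_eq_def functor_comp_def loc_functor_simps)
  have Garr: "on_arr G (on_arr loc_functor f) = Fm f" if "f \<in> Arr A" for f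
    using GF that by (simp add: functor_eq_def functor_comp_def)
  have GComp: "on_arr G (fraction_comp (Kb A) D \<beta> \<alpha>) = on_arr G \<beta> \<cdot>\<^bsub>B\<^esub> on_arr G \<alpha>"
    if "\<alpha> \<in> Hom loc_cat P Q" "\<beta> \<in> Hom loc_cat Q R" for \<alpha> \<beta> P Q R
    using is_functor.on_arr_Comp[OF G that] by (simp add: loc_cat_simps)
  obtain W s f where s: "cmap W ?X s" "cone A W ?X s \<in> D" and f: "cmap W ?Y f"
    and \<phi>_eq: "\<phi> = roof_class (Kb A) D ?X ?Y (htpy_class A W ?X s, htpy_class A W ?Y f)"
    using \<phi> Hom_loc_cat[OF X Y] Hom_verdier_stalkE by metis
  obtain U t p where t: "cmap U ?X t" "cone A U ?X t \<in> D" and p: "cmap U W p"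
    and h: "homotopic A U ?X (\<lambda>n. s n \<cdot> p n) t" and z: "\<And>n. n < 0 \<Longrightarrow> is_zero_obj A (deg U n)"
    using refine_roof[OF retr s] by blast
  note fp = cmap_Comp[OF p f] and sp = cmap_Comp[OF p s(1)]
  note [simp] = cmap_simps(1-5)[OF t(1)] cmap_simps(1-5)[OF p] cmap_simps(1-5)[OF f] X Y
  have tD: "htpy_class A U ?X t \<in> cone_in (Kb A) D" using cone_in_class[OF t] .
  have \<phi>_eq': "\<phi> = roof_class (Kb A) D ?X ?Y (htpy_class A U ?X t, htpy_class A U ?Y (\<lambda>n. f n \<cdot> p n))"
    unfolding \<phi>_eq
  proof (subst frac.roof_class_eq_iff[OF class_roof[OF s f] class_roof[OF t fp]])
    have oU: "U \<in> Obj (Kb A)" by simp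
    have e: "Comp (Kb A) (htpy_class A W ?X s) (htpy_class A U W p) = htpy_class A U ?X t"
      using htpy_comp_class[OF p s(1)] htpy_class_eq_iff[OF sp t(1)] h by simp
    show "roof_equiv (Kb A) D (htpy_class A W ?X s, htpy_class A W ?Y f) (htpy_class A U ?X t, htpy_class A U ?Y (\<lambda>n. f n \<cdot> p n))"
      by (rule frac.roof_equivI[OF htpy_class_in_Hom[OF p] Kb.Ide_Hom[OF oU] htpy_class_in_Hom[OF s(1)] htpy_class_in_Hom[OF t(1)]])
        (simp_all only: e tD Kb.Comp_Ide_right[OF htpy_class_in_Hom[OF t(1)]] Kb.Comp_Ide_right[OF htpy_class_in_Hom[OF fp]],
          simp add: htpy_comp_class[OF p f])
  qed
  define U0 where "U0 = deg U 0"
  define U1 where "U1 = deg U 1"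
  have U01 [simp]: "U0 \<in> Obj A" "U1 \<in> Obj A" by (simp_all add: U0_def U1_def)
  define pi where "pi n = (if n = 0 then Ide A U0 else Zero A (deg U n) (zero_obj A))" for n :: int
  have pi_arr [simp]: "pi n \<in> Arr A" "Dom A (pi n) = deg U n" "Cod A (pi n) = deg (stalk A U0) n" for n
    by (auto simp: pi_def U0_def)
  have pi: "cmap U (stalk A U0) pi"
  proof (rule cmapI)
    fix n
    show "diff (stalk A U0) n \<cdot> pi n = pi (n + 1) \<cdot> diff U n"
    \<comment> \<open>The vanishing of \<open>U\<close> in negative degrees enters here: commutation
      in degree -1 asks that the differential arriving in degree 0 be zero.\<close>
    proof (cases "n = -1")
      case True
      then show ?thesis using z[of n] by (intro from_zero_obj_eq) simp_all
    next
      case False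
      then show ?thesis by (intro to_zero_obj_eq) (simp_all add: zero_obj)
    qed
  qed simp_all
  \<comment> \<open>A map to a stalk is determined by its component in degree 0, so every such map
    from \<open>U\<close> factors through \<open>pi\<close>.\<close>
  have stalk_pi: "htpy_class A U (stalk A Z) (\<lambda>n. stalk_map (k 0) n \<cdot> pi n) = htpy_class A U (stalk A Z) k"
    if k: "cmap U (stalk A Z) k" for k Z
  proof -
    have k0: "k 0 \<in> Hom A U0 Z" using cmap_simps(3-5)[OF k, of 0] by (simp add: Hom_def U0_def)
    note kk = cmap_simps(1-5)[OF k]
    have "stalk_map (k 0) n \<cdot> pi n = k n" for n
    proof (cases "n = 0")
      case True
      then show ?thesis using HomD[OF k0] by (simp add: stalk_map_def pi_def)
    next
      case False
      have "Cod A (k n) = zero_obj A" using kk(5)[of n] False by simp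
      then show ?thesis using False HomD[OF k0] kk(3,4)[of n]
        by (intro to_zero_obj_eq) (simp_all add: zero_obj stalk_map_def)
    qed
    then show ?thesis using htpy_class_eq_iff[OF cmap_Comp[OF pi cmap_stalk_map[OF k0]] k]
        homotopic_eqI[OF cmap_Comp[OF pi cmap_stalk_map[OF k0]]] by blast
  qed
  define \<tau> where "\<tau> = roof_class (Kb A) D ?X (stalk A U0) (htpy_class A U ?X t, htpy_class A U (stalk A U0) pi)"
  have \<tau>: "\<tau> \<in> Hom loc_cat ?X (stalk A U0)"
    unfolding Hom_loc_cat[OF X U01(1)] \<tau>_def
    using frac.roof_class_in_Hom[OF tD htpy_class_in_Hom[OF t(1)] htpy_class_in_Hom[OF pi]] .
  have u\<tau>: "fraction_comp (Kb A) D (on_arr loc_functor g) \<tau> = roof_class (Kb A) D ?X (stalk A Z)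
      (htpy_class A U ?X t, htpy_class A U (stalk A Z) (\<lambda>n. stalk_map g n \<cdot> pi n))" if "g \<in> Hom A U0 Z" for g Z
    unfolding \<tau>_def by (rule loc_functor_Comp[OF t pi that])
  have Gu\<tau>: "on_arr G (fraction_comp (Kb A) D (on_arr loc_functor g) \<tau>) = Fm g \<cdot>\<^bsub>B\<^esub> on_arr G \<tau>" if "g \<in> Hom A U0 Z" for g Z
    using GComp[OF \<tau> loc_functor_Hom[OF that]] Garr HomD[OF that] by simp
  have q: "on_arr G \<tau> \<in> Hom B (Fo X) (Fo U0)"
    using is_functor.on_arr_Hom[OF G \<tau>] Gobj by simp
  have t0: "t 0 \<in> Hom A U0 X" and f0: "f 0 \<cdot> p 0 \<in> Hom A U0 Y" and d0: "diff U 0 \<in> Hom A U0 U1"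
    by (simp_all add: Hom_def U0_def U1_def)
  have "fraction_comp (Kb A) D (on_arr loc_functor (f 0 \<cdot> p 0)) \<tau> = \<phi>"
    unfolding u\<tau>[OF f0] \<phi>_eq' using stalk_pi[OF fp] by simp
  then have 1: "on_arr G \<phi> = Fm (f 0 \<cdot> p 0) \<cdot>\<^bsub>B\<^esub> on_arr G \<tau>" using Gu\<tau>[OF f0] by simp
  \<comment> \<open>The composite is the roof with both legs \<open>t\<close>, which represents the
    identity.\<close>
  have "fraction_comp (Kb A) D (on_arr loc_functor (t 0)) \<tau> = Ide loc_cat ?X"
    unfolding u\<tau>[OF t0] stalk_pi[OF t(1)] loc_cat_simps
  proof (subst frac.roof_class_eq_iff[OF class_roof[OF t t(1)]])
    have oX: "?X \<in> Obj (Kb A)" and oU: "U \<in> Obj (Kb A)" by simp_all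
    show "(Ide (Kb A) ?X, Ide (Kb A) ?X) \<in> roofs (Kb A) D ?X ?X"
      using frac.roofsI[OF frac.Ide_cone_in[OF oX] Kb.Ide_Hom[OF oX] Kb.Ide_Hom[OF oX]] .
    show "roof_equiv (Kb A) D (htpy_class A U ?X t, htpy_class A U ?X t) (Ide (Kb A) ?X, Ide (Kb A) ?X)"
      by (rule frac.roof_equivI[OF Kb.Ide_Hom[OF oU] htpy_class_in_Hom[OF t(1)] htpy_class_in_Hom[OF t(1)] Kb.Ide_Hom[OF oX]])
        (simp_all only: tD Kb.Comp_Ide_right[OF htpy_class_in_Hom[OF t(1)]] Kb.Comp_Ide_left[OF htpy_class_in_Hom[OF t(1)]])
  qed
  then have 2: "Fm (t 0) \<cdot>\<^bsub>B\<^esub> on_arr G \<tau> = Ide B (Fo X)"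
    using Gu\<tau>[OF t0] is_functor.on_arr_Ide[OF G, of ?X] Gobj[OF X] X by (simp add: loc_cat_simps)
  have zH: "Zero A U0 U1 \<in> Hom A U0 U1" by (rule Zero_Hom) simp_all
  \<comment> \<open>The identity of \<open>U1\<close>, placed in degree 1, contracts the projection
    followed by the differential. The result is stated as agreement with the composite by a zero
    arrow, because \<open>G\<close> is determined on images of arrows of \<open>A\<close> but is not
    assumed additive.\<close>
  have "homotopic A U (stalk A U1) (\<lambda>n. stalk_map (diff U 0) n \<cdot> pi n) (\<lambda>n. stalk_map (Zero A U0 U1) n \<cdot> pi n)"
  proof (rule homotopicI[where h="\<lambda>n. if n = 1 then Ide A U1 else Zero A (deg U n) (deg (stalk A U1) (n - 1))"])
    fix n :: int
    let ?h = "\<lambda>n. if n = 1 then Ide A U1 else Zero A (deg U n) (deg (stalk A U1) (n - 1))"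
    show "stalk_map (diff U 0) n \<cdot> pi n = (stalk_map (Zero A U0 U1) n \<cdot> pi n) \<boxplus>
        ((diff (stalk A U1) (n - 1) \<cdot> ?h n) \<boxplus> (?h (n + 1) \<cdot> diff U n))"
      by (cases "n = 0"; cases "n = 1") (auto simp: stalk_map_def pi_def U0_def U1_def)
  qed (auto simp: U1_def)
  then have "fraction_comp (Kb A) D (on_arr loc_functor (diff U 0)) \<tau> = fraction_comp (Kb A) D (on_arr loc_functor (Zero A U0 U1)) \<tau>"
    unfolding u\<tau>[OF d0] u\<tau>[OF zH]
    using htpy_class_eq_iff[OF cmap_Comp[OF pi cmap_stalk_map[OF d0]] cmap_Comp[OF pi cmap_stalk_map[OF zH]]] by simp
  then have "Fm (diff U 0) \<cdot>\<^bsub>B\<^esub> on_arr G \<tau> = Fm (Zero A U0 U1) \<cdot>\<^bsub>B\<^esub> on_arr G \<tau>"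
    using Gu\<tau>[OF d0] Gu\<tau>[OF zH] by simp
  then have "cycle U (Fo X) (on_arr G \<tau>)"
    using q cod.HomD[OF q] by (simp add: cycle_def U0_def U1_def)
  then show ?thesis
    by (rule evaluatesI[OF t fp \<phi>_eq' _ 2 1])
qed

end

theorem theorem0p1:
  fixes A :: "('o, 'm) additive_cat" and S :: "'m set"
    and A' :: "('p, 'n) additive_cat" and F :: "('o, 'm, 'p, 'n) functor_data"
  assumes "additive_category A"
    and "S \<subseteq> Arr A"
    and "additive_category A'"
    and "additive_functor A A' F"
  shows
    "((\<exists>G. is_functor (add_localization A S) A' G \<and>
           functor_eq A F (functor_comp G (add_localization_functor A S)))
        \<longleftrightarrow> (\<forall>s \<in> S. iso_arr A' (on_arr F s))) \<and>
     ((\<forall>s \<in> S. iso_arr A' (on_arr F s)) \<longrightarrow>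
        (\<forall>G G'.
           is_functor (add_localization A S) A' G \<and>
           functor_eq A F (functor_comp G (add_localization_functor A S)) \<and>
           is_functor (add_localization A S) A' G' \<and>
           functor_eq A F (functor_comp G' (add_localization_functor A S))
           \<longrightarrow> functor_eq (add_localization A S) G G'))"
proof -
  interpret additive_category A by fact
  interpret F: additive_functor A A' F by fact
  let ?D = "cones_subcat A S"
  have bd: "arrow_cone A ` S \<subseteq> Collect (bounded_complex A)" using assms(2) by auto
  interpret triangulated_subcategory A ?D
    by unfold_locales (unfold cones_subcat_def, rule strict_triangulated_generated[OF bd])
  have cones: "arrow_cone A s \<in> ?D" if "s \<in> S" for s
    using that by (auto simp: cones_subcat_def generated_triangulated_subcat_def)
  have loc: "add_localization A S = loc_cat" "add_localization_functor A S = loc_functor"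
    by (simp_all add: add_localization_def loc_cat_def add_localization_functor_def loc_functor_def)
  have gen: "?D \<subseteq> E" if "strict_triangulated_subcat (Kb A) E" "arrow_cone A ` S \<subseteq> E" for E
    using generated_subset[OF that] by (simp add: cones_subcat_def)
  have retr: "?D \<subseteq> retracts_of_approximable"
  proof (rule gen)
    show "strict_triangulated_subcat (Kb A) retracts_of_approximable" by (rule strict_triangulated_retracts)
    show "arrow_cone A ` S \<subseteq> retracts_of_approximable"
    proof
      fix C assume "C \<in> arrow_cone A ` S"
      then obtain s where s: "s \<in> S" "C = arrow_cone A s" by blast
      \<comment> \<open>The cone of an arrow occupies degrees -1 and 0, so the upper degree is
        \<open>0\<close>.\<close>
      have "approximable C"
        by (rule approximable_of_degrees[of _ 0]) (use s cones in \<open>auto simp: zero_obj\<close>)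
      then show "C \<in> retracts_of_approximable"
        unfolding retracts_of_approximable_def using s cones hretract_refl D_bounded by blast
    qed
  qed
  have iso: "iso_arr A' (on_arr F s)" if G: "is_functor loc_cat A' G" "functor_eq A F (functor_comp G loc_functor)" and s: "s \<in> S" for G s
  proof -
    have sA: "s \<in> Arr A" using s assms(2) by blast
    then have sH: "s \<in> Hom A (Dom A s) (Cod A s)" by (simp add: Hom_def)
    obtain \<psi> where "\<psi> \<in> Hom loc_cat (stalk A (Cod A s)) (stalk A (Dom A s))"
      "Comp loc_cat \<psi> (on_arr loc_functor s) = Ide loc_cat (stalk A (Dom A s))"
      "Comp loc_cat (on_arr loc_functor s) \<psi> = Ide loc_cat (stalk A (Cod A s))"
      using loc_functor_inverts[OF sH cones[OF s]] by blast
    then have "iso_arr A' (on_arr G (on_arr loc_functor s))"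
      using is_functor_iso_arr[OF G(1) loc_functor_Hom[OF sH]] by blast
    then show ?thesis using G(2) sA by (simp add: functor_eq_def functor_comp_def)
  qed
  have inv: "inverting_functor A A' F ?D" if "\<forall>s \<in> S. iso_arr A' (on_arr F s)"
  proof -
    have "?D \<subseteq> Collect F.F_acyclic"
      by (rule gen[OF F.strict_triangulated_F_acyclic]) (use that assms(2) F.F_acyclic_arrow_cone in blast)
    then show ?thesis
      by (intro inverting_functor.intro inverting_functor_axioms.intro triangulated_subcategory_axioms assms)
  qed
  have ex: "\<exists>G. is_functor loc_cat A' G \<and> functor_eq A F (functor_comp G loc_functor)" if "\<forall>s \<in> S. iso_arr A' (on_arr F s)"
    using inverting_functor.extension_is_functor[OF inv[OF that]] inverting_functor.extension_factorizes[OF inv[OF that]] by blast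
  have un: "functor_eq loc_cat G G'" if i: "\<forall>s \<in> S. iso_arr A' (on_arr F s)"
    and G: "is_functor loc_cat A' G" "functor_eq A F (functor_comp G loc_functor)"
    and G': "is_functor loc_cat A' G'" "functor_eq A F (functor_comp G' loc_functor)" for G G'
    unfolding functor_eq_def
  proof (intro conjI ballI)
    fix P assume "P \<in> Obj loc_cat"
    \<comment> \<open>Every object of the localization is a value of the localization functor, so
      its image is prescribed by \<open>F\<close>.\<close>
    then obtain X where "X \<in> Obj A" "P = on_obj loc_functor X" by (auto simp: loc_cat_simps loc_functor_simps)
    then show "on_obj G P = on_obj G' P" using G(2) G'(2) by (simp add: functor_eq_def functor_comp_def)
  next
    fix \<phi> assume "\<phi> \<in> Arr loc_cat"
    then have "\<phi> \<in> Hom loc_cat (Dom loc_cat \<phi>) (Cod loc_cat \<phi>)" by (simp add: Hom_def)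
    then obtain X Y where X: "X \<in> Obj A" "Y \<in> Obj A" and "\<phi> \<in> Hom (verdier_quotient (Kb A) ?D) (stalk A X) (stalk A Y)"
      by (rule Hom_loc_catE)
    then have \<phi>: "\<phi> \<in> Hom loc_cat (stalk A X) (stalk A Y)" using Hom_loc_cat[OF X] by simp
    \<comment> \<open>Both factorizations compute a value of the same fraction, and that value is
      unique.\<close>
    show "on_arr G \<phi> = on_arr G' \<phi>"
      using inverting_functor.evaluates_unique[OF inv[OF i] X]
        inverting_functor.factorization_evaluates[OF inv[OF i] retr G X \<phi>]
        inverting_functor.factorization_evaluates[OF inv[OF i] retr G' X \<phi>] by blast
  qed
  show ?thesis unfolding loc using iso ex un by blast
qed

end
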